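(* There is an algorithm which, given a finite set $D$, an integer $m$, and a domain $X\subseteq D^m$ (given as an explicit list), decides whether $X$ is an impossibility domain with respect to IIA + Idempotency + Non-dictatorship, in time $O\big(p(|X|,m,|D|)\cdot|D|^{m\cdot|D|^{|D|}}\big)$ for some polynomial $p$.
   Context: For $X\subseteq D^m$, write $D_j=\{x_j:x\in X\}$. An IIA aggregator of arity $n$ is $f=(f_1,\dots,f_m)$ with $f_j:D_j^n\to D_j$ such that for all $x^{(1)},\dots,x^{(n)}\in X$, $(f_1(x^{(1)}_1,\dots,x^{(n)}_1),\dots,f_m(x^{(1)}_m,\dots,x^{(n)}_m))\in X$. It is idempotent if $f_j(u,\dots,u)=u$ for all $j$ and $u\in D_j$, and a dictatorship if there is $k\in[n]$ with $f_j(u_1,\dots,u_n)=u_k$ for all $j$ and all arguments. $X$ is an impossibility domain w.r.t. IIA + Idempotency + Non-dictatorship if for no $n\ge2$ is there an idempotent non-dictatorial IIA aggregator for $X$ of arity $n$. *)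

theory Defs
  imports Complex_Main
begin

section \<open>Domains and aggregators\<close>

text \<open>
  Tuples are lists; coordinates and voters are numbered from 0.  An aggregator is a family
  \<open>f j :: 'a list \<Rightarrow> 'a\<close>, and only its values on \<open>D\<^sub>j\<^sup>n\<close> for \<open>j < m\<close> are ever inspected.
\<close>

definition tuples :: "'a set \<Rightarrow> nat \<Rightarrow> 'a list set" where
  "tuples A n = {us. length us = n \<and> set us \<subseteq> A}"

definition coord :: "'a list set \<Rightarrow> nat \<Rightarrow> 'a set" where
  "coord X j = (\<lambda>x. x ! j) ` X"

definition iia_aggregator :: "nat \<Rightarrow> 'a list set \<Rightarrow> nat \<Rightarrow> (nat \<Rightarrow> 'a list \<Rightarrow> 'a) \<Rightarrow> bool" where
  "iia_aggregator m X n f \<longleftrightarrow>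
     (\<forall>j<m. \<forall>us \<in> tuples (coord X j) n. f j us \<in> coord X j) \<and>
     (\<forall>ys \<in> tuples X n. map (\<lambda>j. f j (map (\<lambda>x. x ! j) ys)) [0..<m] \<in> X)"

definition idempotent_agg :: "nat \<Rightarrow> 'a list set \<Rightarrow> nat \<Rightarrow> (nat \<Rightarrow> 'a list \<Rightarrow> 'a) \<Rightarrow> bool" where
  "idempotent_agg m X n f \<longleftrightarrow> (\<forall>j<m. \<forall>u \<in> coord X j. f j (replicate n u) = u)"

definition dictatorship :: "nat \<Rightarrow> 'a list set \<Rightarrow> nat \<Rightarrow> (nat \<Rightarrow> 'a list \<Rightarrow> 'a) \<Rightarrow> bool" where
  "dictatorship m X n f \<longleftrightarrow> (\<exists>k<n. \<forall>j<m. \<forall>us \<in> tuples (coord X j) n. f j us = us ! k)"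

definition impossibility_domain :: "nat \<Rightarrow> 'a list set \<Rightarrow> bool" where
  "impossibility_domain m X \<longleftrightarrow>
     \<not> (\<exists>n\<ge>2. \<exists>f. iia_aggregator m X n f \<and> idempotent_agg m X n f \<and> \<not> dictatorship m X n f)"

section \<open>Random access machines\<close>

text \<open>
  The random access machine of Cook and Reckhow under the uniform cost criterion, over natural
  numbers (so subtraction is truncated).  There is no multiplication, as usual for uniform cost.
  The input is a sequence of numbers that is consumed by \<open>Read\<close>; reading past its end yields 0.
  All registers are initially 0, the machine halts when the program counter leaves the program,
  and the result is then the content of register 0.
\<close>

datatype instr =
    Const nat nat
  | Add nat nat nat
  | Sub nat nat nat
  | Load nat nat
  | Store nat nat
  | JumpPos nat nat
  | Read nat

type_synonym config = "nat \<times> nat list \<times> (nat \<Rightarrow> nat)"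

fun exec :: "instr \<Rightarrow> config \<Rightarrow> config" where
  "exec (Const i c) (pc, inp, R) = (Suc pc, inp, R(i := c))"
| "exec (Add i j k) (pc, inp, R) = (Suc pc, inp, R(i := R j + R k))"
| "exec (Sub i j k) (pc, inp, R) = (Suc pc, inp, R(i := R j - R k))"
| "exec (Load i j) (pc, inp, R) = (Suc pc, inp, R(i := R (R j)))"
| "exec (Store i j) (pc, inp, R) = (Suc pc, inp, R(R i := R j))"
| "exec (JumpPos i l) (pc, inp, R) = ((if R i > 0 then l else Suc pc), inp, R)"
| "exec (Read i) (pc, [], R) = (Suc pc, [], R(i := 0))"
| "exec (Read i) (pc, a # inp, R) = (Suc pc, inp, R(i := a))"

definition step :: "instr list \<Rightarrow> config \<Rightarrow> config" where
  "step P c = (if fst c < length P then exec (P ! fst c) c else c)"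

text \<open>
  Halted configurations are fixed points of \<open>step\<close>, so the following says that \<open>P\<close> halts on the
  given input after at most \<open>t\<close> instructions, with result \<open>r\<close>.
\<close>

definition halts_within :: "instr list \<Rightarrow> nat list \<Rightarrow> nat \<Rightarrow> nat \<Rightarrow> bool" where
  "halts_within P inp t r \<longleftrightarrow>
     (\<exists>pc inp' R. (step P ^^ t) (0, inp, \<lambda>_. 0) = (pc, inp', R) \<and> length P \<le> pc \<and> R 0 = r)"

section \<open>Inputs and time bounds\<close>

definition enumerates :: "'a list \<Rightarrow> 'a set \<Rightarrow> bool" where
  "enumerates as A \<longleftrightarrow> distinct as \<and> set as = A"

text \<open>
  Elements of \<open>D\<close> are named by arbitrary natural numbers.  The input consists of \<open>|D|\<close>, the
  elements of \<open>D\<close>, \<open>m\<close>, \<open>|X|\<close>, and the members of \<open>X\<close> one after the other, each of them written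
  as its \<open>m\<close> entries.
\<close>

definition encode_input :: "nat list \<Rightarrow> nat \<Rightarrow> nat list list \<Rightarrow> nat list" where
  "encode_input ds m xs = length ds # ds @ m # length xs # concat xs"

definition polynomial3 :: "(real \<Rightarrow> real \<Rightarrow> real \<Rightarrow> real) \<Rightarrow> bool" where
  "polynomial3 p \<longleftrightarrow>
     (\<exists>S c. finite S \<and> p = (\<lambda>x y z. \<Sum>(i, j, k)\<in>S. c i j k * x ^ i * y ^ j * z ^ k))"

end

theory Submission
  imports Defs
begin

text \<open>
  Consider an idempotent non-dictatorial aggregator of minimal arity \<open>n\<close>.  If \<open>n \<le> |D|\<close>, dummy voters
  extend it to arity \<open>|D|\<close>.  If \<open>n > |D|\<close>, then only tuples with a repetition occur, and identifying
  voters yields dictatorships.  For \<open>n \<ge> 4\<close> an ultrafilter argument as in Arrow's theorem shows that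
  these dictators agree, a contradiction.  For \<open>n = 3\<close> the three ways to identify two voters determine
  the aggregator, and it is given by one and the same function (such as majority or minority) in all
  coordinates.  So it suffices to search for aggregators of arity \<open>|D|\<close> and for ternary aggregators
  that use a single function.

  There are \<open>d\<close> to the power \<open>m * (d^d - d)\<close> idempotent candidates of the first kind, where \<open>d = |D|\<close>,
  and checking one of them against all members of \<open>X^d\<close> costs a polynomial times \<open>|X|^d \<le> d^(m * d)\<close>.
  The search is written in a small language with bounded loops, whose semantics is a total
  function, and is compiled to the random access machine.
\<close>

text \<open>The obstacle is \<open>|D| = 2\<close>. For \<open>|D| \<ge> 3\<close> a ternary
  aggregator can be padded to arity \<open>|D|\<close>, but two elements leave majority and
  minority, all of whose binary minors are dictatorships, so arity 3 has to be searched separately.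
  A ternary table for every coordinate would mean \<open>2 ^ (6 * m)\<close> candidates, more than
  the budget \<open>2 ^ (4 * m)\<close>. The way out is that a dictator must be the same voter in
  all coordinates: the three binary minors therefore leave three choices that do not depend on the
  coordinate. One common table remains, with \<open>2 ^ 6 = 64\<close> candidates, which a constant
  factor absorbs.

  On the machine side there is no multiplication. Products are repeated additions and cost time
  proportional to one factor, so this factor is always one of the small parameters. All costs are
  measured in powers of a single number \<open>q\<close> that bounds these parameters.\<close>

section \<open>Aggregators of bounded arity\<close>

definition nondictatorial :: "nat \<Rightarrow> 'a list set \<Rightarrow> nat \<Rightarrow> (nat \<Rightarrow> 'a list \<Rightarrow> 'a) \<Rightarrow> bool" where
  "nondictatorial m X n f \<longleftrightarrow>
     iia_aggregator m X n f \<and> idempotent_agg m X n f \<and> \<not> dictatorship m X n f"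

lemma impossibility_domain_iff:
  "impossibility_domain m X \<longleftrightarrow> \<not> (\<exists>n\<ge>2. \<exists>f. nondictatorial m X n f)"
  by (simp add: impossibility_domain_def nondictatorial_def)

lemma tuples_nth: "us \<in> tuples A n \<Longrightarrow> i < n \<Longrightarrow> us ! i \<in> A"
  by (auto simp: tuples_def)

lemma map_upt_in_tuples: "(\<And>i. i < n \<Longrightarrow> v i \<in> A) \<Longrightarrow> map v [0..<n] \<in> tuples A n"
  by (auto simp: tuples_def)

lemma tuple_eqI:
  "us \<in> tuples A n \<Longrightarrow> (\<And>i. i < n \<Longrightarrow> us ! i = v i) \<Longrightarrow> us = map v [0..<n]"
  by (auto simp: tuples_def intro: nth_equalityI)

lemma columns_in_tuples: "ys \<in> tuples X n \<Longrightarrow> map (\<lambda>x. x ! j) ys \<in> tuples (coord X j) n"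
  by (auto simp: tuples_def coord_def)

lemma tuples_coordE:
  assumes "us \<in> tuples (coord X j) n"
  obtains ys where "ys \<in> tuples X n" "map (\<lambda>x. x ! j) ys = us"
proof -
  have "\<exists>y. y \<in> X \<and> y ! j = us ! i" if "i < n" for i
    using tuples_nth[OF assms that] by (auto simp: coord_def)
  then obtain y where y: "\<And>i. i < n \<Longrightarrow> y i \<in> X \<and> y i ! j = us ! i" by metis
  have "map (\<lambda>x. x ! j) (map y [0..<n]) = us"
    using tuple_eqI[OF assms, of "\<lambda>i. y i ! j"] y by (simp add: comp_def)
  moreover have "map y [0..<n] \<in> tuples X n" using y by (auto intro: map_upt_in_tuples)
  ultimately show thesis using that by blast
qed

text \<open>The range condition is implied by closure: every column with entries in
  \<open>coord X j\<close> comes from a tuple of members of \<open>X\<close>, and its image is an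
  entry of a member of \<open>X\<close>.\<close>

lemma iia_aggregator_iff:
  "iia_aggregator m X n f \<longleftrightarrow>
     (\<forall>ys\<in>tuples X n. map (\<lambda>j. f j (map (\<lambda>x. x ! j) ys)) [0..<m] \<in> X)"
proof -
  have "f j us \<in> coord X j"
    if *: "\<forall>ys\<in>tuples X n. map (\<lambda>j. f j (map (\<lambda>x. x ! j) ys)) [0..<m] \<in> X"
      and "j < m" "us \<in> tuples (coord X j) n" for j us
  proof -
    from tuples_coordE[OF that(3)] obtain ys where
      ys: "ys \<in> tuples X n" "map (\<lambda>x. x ! j) ys = us" .
    from * ys(1) have "map (\<lambda>j. f j (map (\<lambda>x. x ! j) ys)) [0..<m] ! j \<in> coord X j"
      unfolding coord_def by blast
    with ys(2) that(2) show ?thesis by simp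
  qed
  then show ?thesis unfolding iia_aggregator_def by blast
qed

lemma nondictatorial_cong:
  assumes "nondictatorial m X n f"
    and eq: "\<And>j us. j < m \<Longrightarrow> us \<in> tuples (coord X j) n \<Longrightarrow> g j us = f j us"
  shows "nondictatorial m X n g"
proof -
  have "map (\<lambda>j. g j (map (\<lambda>x. x ! j) ys)) [0..<m] = map (\<lambda>j. f j (map (\<lambda>x. x ! j) ys)) [0..<m]"
    if "ys \<in> tuples X n" for ys
    using that by (auto simp: eq columns_in_tuples)
  then have "iia_aggregator m X n g \<longleftrightarrow> iia_aggregator m X n f"
    unfolding iia_aggregator_iff by (intro ball_cong refl) (simp only:)
  moreover have "replicate n u \<in> tuples (coord X j) n" if "u \<in> coord X j" for u j
    using that by (auto simp: tuples_def)
  then have "idempotent_agg m X n g \<longleftrightarrow> idempotent_agg m X n f"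
    unfolding idempotent_agg_def by (simp add: eq)
  moreover have "dictatorship m X n g \<longleftrightarrow> dictatorship m X n f"
    unfolding dictatorship_def by (simp add: eq)
  ultimately show ?thesis using assms(1) by (simp add: nondictatorial_def)
qed

text \<open>Minors in the sense of clone theory: voter \<open>i\<close> of \<open>f\<close> votes
  like new voter \<open>h i\<close>. A non-injective \<open>h\<close> identifies voters;
  \<open>h = id\<close> with more new voters adds dummies.\<close>

definition minor :: "nat \<Rightarrow> (nat \<Rightarrow> nat) \<Rightarrow> (nat \<Rightarrow> 'a list \<Rightarrow> 'a) \<Rightarrow> nat \<Rightarrow> 'a list \<Rightarrow> 'a" where
  "minor n h f j us = f j (map (\<lambda>i. us ! h i) [0..<n])"

lemma minor_aggregator:
  assumes "iia_aggregator m X n f" "idempotent_agg m X n f" "\<And>i. i < n \<Longrightarrow> h i < n'"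
  shows "iia_aggregator m X n' (minor n h f)" "idempotent_agg m X n' (minor n h f)"
proof -
  show "iia_aggregator m X n' (minor n h f)"
    unfolding iia_aggregator_iff
  proof
    fix ys assume ys: "ys \<in> tuples X n'"
    then have len: "length ys = n'" by (simp add: tuples_def)
    have "map (\<lambda>i. ys ! h i) [0..<n] \<in> tuples X n"
      using ys assms(3) by (auto intro!: map_upt_in_tuples tuples_nth)
    then have "map (\<lambda>j. f j (map (\<lambda>x. x ! j) (map (\<lambda>i. ys ! h i) [0..<n]))) [0..<m] \<in> X"
      using assms(1) by (simp only: iia_aggregator_iff)
    also have "map (\<lambda>j. f j (map (\<lambda>x. x ! j) (map (\<lambda>i. ys ! h i) [0..<n]))) [0..<m] =
      map (\<lambda>j. minor n h f j (map (\<lambda>x. x ! j) ys)) [0..<m]"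
      using assms(3) len by (auto simp: minor_def intro!: arg_cong2[where f = f])
    finally show "map (\<lambda>j. minor n h f j (map (\<lambda>x. x ! j) ys)) [0..<m] \<in> X" .
  qed
  have "map (\<lambda>i. replicate n' u ! h i) [0..<n] = replicate n u" for u :: 'a
    using assms(3) by (intro nth_equalityI) simp_all
  then show "idempotent_agg m X n' (minor n h f)"
    using assms(2) unfolding idempotent_agg_def minor_def by simp
qed

text \<open>The form in which minimality of the arity is used. One \<open>k\<close> serves all
  coordinates, which later carries information from one coordinate to another.\<close>

lemma minor_dictator:
  assumes "iia_aggregator m X n f" "idempotent_agg m X n f" "\<And>i. i < n \<Longrightarrow> h i < n'"
    and "\<not> (\<exists>g. nondictatorial m X n' g)"
  obtains k where "k < n'"
    "\<And>j v. j < m \<Longrightarrow> (\<And>q. q < n' \<Longrightarrow> v q \<in> coord X j) \<Longrightarrow> f j (map (\<lambda>i. v (h i)) [0..<n]) = v k"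
proof -
  have "dictatorship m X n' (minor n h f)"
    using minor_aggregator[of m X n f h n', OF assms(1-3)] assms(4) unfolding nondictatorial_def by blast
  then obtain k where k: "k < n'"
    "\<And>j us. j < m \<Longrightarrow> us \<in> tuples (coord X j) n' \<Longrightarrow> minor n h f j us = us ! k"
    unfolding dictatorship_def by blast
  have "f j (map (\<lambda>i. v (h i)) [0..<n]) = v k"
    if "j < m" "\<And>q. q < n' \<Longrightarrow> v q \<in> coord X j" for j v
  proof -
    have "map v [0..<n'] \<in> tuples (coord X j) n'" using that(2) by (rule map_upt_in_tuples)
    from k(2)[OF that(1) this] k(1) have "minor n h f j (map v [0..<n']) = v k" by simp
    moreover have "map (\<lambda>i. map v [0..<n'] ! h i) [0..<n] = map (\<lambda>i. v (h i)) [0..<n]"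
      using assms(3) by simp
    ultimately show ?thesis by (simp add: minor_def)
  qed
  with k(1) show thesis using that by blast
qed

text \<open>Voters from \<open>n\<close> on are dummies. If one of them were a dictator, letting all
  dummies copy voter 0 would make voter 0 a dictator of \<open>f\<close>.\<close>

lemma nondictatorial_pad:
  assumes "nondictatorial m X n f" "0 < n" "n \<le> n'"
  shows "nondictatorial m X n' (minor n id f)"
proof -
  have "\<not> dictatorship m X n' (minor n id f)"
  proof
    assume "dictatorship m X n' (minor n id f)"
    then obtain k where k: "k < n'"
      "\<And>j us. j < m \<Longrightarrow> us \<in> tuples (coord X j) n' \<Longrightarrow> minor n id f j us = us ! k"
      unfolding dictatorship_def by blast
    have "f j us = us ! (if k < n then k else 0)" if "j < m" "us \<in> tuples (coord X j) n" for j us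
    proof -
      let ?vs = "map (\<lambda>i. us ! (if i < n then i else 0)) [0..<n']"
      have "?vs \<in> tuples (coord X j) n'"
        using that(2) assms(2) by (auto intro!: map_upt_in_tuples tuples_nth)
      from k(2)[OF that(1) this] k(1)
      have "minor n id f j ?vs = us ! (if k < n then k else 0)" by simp
      moreover have "map (\<lambda>i. ?vs ! id i) [0..<n] = us"
        using assms(3) that(2) by (auto simp: tuples_def intro!: nth_equalityI)
      ultimately show ?thesis unfolding minor_def by simp
    qed
    moreover have "(if k < n then k else 0) < n" using assms(2) by simp
    ultimately show False using assms(1) unfolding nondictatorial_def dictatorship_def by blast
  qed
  then show ?thesis
    using minor_aggregator[of m X n f id n'] assms unfolding nondictatorial_def by auto
qed

text \<open>The sets \<open>A\<close> of voters with \<open>U A\<close> below form an ultrafilter, as in proofs of Arrow's theorem: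
  every partition of the voters into three blocks has exactly one block in it.\<close>

lemma dictator_on_noninjective:
  assumes n: "n \<ge> 4" and f: "iia_aggregator m X n f" "idempotent_agg m X n f"
    and dict: "\<not> (\<exists>g. nondictatorial m X (n - 1) g)"
    and j0: "j0 < m" "a \<in> coord X j0" "b \<in> coord X j0" "a \<noteq> b"
  shows "\<exists>k<n. \<forall>j<m. \<forall>us\<in>tuples (coord X j) n. \<not> distinct us \<longrightarrow> f j us = us ! k"
proof -
  \<comment> \<open>Coalition \<open>A\<close> votes \<open>a\<close> and the others vote
    \<open>b\<close> in coordinate \<open>j0\<close>; \<open>U A\<close> says that \<open>A\<close>
    wins.\<close>
  define ab where "ab A = map (\<lambda>i. if i \<in> A then a else b) [0..<n]" for A
  define U where "U A \<longleftrightarrow> f j0 (ab A) = a" for A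
  have split: "U (A \<union> B) \<and> (U A \<or> U B)" if "A \<inter> B = {}" "U A \<or> U (A \<union> B)" for A B
  proof -
    define h where "h i = (if i \<in> A then 0 else if i \<in> B then 1 else 2 :: nat)" for i
    \<comment> \<open>The three blocks \<open>A\<close>, \<open>B\<close> and the rest need three
      voters in the minor, hence \<open>n - 1 \<ge> 3\<close>.\<close>
    have "i < n \<Longrightarrow> h i < n - 1" for i using n by (auto simp: h_def)
    from minor_dictator[of m X n f h "n - 1", OF f this dict] obtain k where k:
      "\<And>j v. j < m \<Longrightarrow> (\<And>q. q < n - 1 \<Longrightarrow> v q \<in> coord X j) \<Longrightarrow>
        f j (map (\<lambda>i. v (h i)) [0..<n]) = v k" by metis
    have kc: "f j0 (map (\<lambda>i. if h i \<in> C then a else b) [0..<n]) = (if k \<in> C then a else b)" for C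
      using k[of j0 "\<lambda>q. if q \<in> C then a else b"] j0 by simp
    have "ab (A \<union> B) = map (\<lambda>i. if h i \<in> {0,1} then a else b) [0..<n]"
      "ab A = map (\<lambda>i. if h i \<in> {0} then a else b) [0..<n]"
      "ab B = map (\<lambda>i. if h i \<in> {1} then a else b) [0..<n]"
      using that(1) by (auto simp: ab_def h_def)
    then have "U (A \<union> B) \<longleftrightarrow> k \<in> {0,1}" "U A \<longleftrightarrow> k \<in> {0}" "U B \<longleftrightarrow> k \<in> {1}"
      unfolding U_def using kc[of "{0,1}"] kc[of "{0}"] kc[of "{1}"] j0(4) by simp_all
    then show ?thesis using that(2) by blast
  qed
  have up: "U B" if "U A" "A \<subseteq> B" for A B
    using split[of A "B - A"] that by (simp add: Un_absorb1)
  have const: "map (\<lambda>i. u) [0..<n] = replicate n u" for u :: 'a by (simp add: map_replicate_const)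
  have "ab {..<n} = map (\<lambda>i. a) [0..<n]" "ab {} = map (\<lambda>i. b) [0..<n]" by (auto simp: ab_def)
  then have "U {..<n}" "\<not> U {}"
    using f(2) j0 unfolding U_def idempotent_agg_def const by auto
  \<comment> \<open>An ultrafilter on a finite set is principal: \<open>split\<close> removes voters
    from the winning set of all voters one at a time.\<close>
  obtain k where k: "k < n" "U {k}"
  proof -
    have "\<exists>k<n. U {k}" if "finite A" "A \<subseteq> {..<n}" "U A" for A
      using that
    proof (induction A rule: finite_induct)
      case (insert x A)
      then have "U {x} \<or> U A" using split[of "{x}" A] by simp
      then show ?case using insert by auto
    qed (use \<open>\<not> U {}\<close> in simp)
    from this[of "{..<n}"] \<open>U {..<n}\<close> that show thesis by blast
  qed
  have "f j us = us ! k" if "j < m" and us: "us \<in> tuples (coord X j) n" "\<not> distinct us" for j us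
  proof -
    have len: "length us = n" using us(1) by (simp add: tuples_def)
    with us(2) obtain i l where il: "i < n" "l < n" "i < l" "us ! i = us ! l"
      unfolding distinct_conv_nth by (metis linorder_neqE_nat)
    \<comment> \<open>Voter \<open>l\<close> is identified with \<open>i\<close>, and the voters
      after \<open>l\<close> move down by one; \<open>v\<close> lists the votes of the remaining
      voters.\<close>
    define h where "h t = (if t = l then i else if t < l then t else t - 1)" for t
    define v where "v q = us ! (if q < l then q else Suc q)" for q
    have h: "t < n \<Longrightarrow> h t < n - 1" for t using il by (auto simp: h_def)
    from minor_dictator[of m X n f h "n - 1", OF f h dict] obtain k' where k':
      "\<And>j v. j < m \<Longrightarrow> (\<And>q. q < n - 1 \<Longrightarrow> v q \<in> coord X j) \<Longrightarrow>
        f j (map (\<lambda>i. v (h i)) [0..<n]) = v k'" by metis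
    have vh: "v (h t) = us ! t" if "t < n" for t
      using il that by (auto simp: v_def h_def)
    have "v q \<in> coord X j" if "q < n - 1" for q
      using that us(1) unfolding v_def by (auto intro!: tuples_nth)
    from k'[OF \<open>j < m\<close> this] have "f j (map (\<lambda>t. v (h t)) [0..<n]) = v k'" .
    also have "map (\<lambda>t. v (h t)) [0..<n] = us"
      using vh len by (auto intro!: nth_equalityI)
    finally have "f j us = v k'" .
    \<comment> \<open>Otherwise the voters \<open>t\<close> with \<open>h t = h k\<close>, who
      include \<open>k\<close> and so form a winning coalition, would lose against the dictator
      \<open>k'\<close> of this minor in coordinate \<open>j0\<close>.\<close>
    moreover have "k' = h k"
    proof (rule ccontr)
      assume "k' \<noteq> h k"
      have "f j0 (map (\<lambda>t. if h t = h k then a else b) [0..<n]) = b"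
        using k'[of j0 "\<lambda>q. if q = h k then a else b"] j0 \<open>k' \<noteq> h k\<close> by auto
      then have "\<not> U {t. h t = h k}" using j0(4) by (simp add: U_def ab_def)
      then show False using up[OF k(2)] by auto
    qed
    ultimately show ?thesis using vh[OF k(1)] by simp
  qed
  with k(1) show ?thesis by blast
qed

lemma not_distinct_tuple:
  assumes "finite A" "card A < n" "us \<in> tuples A n" shows "\<not> distinct us"
proof
  assume "distinct us"
  then have "card (set us) = n" using distinct_card assms(3) unfolding tuples_def by fastforce
  moreover have "card (set us) \<le> card A" using assms(1,3) by (intro card_mono) (auto simp: tuples_def)
  ultimately show False using assms(2) by simp
qed

text \<open>Every occurring triple repeats an entry, so it belongs to one of three binary minors.
  Each minor is a dictatorship with a dictator common to all coordinates, so the value depends on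
  the triple alone.\<close>

lemma ternary_uniform:
  assumes D: "\<And>j us. j < m \<Longrightarrow> us \<in> tuples (coord X j) 3 \<Longrightarrow> \<not> distinct us"
    and f: "nondictatorial m X 3 f" and dict: "\<not> (\<exists>g. nondictatorial m X 2 g)"
  shows "\<exists>g. nondictatorial m X 3 (\<lambda>_. g)"
proof -
  have agg: "iia_aggregator m X 3 f" "idempotent_agg m X 3 f"
    using f by (auto simp: nondictatorial_def)
  have up3: "[0..<3] = [0, 1, 2]" by (simp add: upt_rec)
  \<comment> \<open>Voter \<open>p\<close> votes \<open>y\<close> against the \<open>x\<close> of
    the other two; \<open>k = 0\<close> means that the pair wins, any other \<open>k\<close> that
    \<open>p\<close> does.\<close>
  have "\<exists>k. \<forall>j<m. \<forall>x\<in>coord X j. \<forall>y\<in>coord X j.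
      f j (map (\<lambda>i. if i = p then y else x) [0..<3]) = (if k = (0::nat) then x else y)" for p
  proof -
    define h where "h i = (if i = p then 1 else 0 :: nat)" for i
    have h: "i < 3 \<Longrightarrow> h i < 2" for i by (simp add: h_def)
    from minor_dictator[of m X 3 f h 2, OF agg h dict] obtain k where k:
      "\<And>j v. j < m \<Longrightarrow> (\<And>q. q < 2 \<Longrightarrow> v q \<in> coord X j) \<Longrightarrow>
        f j (map (\<lambda>i. v (h i)) [0..<3]) = v k" by metis
    show ?thesis
    proof (intro exI[of _ k] allI impI ballI)
      fix j x y assume "j < m" "x \<in> coord X j" "y \<in> coord X j"
      then have "f j (map (\<lambda>i. if h i = 0 then x else y) [0..<3]) = (if k = 0 then x else y)"
        using k[of j "\<lambda>q. if q = 0 then x else y"] by simp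
      moreover have "map (\<lambda>i. if h i = 0 then x else y) [0..<3] =
        map (\<lambda>i. if i = p then y else x) [0..<3]" by (simp add: h_def)
      ultimately show "f j (map (\<lambda>i. if i = p then y else x) [0..<3]) = (if k = 0 then x else y)"
        by simp
    qed
  qed note minor = this
  obtain k1 :: nat where k1: "\<forall>j<m. \<forall>x\<in>coord X j. \<forall>y\<in>coord X j.
      f j [x, x, y] = (if k1 = 0 then x else y)"
    using minor[of 2] by (auto simp: up3)
  obtain k2 :: nat where k2: "\<forall>j<m. \<forall>x\<in>coord X j. \<forall>y\<in>coord X j.
      f j [x, y, x] = (if k2 = 0 then x else y)"
    using minor[of 1] by (auto simp: up3)
  obtain k3 :: nat where k3: "\<forall>j<m. \<forall>x\<in>coord X j. \<forall>y\<in>coord X j.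
      f j [y, x, x] = (if k3 = 0 then x else y)"
    using minor[of 0] by (auto simp: up3)
  \<comment> \<open>All three constants zero gives majority, all nonzero gives minority. The last
    branch is meant for \<open>us ! 1 = us ! 2\<close>.\<close>
  define g where "g us =
    (if us ! 0 = us ! 1 then if k1 = 0 then us ! 0 else us ! 2
     else if us ! 0 = us ! 2 then if k2 = 0 then us ! 0 else us ! 1
     else if k3 = 0 then us ! 1 else us ! 0)" for us :: "'a list"
  have "g us = f j us" if j: "j < m" and us: "us \<in> tuples (coord X j) 3" for j us
  proof -
    obtain x y z where xyz: "us = [x, y, z]"
      using us unfolding tuples_def by (auto simp: eval_nat_numeral length_Suc_conv)
    with us have "x \<in> coord X j" "y \<in> coord X j" "z \<in> coord X j" by (auto simp: tuples_def)
    moreover have "x = y \<or> x = z \<or> y = z" using D[OF j us] by (auto simp: xyz)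
    ultimately show ?thesis using k1 k2 k3 j by (auto simp: g_def xyz)
  qed
  then show ?thesis using nondictatorial_cong[OF f, of "\<lambda>_. g"] by auto
qed

theorem impossibility_domain_search:
  assumes D: "finite D" "D \<noteq> {}" and X: "X \<subseteq> tuples D m"
  shows "impossibility_domain m X \<longleftrightarrow>
    \<not> (\<exists>f. nondictatorial m X (card D) f) \<and> \<not> (\<exists>g. nondictatorial m X 3 (\<lambda>_. g))"
proof
  assume imp: "impossibility_domain m X"
  have "\<not> nondictatorial m X (card D) f" for f
  proof (cases "card D \<ge> 2")
    \<comment> \<open>Arity 1 is outside the scope of \<open>impossibility_domain\<close>, but a
      unary idempotent aggregator is the identity in every coordinate.\<close>
    case False
    with D have "card D = 1" by (metis One_nat_def Suc_1 Suc_leI card_gt_0_iff le_neq_implies_less)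
    have "f j us = us ! 0"
      if *: "idempotent_agg m X 1 f" "j < m" "us \<in> tuples (coord X j) 1" for j us
    proof -
      obtain u where "us = [u]" using *(3) by (auto simp: tuples_def length_Suc_conv)
      with * show ?thesis by (auto simp: idempotent_agg_def tuples_def)
    qed
    then show ?thesis unfolding \<open>card D = 1\<close> nondictatorial_def dictatorship_def by auto
  qed (use imp in \<open>auto simp: impossibility_domain_iff\<close>)
  moreover have "\<not> nondictatorial m X 3 (\<lambda>_. g)" for g
  proof -
    have "(2 :: nat) \<le> 3" by simp
    then show ?thesis using imp unfolding impossibility_domain_iff by blast
  qed
  ultimately show "\<not> (\<exists>f. nondictatorial m X (card D) f) \<and> \<not> (\<exists>g. nondictatorial m X 3 (\<lambda>_. g))"
    by blast
next
  assume no: "\<not> (\<exists>f. nondictatorial m X (card D) f) \<and> \<not> (\<exists>g. nondictatorial m X 3 (\<lambda>_. g))"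
  have coordD: "coord X j \<subseteq> D" if "j < m" for j
    using X that by (auto simp: coord_def dest!: subsetD intro: tuples_nth)
  have tup: "us \<in> tuples D n" if "us \<in> tuples (coord X j) n" "j < m" for us j n
    using coordD[OF that(2)] that(1) by (auto simp: tuples_def)
  have "\<not> nondictatorial m X n f" if "n \<ge> 2" for n f
    using that
  proof (induction n arbitrary: f rule: less_induct)
    case (less n)
    show ?case
    proof
      assume f: "nondictatorial m X n f"
      then have agg: "iia_aggregator m X n f" "idempotent_agg m X n f" "\<not> dictatorship m X n f"
        by (auto simp: nondictatorial_def)
      have gt: "card D < n"
        using nondictatorial_pad[OF f, of "card D"] no less.prems by force
      then have nd: "\<not> distinct us" if "us \<in> tuples (coord X j) n" "j < m" for us j
        using not_distinct_tuple[OF D(1)] tup that by blast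
      \<comment> \<open>Two values in one coordinate are needed to tell dictators apart, and they
        force \<open>card D \<ge> 2\<close>, hence \<open>n \<ge> 3\<close>. Without them
        idempotency makes voter 0 a dictator.\<close>
      have "\<exists>j0<m. \<exists>a\<in>coord X j0. \<exists>b\<in>coord X j0. a \<noteq> b"
      proof (rule ccontr)
        assume eq: "\<not> (\<exists>j0<m. \<exists>a\<in>coord X j0. \<exists>b\<in>coord X j0. a \<noteq> b)"
        have "f j us = us ! 0" if "j < m" "us \<in> tuples (coord X j) n" for j us
        proof -
          have u0: "us ! 0 \<in> coord X j" using tuples_nth[OF that(2)] less.prems by simp
          have "us = map (\<lambda>_. us ! 0) [0..<n]"
            using tuple_eqI[OF that(2)] tuples_nth[OF that(2)] u0 eq that(1) by metis
          then have "us = replicate n (us ! 0)" by (simp add: map_replicate_const)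
          then show ?thesis using agg(2) u0 that(1) unfolding idempotent_agg_def by metis
        qed
        then have "dictatorship m X n f" unfolding dictatorship_def using less.prems by force
        with agg(3) show False ..
      qed
      then obtain j0 a b where j0: "j0 < m" "a \<in> coord X j0" "b \<in> coord X j0" "a \<noteq> b" by blast
      have "{a, b} \<subseteq> D" using j0 coordD by blast
      then have "card {a, b} \<le> card D" using D(1) by (rule card_mono[rotated])
      then have "n \<ge> 3" using gt j0(4) by simp
      then have dict: "\<not> (\<exists>g. nondictatorial m X (n - 1) g)" using less.IH[of "n - 1"] by auto
      show False
      proof (cases "n = 3")
        case True
        then show False using ternary_uniform[of m X f] nd f dict no by auto
      next
        case False
        with \<open>n \<ge> 3\<close> have "n \<ge> 4" by simp
        from dictator_on_noninjective[OF this agg(1,2) dict j0] nd agg(3)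
        show False unfolding dictatorship_def by blast
      qed
    qed
  qed
  then show "impossibility_domain m X" by (auto simp: impossibility_domain_iff)
qed

section \<open>A language of bounded loops\<close>

datatype expr = Num nat | Cell nat expr | Plus expr expr | Minus expr expr

datatype com =
    Skip
  | Assign nat expr expr
  | Input nat expr
  | Seq com com (infixr ";;" 60)
  | Cond expr com com
  | Repeat expr com

type_synonym mem = "nat \<Rightarrow> nat \<Rightarrow> nat"
type_synonym state = "nat list \<times> mem"

primrec eval :: "expr \<Rightarrow> mem \<Rightarrow> nat" where
  "eval (Num c) M = c"
| "eval (Cell a e) M = M a (eval e M)"
| "eval (Plus e1 e2) M = eval e1 M + eval e2 M"
| "eval (Minus e1 e2) M = eval e1 M - eval e2 M"

definition upd :: "nat \<Rightarrow> nat \<Rightarrow> nat \<Rightarrow> mem \<Rightarrow> mem" where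
  "upd a i v M = M(a := (M a)(i := v))"

lemma upd_apply [simp]: "upd a i v M b k = (if b = a \<and> k = i then v else M b k)"
  by (simp add: upd_def)

text \<open>The count of \<open>Repeat\<close> is evaluated once on entry, so the body may overwrite
  the cells it depends on, and termination is automatic.\<close>

primrec run :: "com \<Rightarrow> state \<Rightarrow> state" where
  "run Skip s = s"
| "run (Assign a e1 e2) s = (fst s, upd a (eval e1 (snd s)) (eval e2 (snd s)) (snd s))"
| "run (Input a e) s =
     (tl (fst s), upd a (eval e (snd s)) (case fst s of [] \<Rightarrow> 0 | x # _ \<Rightarrow> x) (snd s))"
| "run (c1 ;; c2) s = run c2 (run c1 s)"
| "run (Cond e c1 c2) s = (if eval e (snd s) > 0 then run c1 s else run c2 s)"
| "run (Repeat e c) s = (run c ^^ eval e (snd s)) s"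

text \<open>Expressions compile to jump-free code, so this is both its length and its running time.
  The 7 is the address computation, 6 instructions, and the load.\<close>

primrec ecost :: "expr \<Rightarrow> nat" where
  "ecost (Num c) = 1"
| "ecost (Cell a e) = ecost e + 7"
| "ecost (Plus e1 e2) = ecost e1 + ecost e2 + 1"
| "ecost (Minus e1 e2) = ecost e1 + ecost e2 + 1"

text \<open>Exact step counts. The zero branch of \<open>Cond\<close> pays 2 for an unconditional
  jump. A loop pays 2 to reach its test and 1 for the failing test; each round pays 3 for the test
  and the decrement.\<close>

primrec cost :: "com \<Rightarrow> state \<Rightarrow> nat" where
  "cost Skip s = 0"
| "cost (Assign a e1 e2) s = ecost e1 + ecost e2 + 7"
| "cost (Input a e) s = ecost e + 8"
| "cost (c1 ;; c2) s = cost c1 s + cost c2 (run c1 s)"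
| "cost (Cond e c1 c2) s = ecost e + 1 + (if eval e (snd s) > 0 then cost c1 s else cost c2 s + 2)"
| "cost (Repeat e c) s =
     ecost e + 3 + (\<Sum>k<eval e (snd s). cost c ((run c ^^ k) s) + 3)"

section \<open>Compilation\<close>

text \<open>
  Temporaries live in the registers divisible by 16, and cell \<open>i\<close> of array \<open>a < 15\<close> in register
  \<open>16 * i + a + 1\<close>.  This makes an address computable from its index without multiplication,
  keeps the arrays disjoint, and does not bound their lengths.
\<close>

definition tmp :: "nat \<Rightarrow> nat" where
  "tmp t = 16 * t"

text \<open>Four doublings multiply by 16; \<open>tmp (Suc t)\<close> is scratch space.\<close>

definition addr :: "nat \<Rightarrow> nat \<Rightarrow> instr list" where
  "addr t a = [Add (tmp t) (tmp t) (tmp t), Add (tmp t) (tmp t) (tmp t),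
     Add (tmp t) (tmp t) (tmp t), Add (tmp t) (tmp t) (tmp t), Const (tmp (Suc t)) (a+1), Add (tmp t) (tmp t) (tmp (Suc t))]"

primrec ecode :: "nat \<Rightarrow> expr \<Rightarrow> instr list" where
  "ecode t (Num c) = [Const (tmp t) c]"
| "ecode t (Cell a e) = ecode t e @ addr t a @ [Load (tmp t) (tmp t)]"
| "ecode t (Plus e1 e2) = ecode t e1 @ ecode (Suc t) e2 @ [Add (tmp t) (tmp t) (tmp (Suc t))]"
| "ecode t (Minus e1 e2) = ecode t e1 @ ecode (Suc t) e2 @ [Sub (tmp t) (tmp t) (tmp (Suc t))]"

primrec clen :: "com \<Rightarrow> nat" where
  "clen Skip = 0"
| "clen (Assign a e1 e2) = ecost e1 + ecost e2 + 7"
| "clen (Input a e) = ecost e + 8"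
| "clen (c1 ;; c2) = clen c1 + clen c2"
| "clen (Cond e c1 c2) = ecost e + clen c1 + clen c2 + 3"
| "clen (Repeat e c) = ecost e + clen c + 5"

text \<open>Jump targets are absolute, so the start \<open>p\<close> and the separately defined
  lengths \<open>clen\<close> are needed. Unconditional jumps test a constant 1. The loop test
  stands at the end of the loop; the counter stays in \<open>tmp t\<close> while the body uses
  temporaries from \<open>Suc t\<close> on.\<close>

primrec ccode :: "nat \<Rightarrow> nat \<Rightarrow> com \<Rightarrow> instr list" where
  "ccode t p Skip = []"
| "ccode t p (Assign a e1 e2) =
     ecode t e1 @ addr t a @ ecode (Suc t) e2 @ [Store (tmp t) (tmp (Suc t))]"
| "ccode t p (Input a e) = ecode t e @ addr t a @ [Read (tmp (Suc t)), Store (tmp t) (tmp (Suc t))]"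
| "ccode t p (c1 ;; c2) = ccode t p c1 @ ccode t (p + clen c1) c2"
| "ccode t p (Cond e c1 c2) =
     ecode t e @ [JumpPos (tmp t) (p + ecost e + clen c2 + 3)] @ ccode t (p + ecost e + 1) c2 @
     [Const (tmp t) 1, JumpPos (tmp t) (p + clen (Cond e c1 c2))] @
     ccode t (p + ecost e + clen c2 + 3) c1"
| "ccode t p (Repeat e c) =
     ecode t e @ [Const (tmp (Suc t)) 1, JumpPos (tmp (Suc t)) (p + ecost e + clen c + 4)] @
     ccode (Suc t) (p + ecost e + 2) c @
     [Const (tmp (Suc t)) 1, Sub (tmp t) (tmp t) (tmp (Suc t)), JumpPos (tmp t) (p + ecost e + 2)]"

primrec ewf :: "expr \<Rightarrow> bool" where
  "ewf (Num c) \<longleftrightarrow> True"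
| "ewf (Cell a e) \<longleftrightarrow> a < 15 \<and> ewf e"
| "ewf (Plus e1 e2) \<longleftrightarrow> ewf e1 \<and> ewf e2"
| "ewf (Minus e1 e2) \<longleftrightarrow> ewf e1 \<and> ewf e2"

primrec wf_com :: "com \<Rightarrow> bool" where
  "wf_com Skip \<longleftrightarrow> True"
| "wf_com (Assign a e1 e2) \<longleftrightarrow> a < 15 \<and> ewf e1 \<and> ewf e2"
| "wf_com (Input a e) \<longleftrightarrow> a < 15 \<and> ewf e"
| "wf_com (c1 ;; c2) \<longleftrightarrow> wf_com c1 \<and> wf_com c2"
| "wf_com (Cond e c1 c2) \<longleftrightarrow> ewf e \<and> wf_com c1 \<and> wf_com c2"
| "wf_com (Repeat e c) \<longleftrightarrow> ewf e \<and> wf_com c"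

lemma length_addr [simp]: "length (addr t a) = 6"
  by (simp add: addr_def)

lemma length_ecode [simp]: "length (ecode t e) = ecost e"
  by (induction e arbitrary: t) auto

lemma length_ccode [simp]: "length (ccode t p c) = clen c"
  by (induction c arbitrary: t p) auto

section \<open>Simulation of the language by the machine\<close>

definition code_at :: "instr list \<Rightarrow> nat \<Rightarrow> instr list \<Rightarrow> bool" where
  "code_at P p c \<longleftrightarrow> p + length c \<le> length P \<and> (\<forall>i<length c. P ! (p + i) = c ! i)"

lemma code_at_append:
  "code_at P p (c1 @ c2) \<longleftrightarrow> code_at P p c1 \<and> code_at P (p + length c1) c2"
proof -
  have "(\<forall>i<length c1 + length c2. P ! (p + i) = (c1 @ c2) ! i) \<longleftrightarrow>
    (\<forall>i<length c1. P ! (p + i) = c1 ! i) \<and> (\<forall>i<length c2. P ! (p + length c1 + i) = c2 ! i)"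
    (is "?L \<longleftrightarrow> ?R")
  proof
    assume L: ?L
    show ?R
    proof (intro conjI allI impI)
      fix i assume "i < length c1" then show "P ! (p + i) = c1 ! i"
        using L[rule_format, of i] by (simp add: nth_append)
    next
      fix i assume "i < length c2" then show "P ! (p + length c1 + i) = c2 ! i"
        using L[rule_format, of "length c1 + i"] by (simp add: nth_append add.assoc)
    qed
  next
    assume R: ?R
    show ?L
    proof (intro allI impI)
      fix i assume "i < length c1 + length c2"
      then show "P ! (p + i) = (c1 @ c2) ! i"
        using R[THEN conjunct1, rule_format, of i] R[THEN conjunct2, rule_format, of "i - length c1"]
        by (cases "i < length c1") (auto simp: nth_append)
    qed
  qed
  then show ?thesis by (auto simp: code_at_def)
qed

lemma code_at_Nil [simp]: "code_at P p [] \<longleftrightarrow> p \<le> length P"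
  by (simp add: code_at_def)

lemma code_at_Cons:
  "code_at P p (i # c) \<longleftrightarrow> p < length P \<and> P ! p = i \<and> code_at P (Suc p) c"
  using code_at_append[of P p "[i]" c] by (auto simp: code_at_def)

definition runs :: "instr list \<Rightarrow> nat \<Rightarrow> config \<Rightarrow> config \<Rightarrow> bool" where
  "runs P t s s' \<longleftrightarrow> (step P ^^ t) s = s'"

lemma runs_0 [simp]: "runs P 0 s s' \<longleftrightarrow> s = s'"
  by (simp add: runs_def)

lemma runs_trans: "runs P t1 s s' \<Longrightarrow> runs P t2 s' s'' \<Longrightarrow> runs P (t1 + t2) s s''"
  by (simp add: runs_def add.commute[of t1] funpow_add)

lemma runs_Suc:
  assumes "p < length P" "runs P t (exec (P ! p) (p, inp, R)) s"
  shows "runs P (Suc t) (p, inp, R) s"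
  using runs_trans[of P 1 "(p, inp, R)" "exec (P ! p) (p, inp, R)" t s] assms
  by (simp add: runs_def step_def)

text \<open>The frame condition for nested evaluation: work at level \<open>t\<close> leaves all
  array cells and all lower temporaries, which hold operands and loop counters, intact.\<close>

definition keeps :: "nat \<Rightarrow> (nat \<Rightarrow> nat) \<Rightarrow> (nat \<Rightarrow> nat) \<Rightarrow> bool" where
  "keeps t R R' \<longleftrightarrow> (\<forall>i. (\<forall>t'\<ge>t. i \<noteq> tmp t') \<longrightarrow> R' i = R i)"

definition agree :: "(nat \<Rightarrow> nat) \<Rightarrow> mem \<Rightarrow> bool" where
  "agree R M \<longleftrightarrow> (\<forall>a<15. \<forall>i. R (16 * i + a + 1) = M a i)"


lemma tmp_eq [simp]: "tmp t = tmp t' \<longleftrightarrow> t = t'"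
  by (simp add: tmp_def)

lemma keeps_refl [simp]: "keeps t R R"
  by (simp add: keeps_def)

lemma keeps_trans: "keeps t R R' \<Longrightarrow> keeps t' R' R'' \<Longrightarrow> t \<le> t' \<Longrightarrow> keeps t R R''"
  unfolding keeps_def by (metis order_trans)

lemma keeps_tmp: "keeps t R R' \<Longrightarrow> t' < t \<Longrightarrow> R' (tmp t') = R (tmp t')"
  unfolding keeps_def by (metis tmp_eq leD)

lemma keeps_upd: "t \<le> t' \<Longrightarrow> keeps t R R' \<Longrightarrow> keeps t R (R'(tmp t' := v))"
  by (auto simp: keeps_def)

lemma cell_not_tmp: "a < 15 \<Longrightarrow> 16 * i + a + 1 \<noteq> tmp t"
  unfolding tmp_def by presburger

lemma cell_inj:
  assumes "a < 15" "b < 15"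
  shows "16 * i + a + 1 = 16 * k + b + 1 \<longleftrightarrow> a = b \<and> i = (k::nat)"
proof -
  have "i < k \<Longrightarrow> 16 * i + a < 16 * k + b" "k < i \<Longrightarrow> 16 * k + b < 16 * i + a"
    using assms by linarith+
  then show ?thesis by (metis add_left_cancel add_right_cancel less_irrefl linorder_neqE_nat)
qed

lemma keeps_agree: "keeps t R R' \<Longrightarrow> agree R M \<Longrightarrow> agree R' M"
  using cell_not_tmp unfolding agree_def keeps_def by metis

lemma agree_upd: "a < 15 \<Longrightarrow> agree R M \<Longrightarrow> agree (R(16 * i + a + 1 := v)) (upd a i v M)"
  unfolding agree_def using cell_inj by auto

fun straight :: "instr \<Rightarrow> bool" where
  "straight (JumpPos i l) \<longleftrightarrow> False"
| "straight _ \<longleftrightarrow> True"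

lemma straight_exec: "straight i \<Longrightarrow> exec i (p, x) = (Suc p, snd (exec i (0, x)))"
proof -
  assume i: "straight i"
  obtain inp R where x: "x = (inp, R)" by (cases x)
  show ?thesis unfolding x using i by (cases i; cases inp) simp_all
qed

text \<open>Jump-free instructions change input and registers independently of the program counter,
  hence the dummy 0 in \<open>exec i (0, x)\<close>.\<close>

lemma straight_runs_length:
  "list_all straight is \<Longrightarrow> code_at P p is \<Longrightarrow>
   runs P (length is) (p, x) (p + length is, fold (\<lambda>i x. snd (exec i (0, x))) is x)"
proof (induction "is" arbitrary: p x)
  case (Cons i "is")
  then have *: "p < length P" "P ! p = i" "code_at P (Suc p) is" "straight i" "list_all straight is"
    by (auto simp: code_at_Cons)
  obtain inp R where x: "x = (inp, R)" by (cases x)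
  show ?case
    using runs_Suc[OF *(1), of "length is" inp R] Cons.IH[OF *(5,3)] straight_exec[OF *(4), of p]
    unfolding x *(2) by simp
qed simp

lemma straight_runs:
  "code_at P p is \<Longrightarrow> list_all straight is \<Longrightarrow> length is = k \<Longrightarrow>
   fold (\<lambda>i x. snd (exec i (0, x))) is x = y \<Longrightarrow> runs P k (p, x) (p + k, y)"
  using straight_runs_length by blast

lemma addr_runs:
  assumes "code_at P p (addr t a)"
  shows "\<exists>R'. runs P 6 (p, inp, R) (p + 6, inp, R') \<and> R' (tmp t) = 16 * R (tmp t) + a + 1 \<and>
    keeps t R R'"
proof -
  let ?R' = "R(tmp t := 16 * R (tmp t) + a + 1, tmp (Suc t) := a + 1)"
  have "runs P 6 (p, inp, R) (p + 6, inp, ?R')"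
    using assms unfolding addr_def by (rule straight_runs) (simp_all add: fun_upd_twist, simp add: fun_eq_iff)
  moreover have "keeps t R ?R'"
    by (intro keeps_upd keeps_refl) simp_all
  ultimately show ?thesis by fastforce
qed

lemma ecode_runs:
  assumes "code_at P p (ecode t e)" "agree R M" "ewf e"
  shows "\<exists>R'. runs P (ecost e) (p, inp, R) (p + ecost e, inp, R') \<and> R' (tmp t) = eval e M \<and>
    keeps t R R'"
  using assms
proof (induction e arbitrary: p t R)
  case (Num c)
  then show ?case
    using straight_runs[of P p "ecode t (Num c)" 1 "(inp, R)"] by (force simp: keeps_def)
next
  case (Cell a e)
  then have at: "code_at P p (ecode t e)" "code_at P (p + ecost e) (addr t a)"
    "code_at P (p + ecost e + 6) [Load (tmp t) (tmp t)]"
    by (auto simp: code_at_append)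
  from Cell.IH[OF at(1)] Cell.prems obtain R1 where R1:
    "runs P (ecost e) (p, inp, R) (p + ecost e, inp, R1)" "R1 (tmp t) = eval e M" "keeps t R R1"
    by auto
  from addr_runs[OF at(2)] obtain R2 where R2:
    "runs P 6 (p + ecost e, inp, R1) (p + ecost e + 6, inp, R2)"
    "R2 (tmp t) = 16 * R1 (tmp t) + a + 1" "keeps t R1 R2" by blast
  have "runs P 1 (p + ecost e + 6, inp, R2) (p + ecost e + 7, inp, R2(tmp t := R2 (R2 (tmp t))))"
    using straight_runs[OF at(3), of 1 "(inp, R2)"] by (simp add: add_ac del: fun_upd_apply)
  from runs_trans[OF runs_trans[OF R1(1) R2(1)] this]
  have "runs P (ecost e + 7) (p, inp, R) (p + ecost e + 7, inp, R2(tmp t := R2 (R2 (tmp t))))"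
    by (simp add: add_ac)
  moreover have k: "keeps t R R2" using R1(3) R2(3) keeps_trans by blast
  moreover have "R2 (R2 (tmp t)) = M a (eval e M)"
    using keeps_agree[OF k Cell.prems(2)] Cell.prems(3) R1(2) R2(2) by (simp add: agree_def)
  ultimately show ?case
    by (intro exI[of _ "R2(tmp t := R2 (R2 (tmp t)))"]) (simp add: keeps_upd add_ac del: fun_upd_apply, simp)
next
  case (Plus e1 e2)
  then have at: "code_at P p (ecode t e1)" "code_at P (p + ecost e1) (ecode (Suc t) e2)"
    "code_at P (p + ecost e1 + ecost e2) [Add (tmp t) (tmp t) (tmp (Suc t))]"
    by (auto simp: code_at_append add.assoc)
  from Plus.IH(1)[OF at(1)] Plus.prems obtain R1 where R1:
    "runs P (ecost e1) (p, inp, R) (p + ecost e1, inp, R1)" "R1 (tmp t) = eval e1 M" "keeps t R R1"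
    by auto
  from Plus.IH(2)[OF at(2) keeps_agree[OF R1(3)]] Plus.prems obtain R2 where R2:
    "runs P (ecost e2) (p + ecost e1, inp, R1) (p + ecost e1 + ecost e2, inp, R2)"
    "R2 (tmp (Suc t)) = eval e2 M" "keeps (Suc t) R1 R2" by auto
  have "runs P 1 (p + ecost e1 + ecost e2, inp, R2)
    (p + ecost e1 + ecost e2 + 1, inp, R2(tmp t := R2 (tmp t) + R2 (tmp (Suc t))))"
    using straight_runs[OF at(3), of 1 "(inp, R2)"] by simp
  from runs_trans[OF runs_trans[OF R1(1) R2(1)] this]
  have "runs P (ecost (Plus e1 e2)) (p, inp, R) (p + ecost (Plus e1 e2), inp,
    R2(tmp t := R2 (tmp t) + R2 (tmp (Suc t))))" by (simp add: add.assoc)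
  moreover have "keeps t R R2" using R1(3) R2(3) keeps_trans by (meson le_Suc_eq order_refl)
  ultimately show ?case using R1(2) R2(2) keeps_tmp[OF R2(3), of t]
    by (intro exI[of _ "R2(tmp t := R2 (tmp t) + R2 (tmp (Suc t)))"]) (simp add: keeps_upd del: fun_upd_apply, simp)
next
  case (Minus e1 e2)
  then have at: "code_at P p (ecode t e1)" "code_at P (p + ecost e1) (ecode (Suc t) e2)"
    "code_at P (p + ecost e1 + ecost e2) [Sub (tmp t) (tmp t) (tmp (Suc t))]"
    by (auto simp: code_at_append add.assoc)
  from Minus.IH(1)[OF at(1)] Minus.prems obtain R1 where R1:
    "runs P (ecost e1) (p, inp, R) (p + ecost e1, inp, R1)" "R1 (tmp t) = eval e1 M" "keeps t R R1"
    by auto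
  from Minus.IH(2)[OF at(2) keeps_agree[OF R1(3)]] Minus.prems obtain R2 where R2:
    "runs P (ecost e2) (p + ecost e1, inp, R1) (p + ecost e1 + ecost e2, inp, R2)"
    "R2 (tmp (Suc t)) = eval e2 M" "keeps (Suc t) R1 R2" by auto
  have "runs P 1 (p + ecost e1 + ecost e2, inp, R2)
    (p + ecost e1 + ecost e2 + 1, inp, R2(tmp t := R2 (tmp t) - R2 (tmp (Suc t))))"
    using straight_runs[OF at(3), of 1 "(inp, R2)"] by simp
  from runs_trans[OF runs_trans[OF R1(1) R2(1)] this]
  have "runs P (ecost (Minus e1 e2)) (p, inp, R) (p + ecost (Minus e1 e2), inp,
    R2(tmp t := R2 (tmp t) - R2 (tmp (Suc t))))" by (simp add: add.assoc)
  moreover have "keeps t R R2" using R1(3) R2(3) keeps_trans by (meson le_Suc_eq order_refl)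
  ultimately show ?case using R1(2) R2(2) keeps_tmp[OF R2(3), of t]
    by (intro exI[of _ "R2(tmp t := R2 (tmp t) - R2 (tmp (Suc t)))"]) (simp add: keeps_upd del: fun_upd_apply, simp)
qed

text \<open>The last conjunct protects the counters of enclosing loops, which live in the
  temporaries below \<open>t\<close>.\<close>

lemma ccode_runs:
  assumes "code_at P p (ccode t p c)" "agree R (snd s)" "wf_com c"
  shows "\<exists>R'. runs P (cost c s) (p, fst s, R) (p + clen c, fst (run c s), R') \<and>
    agree R' (snd (run c s)) \<and> (\<forall>t'<t. R' (tmp t') = R (tmp t'))"
  using assms
proof (induction c arbitrary: p t R s)
  case Skip
  then show ?case by auto
next
  case (Assign a e1 e2)
  let ?M = "snd s"
  from Assign have at: "code_at P p (ecode t e1)" "code_at P (p + ecost e1) (addr t a)"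
    "code_at P (p + ecost e1 + 6) (ecode (Suc t) e2)"
    "code_at P (p + ecost e1 + 6 + ecost e2) [Store (tmp t) (tmp (Suc t))]"
    by (auto simp: code_at_append add_ac)
  from ecode_runs[OF at(1), of R ?M "fst s"] Assign.prems obtain R1 where R1:
    "runs P (ecost e1) (p, fst s, R) (p + ecost e1, fst s, R1)" "R1 (tmp t) = eval e1 ?M"
    "keeps t R R1" by auto
  from addr_runs[OF at(2)] obtain R2 where R2:
    "runs P 6 (p + ecost e1, fst s, R1) (p + ecost e1 + 6, fst s, R2)"
    "R2 (tmp t) = 16 * R1 (tmp t) + a + 1" "keeps t R1 R2" by blast
  have k2: "keeps t R R2" using R1(3) R2(3) keeps_trans by blast
  from ecode_runs[OF at(3) keeps_agree[OF k2], of ?M "fst s"] Assign.prems obtain R3 where R3: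
    "runs P (ecost e2) (p + ecost e1 + 6, fst s, R2) (p + ecost e1 + 6 + ecost e2, fst s, R3)"
    "R3 (tmp (Suc t)) = eval e2 ?M" "keeps (Suc t) R2 R3" by auto
  have k3: "keeps t R R3" using k2 R3(3) keeps_trans by (meson le_Suc_eq order_refl)
  have t3: "R3 (tmp t) = 16 * eval e1 ?M + a + 1"
    using keeps_tmp[OF R3(3), of t] R1(2) R2(2) by simp
  let ?R = "R3(16 * eval e1 ?M + a + 1 := eval e2 ?M)"
  have "runs P 1 (p + ecost e1 + 6 + ecost e2, fst s, R3)
    (p + ecost e1 + 6 + ecost e2 + 1, fst s, ?R)"
    using straight_runs[OF at(4), of 1 "(fst s, R3)"] t3 R3(2) by simp
  from runs_trans[OF runs_trans[OF runs_trans[OF R1(1) R2(1)] R3(1)] this]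
  have "runs P (cost (Assign a e1 e2) s) (p, fst s, R) (p + clen (Assign a e1 e2), fst s, ?R)"
    by (simp add: ac_simps)
  moreover have "agree ?R (upd a (eval e1 ?M) (eval e2 ?M) ?M)"
    using agree_upd keeps_agree[OF k3 Assign.prems(2)] Assign.prems(3) by simp
  moreover have "\<forall>t'<t. ?R (tmp t') = R (tmp t')"
    using k3 keeps_tmp[OF k3] cell_not_tmp[of a] Assign.prems(3) by (metis fun_upd_other wf_com.simps(2))
  ultimately show ?case unfolding run.simps fst_conv snd_conv by blast
next
  case (Input a e)
  let ?M = "snd s"
  let ?v = "case fst s of [] \<Rightarrow> 0 | x # _ \<Rightarrow> x"
  from Input have at: "code_at P p (ecode t e)" "code_at P (p + ecost e) (addr t a)"
    "code_at P (p + ecost e + 6) [Read (tmp (Suc t)), Store (tmp t) (tmp (Suc t))]"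
    by (auto simp: code_at_append add_ac)
  from ecode_runs[OF at(1), of R ?M "fst s"] Input.prems obtain R1 where R1:
    "runs P (ecost e) (p, fst s, R) (p + ecost e, fst s, R1)" "R1 (tmp t) = eval e ?M"
    "keeps t R R1" by auto
  from addr_runs[OF at(2)] obtain R2 where R2:
    "runs P 6 (p + ecost e, fst s, R1) (p + ecost e + 6, fst s, R2)"
    "R2 (tmp t) = 16 * R1 (tmp t) + a + 1" "keeps t R1 R2" by blast
  have k2: "keeps t R (R2(tmp (Suc t) := ?v))" using R1(3) R2(3) keeps_trans keeps_upd
    by (meson le_Suc_eq order_refl)
  let ?R = "R2(tmp (Suc t) := ?v, 16 * eval e ?M + a + 1 := ?v)"
  have "runs P 2 (p + ecost e + 6, fst s, R2) (p + ecost e + 6 + 2, tl (fst s), ?R)"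
    using at(3) by (rule straight_runs) (cases "fst s"; simp add: R1(2) R2(2))+
  from runs_trans[OF runs_trans[OF R1(1) R2(1)] this]
  have "runs P (cost (Input a e) s) (p, fst s, R) (p + clen (Input a e), tl (fst s), ?R)"
    by (simp add: ac_simps)
  moreover have "agree ?R (upd a (eval e ?M) ?v ?M)"
    using agree_upd keeps_agree[OF k2 Input.prems(2)] Input.prems(3) by simp
  moreover have "\<forall>t'<t. ?R (tmp t') = R (tmp t')"
    using k2 keeps_tmp[OF k2] cell_not_tmp[of a] Input.prems(3) by (metis fun_upd_other wf_com.simps(3))
  ultimately show ?case unfolding run.simps fst_conv snd_conv by blast
next
  case (Seq c1 c2)
  from Seq.prems have at: "code_at P p (ccode t p c1)"
    "code_at P (p + clen c1) (ccode t (p + clen c1) c2)"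
    by (auto simp: code_at_append)
  from Seq.IH(1)[OF at(1) Seq.prems(2)] Seq.prems(3) obtain R1 where R1:
    "runs P (cost c1 s) (p, fst s, R) (p + clen c1, fst (run c1 s), R1)"
    "agree R1 (snd (run c1 s))" "\<forall>t'<t. R1 (tmp t') = R (tmp t')" by auto
  from Seq.IH(2)[OF at(2) R1(2)] Seq.prems(3) obtain R2 where R2:
    "runs P (cost c2 (run c1 s)) (p + clen c1, fst (run c1 s), R1)
      (p + clen c1 + clen c2, fst (run c2 (run c1 s)), R2)"
    "agree R2 (snd (run c2 (run c1 s)))" "\<forall>t'<t. R2 (tmp t') = R1 (tmp t')" by auto
  then show ?case using runs_trans[OF R1(1) R2(1)] R1(3) by (auto simp: add.assoc)
next
  case (Cond e c1 c2)
  let ?q = "p + ecost e"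
  let ?l = "?q + clen c2 + 3"
  let ?end = "p + clen (Cond e c1 c2)"
  from Cond.prems have at: "code_at P p (ecode t e)" "?q < length P" "P ! ?q = JumpPos (tmp t) ?l"
    "code_at P (?q + 1) (ccode t (?q + 1) c2)"
    "code_at P (?q + 1 + clen c2) [Const (tmp t) 1, JumpPos (tmp t) ?end]"
    "code_at P ?l (ccode t ?l c1)"
    by (auto simp: code_at_append code_at_Cons eval_nat_numeral add_ac Suc_le_eq)
  from ecode_runs[OF at(1), of R "snd s" "fst s"] Cond.prems obtain R1 where R1:
    "runs P (ecost e) (p, fst s, R) (?q, fst s, R1)" "R1 (tmp t) = eval e (snd s)"
    "keeps t R R1" by auto
  have a1: "agree R1 (snd s)" using keeps_agree[OF R1(3) Cond.prems(2)] .
  show ?case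
  proof (cases "eval e (snd s) > 0")
    case True
    have 1: "runs P 1 (?q, fst s, R1) (?l, fst s, R1)"
      using True R1(2) at(2,3) by (simp add: runs_def step_def)
    from Cond.IH(1)[OF at(6) a1] Cond.prems(3) obtain R2 where R2:
      "runs P (cost c1 s) (?l, fst s, R1) (?l + clen c1, fst (run c1 s), R2)"
      "agree R2 (snd (run c1 s))" "\<forall>t'<t. R2 (tmp t') = R1 (tmp t')" by auto
    have "?l + clen c1 = ?end" by simp
    then show ?thesis using True runs_trans[OF runs_trans[OF R1(1) 1] R2(1)] R2(2,3) keeps_tmp[OF R1(3)]
      by (auto simp: add_ac intro!: exI[of _ R2])
  next
    case False
    have 1: "runs P 1 (?q, fst s, R1) (?q + 1, fst s, R1)"
      using False R1(2) at(2,3) by (simp add: runs_def step_def)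
    from Cond.IH(2)[OF at(4) a1] Cond.prems(3) obtain R2 where R2:
      "runs P (cost c2 s) (?q + 1, fst s, R1) (?q + 1 + clen c2, fst (run c2 s), R2)"
      "agree R2 (snd (run c2 s))" "\<forall>t'<t. R2 (tmp t') = R1 (tmp t')" by auto
    let ?R = "R2(tmp t := 1)"
    have 2: "runs P 2 (?q + 1 + clen c2, fst (run c2 s), R2) (?end, fst (run c2 s), ?R)"
      using at(5) by (auto simp: runs_def step_def code_at_Cons eval_nat_numeral)
    have "agree ?R (snd (run c2 s))"
      using keeps_agree[OF keeps_upd[OF order_refl keeps_refl] R2(2)] .
    then show ?thesis
      using False runs_trans[OF runs_trans[OF runs_trans[OF R1(1) 1] R2(1)] 2] R2(3) keeps_tmp[OF R1(3)]
      by (intro exI[of _ ?R]) (simp add: add_ac del: fun_upd_apply, simp)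
  qed
next
  case (Repeat e c)
  let ?q = "p + ecost e"
  let ?l = "?q + clen c + 4"
  let ?n = "eval e (snd s)"
  let ?s = "\<lambda>k. (run c ^^ k) s"
  from Repeat.prems have at: "code_at P p (ecode t e)"
    "code_at P ?q [Const (tmp (Suc t)) 1, JumpPos (tmp (Suc t)) ?l]"
    "code_at P (?q + 2) (ccode (Suc t) (?q + 2) c)"
    "code_at P (?q + 2 + clen c) [Const (tmp (Suc t)) 1, Sub (tmp t) (tmp t) (tmp (Suc t))]"
    "?l < length P" "P ! ?l = JumpPos (tmp t) (?q + 2)"
    by (simp_all add: code_at_append code_at_Cons eval_nat_numeral add_ac)
  from ecode_runs[OF at(1), of R "snd s" "fst s"] Repeat.prems obtain R1 where R1:
    "runs P (ecost e) (p, fst s, R) (?q, fst s, R1)" "R1 (tmp t) = ?n" "keeps t R R1" by auto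
  let ?R1 = "R1(tmp (Suc t) := 1)"
  have 1: "runs P 2 (?q, fst s, R1) (?l, fst s, ?R1)"
    using at(2) by (auto simp: runs_def step_def code_at_Cons eval_nat_numeral)
  have k1: "keeps t R ?R1" using R1(3) by (auto intro: keeps_upd)
  \<comment> \<open>The invariant is taken at the loop test, after \<open>k\<close> rounds, with the
    counter running down.\<close>
  have "k \<le> ?n \<Longrightarrow> \<exists>R'. runs P (\<Sum>i<k. cost c (?s i) + 3) (?l, fst s, ?R1) (?l, fst (?s k), R') \<and>
    agree R' (snd (?s k)) \<and> R' (tmp t) = ?n - k \<and> (\<forall>t'<t. R' (tmp t') = R (tmp t'))" for k
  proof (induction k)
    case 0
    have "?R1 (tmp t) = ?n" using R1(2) by simp
    with 0 show ?case using keeps_agree[OF k1 Repeat.prems(2)] keeps_tmp[OF k1]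
      by (intro exI[of _ ?R1]) (simp del: fun_upd_apply)
  next
    case (Suc k)
    obtain R2 where R2: "runs P (\<Sum>i<k. cost c (?s i) + 3) (?l, fst s, ?R1) (?l, fst (?s k), R2)"
      "agree R2 (snd (?s k))" "R2 (tmp t) = ?n - k" "\<forall>t'<t. R2 (tmp t') = R (tmp t')"
      using Suc.IH Suc_leD[OF Suc.prems] by blast
    have 2: "runs P 1 (?l, fst (?s k), R2) (?q + 2, fst (?s k), R2)"
      using Suc.prems R2(3) at(5,6) by (simp add: runs_def step_def)
    obtain R3 where R3:
      "runs P (cost c (?s k)) (?q + 2, fst (?s k), R2) (?q + 2 + clen c, fst (?s (Suc k)), R3)"
      "agree R3 (snd (?s (Suc k)))" "\<forall>t'<Suc t. R3 (tmp t') = R2 (tmp t')"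
      using Repeat.IH[OF at(3) R2(2)] Repeat.prems(3)
      unfolding funpow.simps o_apply wf_com.simps by blast
    let ?R = "R3(tmp (Suc t) := 1, tmp t := R3 (tmp t) - 1)"
    have 3: "runs P 2 (?q + 2 + clen c, fst (?s (Suc k)), R3) (?l, fst (?s (Suc k)), ?R)"
      using at(4) by (auto simp: runs_def step_def code_at_Cons eval_nat_numeral)
    have k: "keeps t R3 ?R" by (intro keeps_upd keeps_refl) simp_all
    have "(\<Sum>i<Suc k. cost c (?s i) + 3) = (\<Sum>i<k. cost c (?s i) + 3) + 1 + cost c (?s k) + 2"
      by simp
    then have "runs P (\<Sum>i<Suc k. cost c (?s i) + 3) (?l, fst s, ?R1) (?l, fst (?s (Suc k)), ?R)"
      using runs_trans[OF runs_trans[OF runs_trans[OF R2(1) 2] R3(1)] 3] by argo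
    moreover have "agree ?R (snd (?s (Suc k)))" using keeps_agree[OF k R3(2)] .
    moreover have "?R (tmp t) = ?n - Suc k" using R2(3) R3(3) by auto
    moreover have "\<forall>t'<t. ?R (tmp t') = R (tmp t')" using R2(4) R3(3) keeps_tmp[OF k] by auto
    ultimately show ?case by blast
  qed
  from this[of ?n, unfolded diff_self_eq_0] obtain R2 where R2:
    "runs P (\<Sum>i<?n. cost c (?s i) + 3) (?l, fst s, ?R1) (?l, fst (?s ?n), R2)"
    "agree R2 (snd (?s ?n))" "R2 (tmp t) = 0" "\<forall>t'<t. R2 (tmp t') = R (tmp t')" by blast
  have 2: "runs P 1 (?l, fst (?s ?n), R2) (p + clen (Repeat e c), fst (?s ?n), R2)"
    using R2(3) at(5,6) by (simp add: runs_def step_def)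
  have "cost (Repeat e c) s = ecost e + 2 + (\<Sum>i<?n. cost c (?s i) + 3) + 1" by simp
  then have "runs P (cost (Repeat e c) s) (p, fst s, R) (p + clen (Repeat e c), fst (?s ?n), R2)"
    using runs_trans[OF runs_trans[OF runs_trans[OF R1(1) 1] R2(1)] 2] by argo
  then show ?case unfolding run.simps using R2(2,4) by blast
qed

text \<open>The final expression is evaluated at level 0, and \<open>tmp 0\<close> is register 0,
  where the machine leaves its result.\<close>

lemma compiled_halts:
  assumes "wf_com c" "ewf e"
  shows "halts_within (ccode 0 0 c @ ecode 0 e) inp (cost c (inp, \<lambda>_ _. 0) + ecost e)
    (eval e (snd (run c (inp, \<lambda>_ _. 0))))"
proof -
  let ?P = "ccode 0 0 c @ ecode 0 e"
  let ?s = "(inp, \<lambda>_ _. 0) :: state"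
  have "code_at ?P 0 ?P" by (simp add: code_at_def)
  then have at: "code_at ?P 0 (ccode 0 0 c)" "code_at ?P (clen c) (ecode 0 e)"
    by (auto simp: code_at_append)
  have "agree (\<lambda>_. 0) (snd ?s)" by (simp add: agree_def)
  from ccode_runs[OF at(1) this assms(1)] obtain R1 where R1:
    "runs ?P (cost c ?s) (0, inp, \<lambda>_. 0) (clen c, fst (run c ?s), R1)"
    "agree R1 (snd (run c ?s))" by auto
  from ecode_runs[OF at(2) R1(2) assms(2)] obtain R2 where R2:
    "runs ?P (ecost e) (clen c, fst (run c ?s), R1) (clen c + ecost e, fst (run c ?s), R2)"
    "R2 (tmp 0) = eval e (snd (run c ?s))" by blast
  show ?thesis
    using runs_trans[OF R1(1) R2(1)] R2(2) by (simp add: halts_within_def runs_def tmp_def)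
qed

section \<open>Frame and loop rules for the language\<close>

abbreviation (input) Reg :: "nat \<Rightarrow> expr" where "Reg v \<equiv> Cell 0 (Num v)"
abbreviation (input) Set_Reg :: "nat \<Rightarrow> expr \<Rightarrow> com" where "Set_Reg v e \<equiv> Assign 0 (Num v) e"
abbreviation (input) Incr :: "nat \<Rightarrow> com" where "Incr v \<equiv> Set_Reg v (Plus (Reg v) (Num 1))"
text \<open>Subtraction is truncated, so the sum of both differences is positive exactly if the
  values differ.\<close>

abbreviation (input) Neq :: "expr \<Rightarrow> expr \<Rightarrow> expr" where
  "Neq e1 e2 \<equiv> Plus (Minus e1 e2) (Minus e2 e1)"

text \<open>An over-approximation: a numeral index names one cell, a computed index counts as the
  whole array.\<close>

primrec writes :: "com \<Rightarrow> nat \<Rightarrow> nat \<Rightarrow> bool" where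
  "writes Skip a i \<longleftrightarrow> False"
| "writes (Assign b e1 e2) a i \<longleftrightarrow> a = b \<and> (case e1 of Num v \<Rightarrow> i = v | _ \<Rightarrow> True)"
| "writes (Input b e) a i \<longleftrightarrow> a = b \<and> (case e of Num v \<Rightarrow> i = v | _ \<Rightarrow> True)"
| "writes (c1 ;; c2) a i \<longleftrightarrow> writes c1 a i \<or> writes c2 a i"
| "writes (Cond e c1 c2) a i \<longleftrightarrow> writes c1 a i \<or> writes c2 a i"
| "writes (Repeat e c) a i \<longleftrightarrow> writes c a i"

lemma run_frame: "\<not> writes c a i \<Longrightarrow> snd (run c s) a i = snd s a i"
proof (induction c arbitrary: s)
  case (Repeat e c)
  have "snd ((run c ^^ k) s) a i = snd s a i" for k
    using Repeat by (induction k) auto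
  then show ?case by simp
qed (auto split: expr.splits)

text \<open>The step may assume that cells the body does not write still have their values from
  before the loop, so invariants speak only of what changes.\<close>

lemma Repeat_rule:
  assumes "I 0 s"
    and "\<And>k t. k < eval e (snd s) \<Longrightarrow> I k t \<Longrightarrow>
      (\<And>a i. \<not> writes c a i \<Longrightarrow> snd t a i = snd s a i) \<Longrightarrow> I (Suc k) (run c t) \<and> cost c t \<le> B"
  shows "I (eval e (snd s)) (run (Repeat e c) s)"
    "cost (Repeat e c) s \<le> ecost e + 3 + eval e (snd s) * (B + 3)"
proof -
  let ?s = "\<lambda>k. (run c ^^ k) s"
  have fr: "\<not> writes c a i \<Longrightarrow> snd (?s k) a i = snd s a i" for a i k
    by (induction k) (auto simp: run_frame)
  have I: "k \<le> eval e (snd s) \<Longrightarrow> I k (?s k)" for k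
    by (induction k) (auto simp: assms(1) intro: assms(2)[THEN conjunct1] fr)
  then show "I (eval e (snd s)) (run (Repeat e c) s)" by simp
  have "cost c (?s k) + 3 \<le> B + 3" if "k < eval e (snd s)" for k
    using assms(2)[OF that I fr] that by simp
  then have "(\<Sum>k<eval e (snd s). cost c (?s k) + 3) \<le> (\<Sum>k<eval e (snd s). B + 3)"
    by (intro sum_mono) simp
  then show "cost (Repeat e c) s \<le> ecost e + 3 + eval e (snd s) * (B + 3)" by simp
qed

lemma Repeat_spec:
  assumes "I 0 s" "eval e (snd s) = n"
    and "\<And>k t. k < n \<Longrightarrow> I k t \<Longrightarrow>
      (\<And>a i. \<not> writes c a i \<Longrightarrow> snd t a i = snd s a i) \<Longrightarrow> I (Suc k) (run c t) \<and> cost c t \<le> B"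
  shows "I n (run (Repeat e c) s) \<and> cost (Repeat e c) s \<le> ecost e + 3 + n * (B + 3)"
  using Repeat_rule[of I s e c B] assms by auto

text \<open>A loop of at most \<open>q\<close> rounds, including its overhead of 3 per round, raises
  the power of \<open>q\<close> by one.\<close>

lemma power_bound:
  assumes "n \<le> q" "B \<le> b * q ^ k" "1 \<le> (q :: nat)" "l = Suc k"
  shows "n * (B + 3) \<le> (b + 3) * q ^ l"
proof -
  have "1 \<le> q ^ k" using assms(3) by simp
  then have "n * (B + 3) \<le> q * ((b + 3) * q ^ k)"
    using assms(1,2) by (intro mult_mono) (auto simp: add_mult_distrib intro!: add_mono)
  then show ?thesis using assms(4) by (simp add: algebra_simps)
qed

section \<open>Arithmetic\<close>

definition Mul :: "nat \<Rightarrow> expr \<Rightarrow> expr \<Rightarrow> com" where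
  "Mul r e1 e2 = Set_Reg r (Num 0) ;; Repeat e1 (Set_Reg r (Plus (Reg r) e2))"

lemma upd_upd [simp]: "upd a i v (upd a i w M) = upd a i v M"
  by (simp add: upd_def)

text \<open>The operands must not depend on the target \<open>r\<close>, which is cleared first. The
  time is proportional to the value of \<open>e1\<close>, so the small factor is put there.\<close>

lemma Mul:
  assumes "\<And>x M. eval e1 (upd 0 r x M) = eval e1 M" "\<And>x M. eval e2 (upd 0 r x M) = eval e2 M"
  shows "run (Mul r e1 e2) s = (fst s, upd 0 r (eval e1 (snd s) * eval e2 (snd s)) (snd s))"
    "cost (Mul r e1 e2) s = ecost e1 + 12 + eval e1 (snd s) * (ecost e2 + 20)"
proof -
  have "(run (Set_Reg r (Plus (Reg r) e2)) ^^ k) (fst s, upd 0 r 0 (snd s)) =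
    (fst s, upd 0 r (k * eval e2 (snd s)) (snd s))" for k
    by (induction k) (simp_all add: assms add.commute del: upd_apply, simp)
  then show "run (Mul r e1 e2) s = (fst s, upd 0 r (eval e1 (snd s) * eval e2 (snd s)) (snd s))"
    by (simp add: Mul_def assms del: upd_apply)
  show "cost (Mul r e1 e2) s = ecost e1 + 12 + eval e1 (snd s) * (ecost e2 + 20)"
    by (simp add: Mul_def assms del: upd_apply)
qed

lemma writes_Mul [simp]: "writes (Mul r e1 e2) a i \<longleftrightarrow> a = 0 \<and> i = r"
  by (auto simp: Mul_def)

text \<open>The base, not the growing power, is the repeated factor. So the time is about base times
  exponent, however large the result; register 26 is scratch.\<close>

definition Pow :: "nat \<Rightarrow> nat \<Rightarrow> nat \<Rightarrow> com" where
  "Pow r b l = Set_Reg r (Num 1) ;; Repeat (Reg l) (Mul 26 (Reg b) (Reg r) ;; Set_Reg r (Reg 26))"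

lemma writes_Pow [simp]: "writes (Pow r b l) a i \<longleftrightarrow> a = 0 \<and> (i = 26 \<or> i = r)"
  by (auto simp: Pow_def)

lemma Pow:
  assumes "r \<noteq> b" "r \<noteq> l" "26 \<notin> {r, b, l}"
  shows "snd (run (Pow r b l) s) 0 r = snd s 0 b ^ snd s 0 l"
    "cost (Pow r b l) s \<le> 60 + snd s 0 l * (snd s 0 b + 1) * 60"
proof -
  let ?t = "run (Set_Reg r (Num 1)) s"
  let ?b = "Mul 26 (Reg b) (Reg r) ;; Set_Reg r (Reg 26)"
  note R = Repeat_rule[of "\<lambda>k t. snd t 0 r = snd s 0 b ^ k" ?t "Reg l" ?b "(snd s 0 b + 1) * 50"]
  have step: "snd (run ?b t) 0 r = snd s 0 b ^ Suc k \<and> cost ?b t \<le> (snd s 0 b + 1) * 50"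
    if "snd t 0 r = snd s 0 b ^ k" "\<And>a i. \<not> writes ?b a i \<Longrightarrow> snd t a i = snd ?t a i" for k t
  proof -
    have "snd t 0 b = snd s 0 b" using that(2)[of 0 b] assms by auto
    then show ?thesis using assms that(1) by (simp add: Mul)
  qed
  have 1: "snd (run (Repeat (Reg l) ?b) ?t) 0 r = snd s 0 b ^ eval (Reg l) (snd ?t)"
    by (rule R(1)) (use step in auto)
  have 2: "cost (Repeat (Reg l) ?b) ?t \<le> ecost (Reg l) + 3 + eval (Reg l) (snd ?t) * ((snd s 0 b + 1) * 50 + 3)"
    by (rule R(2)) (use step in auto)
  show "snd (run (Pow r b l) s) 0 r = snd s 0 b ^ snd s 0 l"
    using 1 assms by (simp add: Pow_def)
  show "cost (Pow r b l) s \<le> 60 + snd s 0 l * (snd s 0 b + 1) * 60"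
    using 2 assms by (simp add: Pow_def algebra_simps)
qed

section \<open>Counting in base \<open>b\<close>\<close>

definition digit :: "nat \<Rightarrow> nat \<Rightarrow> nat \<Rightarrow> nat" where
  "digit b c i = c div b ^ i mod b"

lemma digit_less: "0 < b \<Longrightarrow> digit b c i < b"
  by (simp add: digit_def)

lemma digit_0 [simp]: "digit b 0 i = 0"
  by (simp add: digit_def)

text \<open>\<open>b ^ i dvd Suc c\<close> expresses that adding 1 to \<open>c\<close> carries into
  place \<open>i\<close>; the second part is the propagation of the carry.\<close>

lemma digit_Suc:
  assumes "b > 0"
  shows "digit b (Suc c) i = (if b ^ i dvd Suc c then Suc (digit b c i) mod b else digit b c i)"
    "b ^ Suc i dvd Suc c \<longleftrightarrow> b ^ i dvd Suc c \<and> Suc (digit b c i) = b"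
proof -
  have q: "Suc c div b ^ i = c div b ^ i + (if b ^ i dvd Suc c then 1 else 0)"
    by (auto simp: div_Suc dvd_eq_mod_eq_0)
  then show "digit b (Suc c) i = (if b ^ i dvd Suc c then Suc (digit b c i) mod b else digit b c i)"
    by (simp add: digit_def mod_Suc_eq)
  have "b ^ Suc i dvd Suc c \<longleftrightarrow> b ^ i dvd Suc c \<and> b dvd Suc c div b ^ i"
    using assms by (metis dvd_div_iff_mult dvd_mult_left mult.commute not_gr_zero power_Suc power_not_zero)
  also have "\<dots> \<longleftrightarrow> b ^ i dvd Suc c \<and> Suc (c div b ^ i) mod b = 0"
    using q by (auto simp: dvd_eq_mod_eq_0)
  also have "Suc (c div b ^ i) mod b = 0 \<longleftrightarrow> Suc (digit b c i) = b"
    by (auto simp: digit_def mod_Suc)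
  finally show "b ^ Suc i dvd Suc c \<longleftrightarrow> b ^ i dvd Suc c \<and> Suc (digit b c i) = b" .
qed

text \<open>The entry \<open>a 0\<close> is the least significant digit, the others form a shorter
  number. Hence counting up to \<open>b ^ l\<close> meets every sequence.\<close>

lemma digits_surj:
  assumes "\<And>i. i < l \<Longrightarrow> a i < b"
  shows "\<exists>c<b ^ l. \<forall>i<l. digit b c i = a i"
  using assms
proof (induction l arbitrary: a)
  case (Suc l)
  from Suc.IH[of "\<lambda>i. a (Suc i)"] Suc.prems obtain c where
    c: "c < b ^ l" "\<forall>i<l. digit b c i = a (Suc i)" by auto
  have a0: "a 0 < b" using Suc.prems by simp
  have "b * c + a 0 < b * Suc c" using a0 by simp
  also have "\<dots> \<le> b * b ^ l" using c(1) by (intro mult_le_mono2) simp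
  finally have "b * c + a 0 < b ^ Suc l" by simp
  moreover have "digit b (b * c + a 0) i = a i" if "i < Suc l" for i
  proof (cases i)
    case (Suc i')
    have "(b * c + a 0) div b ^ Suc i' = c div b ^ i'" using a0 by (simp add: div_mult2_eq)
    then show ?thesis using c(2) that Suc by (simp add: digit_def)
  qed (use a0 in \<open>simp add: digit_def\<close>)
  ultimately show ?case by blast
qed simp

text \<open>Register 8 holds the carry, initially 1, register 9 the place and register 10 the new
  digit. All places are visited even after the carry has vanished.\<close>

definition Odometer :: "nat \<Rightarrow> nat \<Rightarrow> nat \<Rightarrow> com" where
  "Odometer a b l = Set_Reg 8 (Num 1) ;; Set_Reg 9 (Num 0) ;;
     Repeat (Reg l) (
       Set_Reg 10 (Plus (Cell a (Reg 9)) (Reg 8)) ;;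
       Cond (Minus (Reg b) (Reg 10)) (Assign a (Reg 9) (Reg 10) ;; Set_Reg 8 (Num 0))
         (Assign a (Reg 9) (Num 0)) ;;
       Incr 9)"

lemma writes_Odometer [simp]:
  "writes (Odometer a b l) a' i \<longleftrightarrow> a' = a \<or> a' = 0 \<and> (i = 8 \<or> i = 9 \<or> i = 10)"
  by (auto simp: Odometer_def)

lemma Odometer:
  assumes a: "a \<noteq> 0" and bl: "b \<notin> {8, 9, 10}" "l \<notin> {8, 9, 10}" and b: "snd s 0 b > 0"
    and dig: "\<forall>i<snd s 0 l. snd s a i = digit (snd s 0 b) c i"
  shows "\<forall>i<snd s 0 l. snd (run (Odometer a b l) s) a i = digit (snd s 0 b) (Suc c) i"
    "cost (Odometer a b l) s \<le> 150 + snd s 0 l * 150"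
proof -
  let ?t = "run (Set_Reg 8 (Num 1) ;; Set_Reg 9 (Num 0)) s"
  let ?c = "Set_Reg 10 (Plus (Cell a (Reg 9)) (Reg 8)) ;;
       Cond (Minus (Reg b) (Reg 10)) (Assign a (Reg 9) (Reg 10) ;; Set_Reg 8 (Num 0))
         (Assign a (Reg 9) (Num 0)) ;;
       Incr 9"
  let ?B = "snd s 0 b" and ?L = "snd s 0 l"
  define I where "I k t \<longleftrightarrow> snd t 0 9 = k \<and> snd t 0 8 = (if ?B ^ k dvd Suc c then 1 else 0) \<and>
    (\<forall>i<?L. snd t a i = digit ?B (if i < k then Suc c else c) i)" for k and t :: state
  have I0: "I 0 ?t" using a dig by (simp add: I_def)
  have step: "I (Suc k) (run ?c t) \<and> cost ?c t \<le> 120"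
    if k: "k < ?L" and I: "I k t" and fr: "\<And>a' i. \<not> writes ?c a' i \<Longrightarrow> snd t a' i = snd ?t a' i" for k t
  proof -
    define B where "B = ?B"
    have bt: "snd t 0 b = B" using fr[of 0 b] a bl by (simp add: B_def)
    have "B > 0" using b by (simp add: B_def)
    then have d: "digit B c k < B" by (rule digit_less)
    have I': "snd t 0 9 = k" "snd t 0 8 = (if B ^ k dvd Suc c then 1 else 0)"
      "\<forall>i<?L. snd t a i = digit B (if i < k then Suc c else c) i"
      using I by (auto simp: I_def B_def)
    note D = digit_Suc[OF \<open>B > 0\<close>, where c = c and i = k]
    have *: "b \<noteq> 8" "b \<noteq> 9" "b \<noteq> 10" using bl by auto
    show ?thesis
    proof (cases "B ^ k dvd Suc c")
      case False
      then show ?thesis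
        unfolding I_def B_def[symmetric] using D d I' a k bt * by (auto simp: less_Suc_eq)
    next
      case True
      show ?thesis
      proof (cases "Suc (digit B c k) = B")
        case True
        then have "digit B (Suc c) k = 0" using D(1) \<open>B ^ k dvd Suc c\<close> by simp
        then show ?thesis
          unfolding I_def B_def[symmetric] using D(2) True \<open>B ^ k dvd Suc c\<close> I' a k bt *
          by (auto simp: less_Suc_eq)
      next
        case False
        with d have "Suc (digit B c k) < B" by simp
        then show ?thesis
          unfolding I_def B_def[symmetric] using D False \<open>B ^ k dvd Suc c\<close> I' a k bt *
          by (auto simp: less_Suc_eq)
      qed
    qed
  qed
  have e: "eval (Reg l) (snd ?t) = ?L" using bl by simp
  have "I ?L (run (Repeat (Reg l) ?c) ?t)"
    using Repeat_rule(1)[of I ?t "Reg l" ?c 120, OF I0 step] unfolding e by blast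
  moreover have 2: "cost (Repeat (Reg l) ?c) ?t \<le> ecost (Reg l) + 3 + ?L * (120 + 3)"
    using Repeat_rule(2)[of I ?t "Reg l" ?c 120, OF I0 step] unfolding e by blast
  ultimately show "\<forall>i<?L. snd (run (Odometer a b l) s) a i = digit ?B (Suc c) i"
    "cost (Odometer a b l) s \<le> 150 + ?L * 150"
    by (simp_all add: Odometer_def I_def)
qed

declare run.simps(6) [simp del] cost.simps(6) [simp del]

section \<open>Coding of the tables\<close>

text \<open>
  A tuple is coded in base \<open>d\<close> by its first entry and the differences modulo \<open>d\<close> to it.  The
  constant tuples are then those with \<open>diffs_code\<close> zero; they need no table entry because of
  idempotency.  The exponent saved in this way pays for running through \<open>X\<^sup>d\<close>.
  The coordinates \<open>j \<ge> M - 1\<close> share a table: \<open>M = m\<close> gives every coordinate its own one,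
  \<open>M = 1\<close> a single one for all.
\<close>

definition diff_mod :: "nat \<Rightarrow> nat \<Rightarrow> nat \<Rightarrow> nat" where
  "diff_mod d u w = (if w < u then w + d - u else w - u)"

primrec diffs_code :: "nat \<Rightarrow> (nat \<Rightarrow> nat) \<Rightarrow> nat \<Rightarrow> nat" where
  "diffs_code d us 0 = 0"
| "diffs_code d us (Suc k) = d * diffs_code d us k + diff_mod d (us 0) (us (Suc k))"

text \<open>Code 0 has no entry, hence the shift by 1. The \<open>M\<close> tables are interleaved,
  with the coordinate varying fastest.\<close>

definition entry :: "nat \<Rightarrow> nat \<Rightarrow> nat \<Rightarrow> (nat \<Rightarrow> nat) \<Rightarrow> nat \<Rightarrow> nat" where
  "entry d n M us j = M * (d * (diffs_code d us (n - 1) - 1) + us 0) + min j (M - 1)"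

definition lookup :: "nat \<Rightarrow> nat \<Rightarrow> nat \<Rightarrow> (nat \<Rightarrow> nat) \<Rightarrow> (nat \<Rightarrow> nat) \<Rightarrow> nat \<Rightarrow> nat" where
  "lookup d n M a us j = (if diffs_code d us (n - 1) > 0 then a (entry d n M us j) else us 0)"

section \<open>The search program\<close>

text \<open>
  Array 1 holds the names of the elements of \<open>D\<close>, which are replaced by their positions
  everywhere else; 2 the entries of \<open>X\<close>, row by row; 3 the offsets of the rows in it; 4 the tables;
  5 the positions of the rows that the \<open>n\<close> voters choose; 6 the image of these rows; 7 whether a
  voter can still be a dictator.  Array 0 holds the scalars: 0 is \<open>|D|\<close>, 1 is \<open>m\<close>, 2 is \<open>|X|\<close>, 3 is \<open>n\<close>,
  4 is \<open>M\<close>, 5 is the length of array 4, 6 and 7 are the numbers of iterations of the two main loops,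
  24 tells whether the current tables are still in the race, and 25 whether some tables were accepted.
\<close>

definition Eq_Row :: com where
  "Eq_Row = Set_Reg 12 (Num 1) ;; Set_Reg 13 (Num 0) ;;
     Repeat (Reg 1) (
       Cond (Neq (Cell 6 (Reg 13)) (Cell 2 (Plus (Reg 11) (Reg 13)))) (Set_Reg 12 (Num 0)) Skip ;;
       Incr 13)"

text \<open>Register 14 is the coordinate, 15 the first entry, 16 the code so far, 17 the voter, and
  18 this voter's entry and then its difference to the first.\<close>

definition Code_Step :: com where
  "Code_Step =
     Set_Reg 18 (Cell 2 (Plus (Cell 3 (Cell 5 (Reg 17))) (Reg 14))) ;;
     Cond (Minus (Reg 15) (Reg 18)) (Set_Reg 18 (Minus (Plus (Reg 18) (Reg 0)) (Reg 15)))
       (Set_Reg 18 (Minus (Reg 18) (Reg 15))) ;;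
     Mul 19 (Reg 0) (Reg 16) ;;
     Set_Reg 16 (Plus (Reg 19) (Reg 18)) ;;
     Incr 17"

definition Code_Tuple :: com where
  "Code_Tuple =
     Set_Reg 15 (Cell 2 (Plus (Cell 3 (Cell 5 (Num 0))) (Reg 14))) ;;
     Set_Reg 16 (Num 0) ;;
     Set_Reg 17 (Num 1) ;;
     Repeat (Minus (Reg 3) (Num 1)) Code_Step"

text \<open>By truncated subtraction the nested differences \<open>j - (j - (M - 1))\<close> compute
  \<open>min j (M - 1)\<close>.\<close>

definition Look_Up :: com where
  "Look_Up =
     Cond (Reg 16) (
       Mul 19 (Reg 0) (Minus (Reg 16) (Num 1)) ;;
       Set_Reg 19 (Plus (Reg 19) (Reg 15)) ;;
       Mul 20 (Reg 4) (Reg 19) ;;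
       Assign 6 (Reg 14)
         (Cell 4 (Plus (Reg 20) (Minus (Reg 14) (Minus (Reg 14) (Minus (Reg 4) (Num 1)))))))
       (Assign 6 (Reg 14) (Reg 15))"

definition Image_Tuple :: com where
  "Image_Tuple = Set_Reg 14 (Num 0) ;; Repeat (Reg 1) (Code_Tuple ;; Look_Up ;; Incr 14)"

definition Member :: com where
  "Member = Set_Reg 21 (Num 0) ;; Set_Reg 22 (Num 0) ;;
     Repeat (Reg 2) (
       Set_Reg 11 (Cell 3 (Reg 22)) ;; Eq_Row ;; Cond (Reg 12) (Set_Reg 21 (Num 1)) Skip ;; Incr 22)"

definition Dictators :: com where
  "Dictators = Set_Reg 23 (Num 0) ;;
     Repeat (Reg 3) (
       Set_Reg 11 (Cell 3 (Cell 5 (Reg 23))) ;; Eq_Row ;;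
       Cond (Reg 12) Skip (Assign 7 (Reg 23) (Num 0)) ;; Incr 23)"

definition Test_Rows :: com where
  "Test_Rows = Image_Tuple ;; Member ;; Cond (Reg 21) Skip (Set_Reg 24 (Num 0)) ;; Dictators ;; Odometer 5 2 3"

text \<open>Every voter starts as a possible dictator. A voter whose flag survives all tuples of
  rows dictates, and then the table is rejected.\<close>

definition Test_Table :: com where
  "Test_Table = Set_Reg 24 (Num 1) ;; Set_Reg 23 (Num 0) ;;
     Repeat (Reg 3) (Assign 7 (Reg 23) (Num 1) ;; Assign 5 (Reg 23) (Num 0) ;; Incr 23) ;;
     Repeat (Reg 7) Test_Rows ;;
     Set_Reg 23 (Num 0) ;;
     Repeat (Reg 3) (Cond (Cell 7 (Reg 23)) (Set_Reg 24 (Num 0)) Skip ;; Incr 23) ;;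
     Cond (Reg 24) (Set_Reg 25 (Num 1)) Skip ;;
     Odometer 4 0 5"

text \<open>Register 25 is not cleared, so successive searches report whether any of them
  succeeded.\<close>

definition Search :: com where
  "Search = Pow 27 0 3 ;; Mul 5 (Reg 4) (Minus (Reg 27) (Reg 0)) ;; Pow 6 0 5 ;; Pow 7 2 3 ;;
     Set_Reg 23 (Num 0) ;; Repeat (Reg 5) (Assign 4 (Reg 23) (Num 0) ;; Incr 23) ;;
     Repeat (Reg 6) Test_Table"

section \<open>Effect and cost of the subroutines\<close>

lemma writes_Eq_Row [simp]: "writes Eq_Row a i \<longleftrightarrow> a = 0 \<and> (i = 12 \<or> i = 13)"
  by (auto simp: Eq_Row_def)

lemma writes_Code_Step [simp]: "writes Code_Step a i \<longleftrightarrow> a = 0 \<and> i \<in> {16, 17, 18, 19}"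
  by (auto simp: Code_Step_def)

lemma writes_Code_Tuple [simp]: "writes Code_Tuple a i \<longleftrightarrow> a = 0 \<and> i \<in> {15, 16, 17, 18, 19}"
  by (auto simp: Code_Tuple_def)

lemma writes_Look_Up [simp]: "writes Look_Up a i \<longleftrightarrow> a = 6 \<or> a = 0 \<and> (i = 19 \<or> i = 20)"
  by (auto simp: Look_Up_def)

lemma writes_Image_Tuple [simp]:
  "writes Image_Tuple a i \<longleftrightarrow> a = 6 \<or> a = 0 \<and> i \<in> {14, 15, 16, 17, 18, 19, 20}"
  by (auto simp: Image_Tuple_def)

lemma writes_Member [simp]: "writes Member a i \<longleftrightarrow> a = 0 \<and> i \<in> {11, 12, 13, 21, 22}"
  by (auto simp: Member_def)

lemma writes_Dictators [simp]:
  "writes Dictators a i \<longleftrightarrow> a = 7 \<or> a = 0 \<and> i \<in> {11, 12, 13, 23}"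
  by (auto simp: Dictators_def)

lemma writes_Test_Rows [simp]:
  "writes Test_Rows a i \<longleftrightarrow> a \<in> {5, 6, 7} \<or> a = 0 \<and> i \<in> {8, 9, 10, 11, 12, 13, 14, 15, 16, 17, 18, 19, 20, 21, 22, 23, 24}"
  by (auto simp: Test_Rows_def)

lemma writes_Test_Table [simp]:
  "writes Test_Table a i \<longleftrightarrow> a \<in> {4, 5, 6, 7} \<or> a = 0 \<and> i \<in> {8, 9, 10, 11, 12, 13, 14, 15, 16, 17, 18, 19, 20, 21, 22, 23, 24, 25}"
  by (auto simp: Test_Table_def)

text \<open>\<open>x\<close> lists the entries of the \<open>N\<close> rows one row after the other,
  as positions in the list of elements; \<open>q\<close> is the common bound in which costs are
  expressed.\<close>

locale search =
  fixes d m N n M q :: nat and x :: "nat \<Rightarrow> nat"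
  assumes n: "1 \<le> n" and d: "1 \<le> d"
    and x: "\<And>i. i < N * m \<Longrightarrow> x i < d"
    and q: "1 \<le> q" "d \<le> q" "m \<le> q" "N \<le> q" "n \<le> q" "M \<le> q"
begin

text \<open>The part of the memory that \<open>Search\<close> only reads, so it survives every
  loop.\<close>

definition ctx :: "state \<Rightarrow> bool" where
  "ctx s \<longleftrightarrow> snd s 0 0 = d \<and> snd s 0 1 = m \<and> snd s 0 2 = N \<and> snd s 0 3 = n \<and> snd s 0 4 = M \<and>
     (\<forall>i<N*m. snd s 2 i = x i) \<and> (\<forall>r<N. snd s 3 r = r * m)"

lemma ctx_cong:
  assumes "\<And>a i. a = 0 \<and> i < 5 \<or> a = 2 \<or> a = 3 \<Longrightarrow> snd t a i = snd s a i"
  shows "ctx t \<longleftrightarrow> ctx s"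
  unfolding ctx_def using assms by simp

lemma x_row: "r < N \<Longrightarrow> j < m \<Longrightarrow> r * m + j < N * m"
  by (metis add.commute less_le_trans add_strict_right_mono[of j m "r * m"] mult_Suc mult_le_mono1 Suc_leI)

definition row :: "nat \<Rightarrow> nat \<Rightarrow> nat" where
  "row r j = x (r * m + j)"

lemma Eq_Row:
  assumes "ctx s" "r < N" "snd s 0 11 = r * m"
  shows "snd (run Eq_Row s) 0 12 = (if \<forall>j<m. snd s 6 j = row r j then 1 else 0)"
    "cost Eq_Row s \<le> 200 * q"
proof -
  let ?t = "run (Set_Reg 12 (Num 1) ;; Set_Reg 13 (Num 0)) s"
  let ?c = "Cond (Neq (Cell 6 (Reg 13)) (Cell 2 (Plus (Reg 11) (Reg 13)))) (Set_Reg 12 (Num 0)) Skip ;;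
       Incr 13"
  define I where "I k t \<longleftrightarrow> snd t 0 13 = k \<and>
    snd t 0 12 = (if \<forall>j<k. snd s 6 j = row r j then 1 else 0)" for k and t :: state
  have m: "snd s 0 1 = m" and row: "\<And>j. j < m \<Longrightarrow> snd s 2 (r * m + j) = row r j"
    using assms x_row by (auto simp: ctx_def row_def)
  have e: "eval (Reg 1) (snd ?t) = m" using m by simp
  have step: "I (Suc k) (run ?c t) \<and> cost ?c t \<le> 120"
    if "k < m" "I k t" "\<And>a i. \<not> writes ?c a i \<Longrightarrow> snd t a i = snd ?t a i" for k t
  proof -
    have "snd t 0 11 = r * m" "\<And>i. snd t 2 i = snd s 2 i" "\<And>i. snd t 6 i = snd s 6 i"
      using that(3) assms(3) by auto
    then show ?thesis using that(1,2) row[of k] unfolding I_def by (auto simp: less_Suc_eq)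
  qed
  have I0: "I 0 ?t" by (simp add: I_def)
  have R: "I m (run (Repeat (Reg 1) ?c) ?t) \<and>
    cost (Repeat (Reg 1) ?c) ?t \<le> ecost (Reg 1) + 3 + m * (120 + 3)"
    by (rule Repeat_spec[of I, OF I0 e]) (rule step)
  then show "snd (run Eq_Row s) 0 12 = (if \<forall>j<m. snd s 6 j = row r j then 1 else 0)"
    by (simp add: Eq_Row_def I_def)
  show "cost Eq_Row s \<le> 200 * q"
    using R q by (simp add: Eq_Row_def)
qed

lemma Code_Tuple:
  assumes ctx: "ctx s" and y: "\<And>k. k < n \<Longrightarrow> snd s 5 k = y k \<and> y k < N"
    and j: "snd s 0 14 = j" "j < m"
  shows "snd (run Code_Tuple s) 0 15 = row (y 0) j"
    "snd (run Code_Tuple s) 0 16 = diffs_code d (\<lambda>k. row (y k) j) (n - 1)"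
    "cost Code_Tuple s \<le> 500 * q^2"
proof -
  let ?i = "Set_Reg 15 (Cell 2 (Plus (Cell 3 (Cell 5 (Num 0))) (Reg 14))) ;;
    Set_Reg 16 (Num 0) ;; Set_Reg 17 (Num 1)"
  let ?t = "run ?i s" and ?us = "\<lambda>k. row (y k) j"
  have xs: "snd s 2 (snd s 3 (snd s 5 k) + j) = ?us k" if "k < n" for k
    using ctx y[OF that] x_row[of "y k" j] j by (simp add: ctx_def row_def)
  have t: "snd ?t 0 15 = ?us 0" using xs[of 0] n j by simp
  define I where "I k v \<longleftrightarrow> snd v 0 17 = Suc k \<and> snd v 0 16 = diffs_code d ?us k"
    for k and v :: state
  have I0: "I 0 ?t" by (simp add: I_def)
  have e: "eval (Minus (Reg 3) (Num 1)) (snd ?t) = n - 1" using ctx by (simp add: ctx_def)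
  have step: "I (Suc k) (run Code_Step v) \<and> cost Code_Step v \<le> 300 * q"
    if k: "k < n - 1" and I: "I k v"
      and fr: "\<And>a i. \<not> writes Code_Step a i \<Longrightarrow> snd v a i = snd ?t a i" for k v
  proof -
    have "snd v 2 (snd v 3 (snd v 5 (Suc k)) + j) = ?us (Suc k)"
      using xs[of "Suc k"] k fr[of 2] fr[of 3] fr[of 5] by simp
    moreover have "snd v 0 15 = ?us 0" "snd v 0 14 = j" using fr[of 0 15] fr[of 0 14] t j by simp_all
    moreover have "snd v 0 0 = d" using fr[of 0 0] ctx by (simp add: ctx_def)
    ultimately show ?thesis using I q by (auto simp: I_def Mul diff_mod_def Code_Step_def)
  qed
  have R: "I (n - 1) (run (Repeat (Minus (Reg 3) (Num 1)) Code_Step) ?t) \<and>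
    cost (Repeat (Minus (Reg 3) (Num 1)) Code_Step) ?t \<le>
      ecost (Minus (Reg 3) (Num 1)) + 3 + (n - 1) * (300 * q + 3)"
    by (rule Repeat_spec[of I, OF I0 e]) (rule step)
  have q2: "1 \<le> q^2" "q \<le> q^2" using q by (simp_all add: power2_eq_square)
  from R show "snd (run Code_Tuple s) 0 16 = diffs_code d (\<lambda>k. row (y k) j) (n - 1)"
    by (simp add: Code_Tuple_def I_def)
  have "(n - 1) * (300 * q + 3) \<le> 303 * q ^ 2"
    using power_bound[of "n - 1" q "300 * q" 300 1 2] q by simp
  then have "cost (Repeat (Minus (Reg 3) (Num 1)) Code_Step) ?t \<le> 400 * q ^ 2"
    using R q2 by simp
  moreover have "cost Code_Tuple s =
    cost ?i s + cost (Repeat (Minus (Reg 3) (Num 1)) Code_Step) ?t" by (simp add: Code_Tuple_def)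
  moreover have "cost ?i s \<le> 70" by simp
  ultimately show "cost Code_Tuple s \<le> 500 * q^2"
    using q2 by linarith
  have "snd (run (Repeat (Minus (Reg 3) (Num 1)) Code_Step) ?t) 0 15 = snd ?t 0 15"
    by (rule run_frame) simp
  then show "snd (run Code_Tuple s) 0 15 = row (y 0) j"
    using t by (simp add: Code_Tuple_def)
qed

lemma Look_Up:
  assumes "ctx s" "snd s 0 14 = j" "snd s 0 15 = us 0" "snd s 0 16 = diffs_code d us (n - 1)"
  shows "snd (run Look_Up s) 6 = (snd s 6)(j := lookup d n M (snd s 4) us j)"
    "cost Look_Up s \<le> 400 * q"
proof -
  have *: "snd s 0 0 = d" "snd s 0 4 = M" using assms(1) by (simp_all add: ctx_def)
  have min: "j - (j - (M - Suc 0)) = min j (M - Suc 0)" by simp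
  show "snd (run Look_Up s) 6 = (snd s 6)(j := lookup d n M (snd s 4) us j)"
    using assms(2-) * by (auto simp: Look_Up_def Mul min lookup_def entry_def fun_eq_iff)
  show "cost Look_Up s \<le> 400 * q"
    using assms(2-) * q by (auto simp: Look_Up_def Mul)
qed

text \<open>The cube stands for \<open>m\<close> coordinates, \<open>n\<close> voters, and a product
  by repeated addition that costs about \<open>d\<close>.\<close>

lemma Image_Tuple:
  assumes ctx: "ctx s" and y: "\<And>k. k < n \<Longrightarrow> snd s 5 k = y k \<and> y k < N"
  shows "\<forall>j<m. snd (run Image_Tuple s) 6 j = lookup d n M (snd s 4) (\<lambda>k. row (y k) j) j"
    "cost Image_Tuple s \<le> 2000 * q ^ 3"
proof -
  let ?t = "run (Set_Reg 14 (Num 0)) s"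
  let ?c = "Code_Tuple ;; Look_Up ;; Incr 14"
  let ?us = "\<lambda>j k. row (y k) j"
  define I where "I j t \<longleftrightarrow> snd t 0 14 = j \<and>
    (\<forall>j'<j. snd t 6 j' = lookup d n M (snd s 4) (?us j') j')" for j and t :: state
  have e: "eval (Reg 1) (snd ?t) = m" using ctx by (simp add: ctx_def)
  have q2: "1 \<le> q^2" "q \<le> q^2" using q by (simp_all add: power2_eq_square)
  have step: "I (Suc j) (run ?c t) \<and> cost ?c t \<le> 1000 * q^2"
    if j: "j < m" and I: "I j t" and fr: "\<And>a i. \<not> writes ?c a i \<Longrightarrow> snd t a i = snd ?t a i" for j t
  proof -
    let ?u = "run Code_Tuple t"
    have "ctx t \<longleftrightarrow> ctx s" by (rule ctx_cong) (use fr in auto)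
    then have ctxt: "ctx t" using ctx by simp
    have yt: "k < n \<Longrightarrow> snd t 5 k = y k \<and> y k < N" for k using fr[of 5 k] y by simp
    have t14: "snd t 0 14 = j" using I by (simp add: I_def)
    note u = Code_Tuple[OF ctxt yt t14 j]
    have ctxu: "ctx ?u" using ctxt by (rule ctx_cong[THEN iffD2, rotated]) (auto simp: run_frame)
    have u': "snd ?u 0 14 = j" "snd ?u 6 = snd t 6" "snd ?u 4 = snd s 4"
      using t14 fr[of 4] by (auto simp: run_frame)
    note v = Look_Up[OF ctxu u'(1) u(1,2)]
    have "snd (run Look_Up ?u) 0 14 = j" using u' by (simp add: run_frame)
    then have "I (Suc j) (run ?c t)" using I v(1) u' by (auto simp: I_def less_Suc_eq)
    moreover have "cost ?c t \<le> 1000 * q^2" using u(3) v(2) q2 by simp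
    ultimately show ?thesis ..
  qed
  have I0: "I 0 ?t" by (simp add: I_def)
  have R: "I m (run (Repeat (Reg 1) ?c) ?t) \<and>
    cost (Repeat (Reg 1) ?c) ?t \<le> ecost (Reg 1) + 3 + m * (1000 * q^2 + 3)"
    by (rule Repeat_spec[of I, OF I0 e]) (rule step)
  show "\<forall>j<m. snd (run Image_Tuple s) 6 j = lookup d n M (snd s 4) (?us j) j"
    using R by (simp add: Image_Tuple_def I_def)
  have "m * (1000 * q^2 + 3) \<le> 1003 * q ^ 3"
    using power_bound[of m q "1000 * q^2" 1000 2 3] q by simp
  moreover have "cost Image_Tuple s = 9 + cost (Repeat (Reg 1) ?c) ?t"
    by (simp add: Image_Tuple_def)
  moreover have "1 \<le> q ^ 3" using q by simp
  ultimately show "cost Image_Tuple s \<le> 2000 * q ^ 3"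
    using R by simp
qed

end

lemma writes_Search [simp]:
  "writes Search a i \<longleftrightarrow> a \<in> {4, 5, 6, 7} \<or>
     a = 0 \<and> i \<in> {5, 6, 7, 8, 9, 10, 11, 12, 13, 14, 15, 16, 17, 18, 19, 20, 21, 22, 23, 24, 25, 26, 27}"
  by (auto simp: Search_def)

section \<open>Range and injectivity of the tuple code\<close>

lemma diff_mod_less: "u < d \<Longrightarrow> w < d \<Longrightarrow> diff_mod d u w < d"
  by (auto simp: diff_mod_def)

lemma diff_mod_inj:
  "u < d \<Longrightarrow> w < d \<Longrightarrow> w' < d \<Longrightarrow> diff_mod d u w = diff_mod d u w' \<Longrightarrow> w = w'"
  by (auto simp: diff_mod_def split: if_splits)

lemma diff_mod_0: "u < d \<Longrightarrow> diff_mod d u w = 0 \<longleftrightarrow> u = w"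
  by (auto simp: diff_mod_def)

lemma mult_add_inj:
  assumes "d * a + b = d * a' + b'" "b < d" "b' < (d :: nat)"
  shows "a = a' \<and> b = b'"
proof -
  have "(d * a + b) div d = a" "(d * a' + b') div d = a'" using assms(2,3) by simp_all
  then show ?thesis using assms(1) by simp
qed

lemma diffs_code_less:
  assumes "\<And>i. i \<le> k \<Longrightarrow> us i < d" shows "diffs_code d us k < d ^ k"
  using assms
proof (induction k)
  case (Suc k)
  have "diffs_code d us k < d ^ k" using Suc.IH Suc.prems le_SucI by blast
  then have "diffs_code d us k + 1 \<le> d ^ k" by simp
  then have "d * (diffs_code d us k + 1) \<le> d * d ^ k" by (rule mult_le_mono2)
  moreover have "diff_mod d (us 0) (us (Suc k)) < d" using Suc.prems by (intro diff_mod_less) auto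
  ultimately show ?case by simp
qed simp

text \<open>Division by \<open>d\<close> recovers the differences one by one; the first entry must
  be known to turn them back into entries.\<close>

lemma diffs_code_inj:
  assumes "\<And>i. i \<le> k \<Longrightarrow> us i < d" "\<And>i. i \<le> k \<Longrightarrow> vs i < d"
    and "us 0 = vs 0" "diffs_code d us k = diffs_code d vs k" "i \<le> k"
  shows "us i = vs i"
  using assms
proof (induction k arbitrary: i)
  case (Suc k)
  have *: "diffs_code d us k = diffs_code d vs k \<and>
    diff_mod d (us 0) (us (Suc k)) = diff_mod d (vs 0) (vs (Suc k))"
    using Suc.prems(4) by (intro mult_add_inj[of d]) (auto simp: Suc.prems intro!: diff_mod_less)
  then have "us (Suc k) = vs (Suc k)"
    using diff_mod_inj[of "us 0" d] Suc.prems(1)[of 0] Suc.prems(1)[of "Suc k"] Suc.prems(2)[of "Suc k"]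
      Suc.prems(3) by simp
  with Suc * show ?case by (metis le_Suc_eq)
qed simp

lemma diffs_code_0:
  assumes "\<And>i. i \<le> k \<Longrightarrow> us i < d" "0 < d"
  shows "diffs_code d us k = 0 \<longleftrightarrow> (\<forall>i\<le>k. us i = us 0)"
  using assms(1)
proof (induction k)
  case (Suc k)
  have "diffs_code d us k = 0 \<longleftrightarrow> (\<forall>i\<le>k. us i = us 0)" using Suc.IH Suc.prems le_SucI by blast
  moreover have "diff_mod d (us 0) (us (Suc k)) = 0 \<longleftrightarrow> us 0 = us (Suc k)"
    by (rule diff_mod_0) (rule Suc.prems, simp)
  moreover have "diffs_code d us (Suc k) = 0 \<longleftrightarrow>
      diffs_code d us k = 0 \<and> diff_mod d (us 0) (us (Suc k)) = 0"
    using assms(2) by simp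
  ultimately show ?case by (metis le_Suc_eq)
qed simp

text \<open>A positive code is at most \<open>d ^ (n - 1) - 1\<close>. After the shift by 1, at most
  \<open>d ^ (n - 1) - 1\<close> values combine with \<open>d\<close> first entries, which gives
  \<open>d ^ n - d\<close> addresses for each table.\<close>

lemma entry_less:
  assumes "\<And>i. i < n \<Longrightarrow> us i < d" "1 \<le> n" "1 \<le> M" "0 < diffs_code d us (n - 1)"
  shows "entry d n M us j < M * (d ^ n - d)"
proof -
  let ?c = "diffs_code d us (n - 1)"
  have "?c < d ^ (n - 1)" using assms(1,2) by (intro diffs_code_less) auto
  then have "?c - 1 + 2 \<le> d ^ (n - 1)" using assms(4) by simp
  from mult_le_mono2[OF this, of d] have "d * (?c - 1) + 2 * d \<le> d ^ n"
    using assms(2) by (cases n) (auto simp: algebra_simps)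
  then have "d * (?c - 1) + us 0 + 1 \<le> d ^ n - d" using assms(1)[of 0] assms(2) by simp
  from mult_le_mono2[OF this, of M] show ?thesis
    using assms(3) by (simp add: entry_def algebra_simps)
qed

section \<open>Testing one table, and running through all tables\<close>

context search
begin

definition tuple_image :: "(nat \<Rightarrow> nat) \<Rightarrow> (nat \<Rightarrow> nat) \<Rightarrow> nat \<Rightarrow> nat" where
  "tuple_image a y j = lookup d n M a (\<lambda>k. row (y k) j) j"

definition V :: nat where
  "V = M * (d ^ n - d)"

text \<open>The digits of \<open>e\<close> in base \<open>N\<close> choose the rows of the
  \<open>n\<close> voters. The first half is closure, the second refutes every dictator; idempotency
  is built into \<open>lookup\<close>.\<close>

definition good :: "(nat \<Rightarrow> nat) \<Rightarrow> bool" where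
  "good a \<longleftrightarrow> (\<forall>e<N^n. \<exists>r<N. \<forall>j<m. tuple_image a (digit N e) j = row r j) \<and>
     (\<forall>k<n. \<exists>e<N^n. \<not> (\<forall>j<m. tuple_image a (digit N e) j = row (digit N e k) j))"

lemma Member:
  assumes "ctx s"
  shows "snd (run Member s) 0 21 = (if \<exists>r<N. \<forall>j<m. snd s 6 j = row r j then 1 else 0)"
    "cost Member s \<le> 1000 * q ^ 2"
proof -
  let ?t = "run (Set_Reg 21 (Num 0) ;; Set_Reg 22 (Num 0)) s"
  let ?c = "Set_Reg 11 (Cell 3 (Reg 22)) ;; Eq_Row ;; Cond (Reg 12) (Set_Reg 21 (Num 1)) Skip ;; Incr 22"
  define I where "I k t \<longleftrightarrow> snd t 0 22 = k \<and>
    snd t 0 21 = (if \<exists>r<k. \<forall>j<m. snd s 6 j = row r j then 1 else 0)" for k and t :: state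
  have I0: "I 0 ?t" by (simp add: I_def)
  have e: "eval (Reg 2) (snd ?t) = N" using assms by (simp add: ctx_def)
  have step: "I (Suc k) (run ?c t) \<and> cost ?c t \<le> 300 * q"
    if k: "k < N" and I: "I k t" and fr: "\<And>a i. \<not> writes ?c a i \<Longrightarrow> snd t a i = snd ?t a i" for k t
  proof -
    let ?u = "run (Set_Reg 11 (Cell 3 (Reg 22))) t"
    have "ctx ?u \<longleftrightarrow> ctx s" by (rule ctx_cong) (use fr in auto)
    then have ctxu: "ctx ?u" using assms by simp
    have "snd ?u 0 11 = k * m" using I ctxu k by (simp add: I_def ctx_def)
    note u = Eq_Row[OF ctxu k this]
    have "snd ?u 6 = snd s 6" using fr[of 6] by auto
    then have u12: "snd (run Eq_Row ?u) 0 12 = (if \<forall>j<m. snd s 6 j = row k j then 1 else 0)"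
      using u(1) by simp
    have "snd (run Eq_Row ?u) 0 21 = snd t 0 21" "snd (run Eq_Row ?u) 0 22 = snd t 0 22"
      by (simp_all add: run_frame)
    then show ?thesis using I u(2) u12 q by (auto simp: I_def less_Suc_eq)
  qed
  have R: "I N (run (Repeat (Reg 2) ?c) ?t) \<and>
    cost (Repeat (Reg 2) ?c) ?t \<le> ecost (Reg 2) + 3 + N * (300 * q + 3)"
    by (rule Repeat_spec[of I, OF I0 e]) (rule step)
  then show "snd (run Member s) 0 21 = (if \<exists>r<N. \<forall>j<m. snd s 6 j = row r j then 1 else 0)"
    by (simp add: Member_def I_def)
  have "N * (300 * q + 3) \<le> 303 * q ^ 2"
    using power_bound[of N q "300 * q" 300 1 2] q by simp
  moreover have "1 \<le> q ^ 2" using q by simp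
  ultimately show "cost Member s \<le> 1000 * q ^ 2"
    using R by (simp add: Member_def)
qed

lemma Dictators:
  assumes "ctx s" and y: "\<And>k. k < n \<Longrightarrow> snd s 5 k = y k \<and> y k < N"
  shows "\<forall>k<n. snd (run Dictators s) 7 k =
      (if \<forall>j<m. snd s 6 j = row (y k) j then snd s 7 k else 0)"
    "cost Dictators s \<le> 1000 * q ^ 2"
proof -
  let ?t = "run (Set_Reg 23 (Num 0)) s"
  let ?c = "Set_Reg 11 (Cell 3 (Cell 5 (Reg 23))) ;; Eq_Row ;;
       Cond (Reg 12) Skip (Assign 7 (Reg 23) (Num 0)) ;; Incr 23"
  define I where "I k t \<longleftrightarrow> snd t 0 23 = k \<and>
    (\<forall>i<n. snd t 7 i = (if i < k \<and> \<not> (\<forall>j<m. snd s 6 j = row (y i) j) then 0 else snd s 7 i))"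
    for k and t :: state
  have I0: "I 0 ?t" by (simp add: I_def)
  have e: "eval (Reg 3) (snd ?t) = n" using assms by (simp add: ctx_def)
  have step: "I (Suc k) (run ?c t) \<and> cost ?c t \<le> 300 * q"
    if k: "k < n" and I: "I k t" and fr: "\<And>a i. \<not> writes ?c a i \<Longrightarrow> snd t a i = snd ?t a i" for k t
  proof -
    let ?u = "run (Set_Reg 11 (Cell 3 (Cell 5 (Reg 23)))) t"
    have "ctx ?u \<longleftrightarrow> ctx s" by (rule ctx_cong) (use fr in auto)
    then have ctxu: "ctx ?u" using assms by simp
    have yk: "y k < N" using y[OF k] by simp
    have "snd t 5 k = y k" using fr[of 5 k] y[OF k] by simp
    then have "snd ?u 0 11 = y k * m" using I ctxu yk by (simp add: I_def ctx_def)
    note u = Eq_Row[OF ctxu yk this]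
    have "snd ?u 6 = snd s 6" using fr[of 6] by auto
    then have u12: "snd (run Eq_Row ?u) 0 12 = (if \<forall>j<m. snd s 6 j = row (y k) j then 1 else 0)"
      using u(1) by simp
    have "snd (run Eq_Row ?u) 7 i = snd t 7 i" "snd (run Eq_Row ?u) 0 23 = snd t 0 23" for i
      by (simp_all add: run_frame)
    then show ?thesis using I u(2) u12 q k by (auto simp: I_def less_Suc_eq)
  qed
  have R: "I n (run (Repeat (Reg 3) ?c) ?t) \<and>
    cost (Repeat (Reg 3) ?c) ?t \<le> ecost (Reg 3) + 3 + n * (300 * q + 3)"
    by (rule Repeat_spec[of I, OF I0 e]) (rule step)
  then show "\<forall>k<n. snd (run Dictators s) 7 k =
      (if \<forall>j<m. snd s 6 j = row (y k) j then snd s 7 k else 0)"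
    by (auto simp: Dictators_def I_def)
  have "n * (300 * q + 3) \<le> 303 * q ^ 2"
    using power_bound[of n q "300 * q" 300 1 2] q by simp
  moreover have "1 \<le> q ^ 2" using q by simp
  ultimately show "cost Dictators s \<le> 1000 * q ^ 2"
    using R by (simp add: Dictators_def)
qed

lemma Test_Rows:
  assumes ctx: "ctx s" and y: "\<And>k. k < n \<Longrightarrow> snd s 5 k = digit N e k" and N: "0 < N"
  defines "z \<equiv> tuple_image (snd s 4) (digit N e)"
  shows "snd (run Test_Rows s) 0 24 = (if \<exists>r<N. \<forall>j<m. z j = row r j then snd s 0 24 else 0)"
    "\<forall>k<n. snd (run Test_Rows s) 7 k = (if \<forall>j<m. z j = row (digit N e k) j then snd s 7 k else 0)"
    "\<forall>k<n. snd (run Test_Rows s) 5 k = digit N (Suc e) k"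
    "cost Test_Rows s \<le> 5000 * q ^ 3"
proof -
  let ?s1 = "run Image_Tuple s"
  have y': "\<And>k. k < n \<Longrightarrow> snd s 5 k = digit N e k \<and> digit N e k < N"
    using y digit_less[OF N] by simp
  have z: "\<forall>j<m. snd ?s1 6 j = z j"
    using Image_Tuple(1)[OF ctx y'] by (simp add: z_def tuple_image_def)
  have ctx1: "ctx ?s1" using ctx by (rule ctx_cong[THEN iffD2, rotated]) (auto simp: run_frame)
  let ?s2 = "run Member ?s1"
  define b where "b \<longleftrightarrow> (\<exists>r<N. \<forall>j<m. z j = row r j)"
  have s2: "snd ?s2 0 21 = (if b then 1 else 0)"
    using Member(1)[OF ctx1] z unfolding b_def by (simp cong: conj_cong)
  let ?s3 = "run (Cond (Reg 21) Skip (Set_Reg 24 (Num 0))) ?s2"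
  have s3: "snd ?s3 0 24 = (if b then snd s 0 24 else 0)"
    "snd ?s3 5 k = snd s 5 k" "snd ?s3 6 k = snd ?s1 6 k" "snd ?s3 7 k = snd s 7 k" for k
    using s2 by (simp_all add: run_frame)
  have ctx3: "ctx ?s3" using ctx1 by (rule ctx_cong[THEN iffD2, rotated]) (auto simp: run_frame)
  let ?s4 = "run Dictators ?s3"
  have y3: "\<And>k. k < n \<Longrightarrow> snd ?s3 5 k = digit N e k \<and> digit N e k < N"
    using y' s3(2) by simp
  have s4: "\<forall>k<n. snd ?s4 7 k = (if \<forall>j<m. z j = row (digit N e k) j then snd s 7 k else 0)"
    using Dictators(1)[OF ctx3 y3] z unfolding s3 by simp
  have s4': "snd ?s4 0 2 = N" "snd ?s4 0 3 = n" "\<forall>k<n. snd ?s4 5 k = digit N e k"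
    using ctx3 y3 by (simp_all add: ctx_def run_frame)
  have T: "run Test_Rows s = run (Odometer 5 2 3) ?s4"
    "cost Test_Rows s = cost Image_Tuple s + cost Member ?s1 +
      cost (Cond (Reg 21) Skip (Set_Reg 24 (Num 0))) ?s2 + cost Dictators ?s3 + cost (Odometer 5 2 3) ?s4"
    by (simp_all add: Test_Rows_def)
  note s5 = Odometer[where a = 5 and b = 2 and l = 3 and s = ?s4 and c = e, unfolded s4'(1,2)]
  show "\<forall>k<n. snd (run Test_Rows s) 5 k = digit N (Suc e) k"
    unfolding T using s5(1) N s4'(3) by simp
  show "\<forall>k<n. snd (run Test_Rows s) 7 k = (if \<forall>j<m. z j = row (digit N e k) j then snd s 7 k else 0)"
    unfolding T using s4 by (simp add: run_frame)
  show "snd (run Test_Rows s) 0 24 = (if \<exists>r<N. \<forall>j<m. z j = row r j then snd s 0 24 else 0)"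
    unfolding T b_def[symmetric] using s3(1) by (simp add: run_frame del: run.simps)
  have "cost (Odometer 5 2 3) ?s4 \<le> 150 + n * 150" using s5(2) N s4'(3) by simp
  moreover have "cost (Cond (Reg 21) Skip (Set_Reg 24 (Num 0))) ?s2 \<le> 30" by simp
  moreover have "cost Image_Tuple s \<le> 2000 * q ^ 3" using Image_Tuple(2)[OF ctx y'] .
  moreover have "cost Member ?s1 \<le> 1000 * q ^ 2" using Member(2)[OF ctx1] .
  moreover have "cost Dictators ?s3 \<le> 1000 * q ^ 2" using Dictators(2)[OF ctx3 y3] .
  moreover have "q ^ 2 \<le> q ^ 3" "q \<le> q ^ 3" "1 \<le> q ^ 3"
    using q(1) power_increasing[of 2 3 q] power_increasing[of 1 3 q] by simp_all
  ultimately show "cost Test_Rows s \<le> 5000 * q ^ 3"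
    unfolding T(2) using q(5) by simp
qed

end

context search
begin

lemma row_less: "r < N \<Longrightarrow> j < m \<Longrightarrow> row r j < d"
  unfolding row_def by (intro x x_row)

text \<open>By \<open>entry_less\<close> all reads stay below \<open>V\<close>, so the
  \<open>V\<close> digits of a counter describe a table completely.\<close>

lemma tuple_image_cong:
  assumes "1 \<le> M" "\<And>p. p < V \<Longrightarrow> a p = b p" "\<And>k. k < n \<Longrightarrow> y k < N" "j < m"
  shows "tuple_image a y j = tuple_image b y j"
  using entry_less[of n "\<lambda>k. row (y k) j" d M j] assms n
  by (auto simp: tuple_image_def lookup_def V_def row_less)

lemma good_cong:
  assumes "1 \<le> M" "\<And>p. p < V \<Longrightarrow> a p = b p"
  shows "good a \<longleftrightarrow> good b"
proof -
  have *: "tuple_image a (digit N e) j = tuple_image b (digit N e) j" if "j < m" "e < N ^ n" for e j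
  proof (rule tuple_image_cong[OF assms])
    have "0 < N" using that(2) n by (cases N) (auto simp: power_0_left split: if_splits)
    then show "digit N e k < N" for k by (rule digit_less)
  qed (use that in auto)
  show ?thesis unfolding good_def by (simp add: * cong: conj_cong)
qed

text \<open>In the cost, \<open>N ^ n\<close> counts the tested tuples of rows, \<open>V\<close>
  pays for advancing the table, and 1 for the loops over the voters.\<close>

lemma Test_Table:
  assumes ctx: "ctx s" and M: "1 \<le> M" and s: "snd s 0 5 = V" "snd s 0 7 = N ^ n"
    and tab: "\<forall>p<V. snd s 4 p = digit d c p"
  shows "\<forall>p<V. snd (run Test_Table s) 4 p = digit d (Suc c) p"
    "snd (run Test_Table s) 0 25 = (if good (digit d c) then 1 else snd s 0 25)"
    "cost Test_Table s \<le> 8000 * q ^ 3 * (N ^ n + V + 1)"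
proof -
  let ?a = "snd s 4"
  define mem where "mem e \<longleftrightarrow> (\<exists>r<N. \<forall>j<m. tuple_image ?a (digit N e) j = row r j)" for e
  define dic where "dic e k \<longleftrightarrow> (\<forall>j<m. tuple_image ?a (digit N e) j = row (digit N e k) j)" for e k
  let ?t1 = "run (Set_Reg 24 (Num 1) ;; Set_Reg 23 (Num 0)) s"
  let ?c1 = "Assign 7 (Reg 23) (Num 1) ;; Assign 5 (Reg 23) (Num 0) ;; Incr 23"
  let ?s1 = "run (Repeat (Reg 3) ?c1) ?t1"
  define I1 where "I1 k t \<longleftrightarrow> snd t 0 23 = k \<and> (\<forall>i<k. snd t 7 i = 1 \<and> snd t 5 i = 0)"
    for k and t :: state
  have e1: "eval (Reg 3) (snd ?t1) = n" using ctx by (simp add: ctx_def)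
  have R1: "I1 n ?s1 \<and> cost (Repeat (Reg 3) ?c1) ?t1 \<le> ecost (Reg 3) + 3 + n * (100 + 3)"
    by (rule Repeat_spec[of I1]) (use e1 in \<open>auto simp: I1_def less_Suc_eq\<close>)
  have ctx1: "ctx ?s1" using ctx by (rule ctx_cong[THEN iffD2, rotated]) (auto simp: run_frame)
  have s1: "snd ?s1 4 = ?a" "snd ?s1 0 24 = 1" "snd ?s1 0 7 = N ^ n" "\<forall>k<n. snd ?s1 7 k = 1 \<and> snd ?s1 5 k = 0"
    using R1 s by (auto simp: run_frame I1_def)
  let ?s2 = "run (Repeat (Reg 7) Test_Rows) ?s1"
  define I2 where "I2 e t \<longleftrightarrow> (\<forall>k<n. snd t 5 k = digit N e k) \<and>
    snd t 0 24 = (if \<forall>e'<e. mem e' then 1 else 0) \<and>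
    (\<forall>k<n. snd t 7 k = (if \<forall>e'<e. dic e' k then 1 else 0))" for e and t :: state
  have I20: "I2 0 ?s1" using s1 by (simp add: I2_def)
  have e2: "eval (Reg 7) (snd ?s1) = N ^ n" using s1 by simp
  have step2: "I2 (Suc e) (run Test_Rows t) \<and> cost Test_Rows t \<le> 5000 * q ^ 3"
    if e: "e < N ^ n" and I: "I2 e t"
      and fr: "\<And>a i. \<not> writes Test_Rows a i \<Longrightarrow> snd t a i = snd ?s1 a i" for e t
  proof -
    have N: "0 < N" using e n by (cases N) (auto simp: power_0_left split: if_splits)
    have ctxt: "ctx t" using ctx1 by (rule ctx_cong[THEN iffD2, rotated]) (auto simp: fr)
    have t4: "snd t 4 = ?a" using fr[of 4] s1(1) by auto
    have y: "\<And>k. k < n \<Longrightarrow> snd t 5 k = digit N e k" using I by (simp add: I2_def)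
    note T = Test_Rows[OF ctxt y N, unfolded t4, folded mem_def dic_def]
    have "snd (run Test_Rows t) 0 24 = (if \<forall>e'<Suc e. mem e' then 1 else 0)"
      using T(1) I by (auto simp: I2_def less_Suc_eq)
    moreover have "\<forall>k<n. snd (run Test_Rows t) 7 k = (if \<forall>e'<Suc e. dic e' k then 1 else 0)"
      using T(2) I by (auto simp: I2_def less_Suc_eq)
    ultimately show ?thesis using T(3,4) by (simp add: I2_def)
  qed
  have R2: "I2 (N ^ n) ?s2 \<and>
    cost (Repeat (Reg 7) Test_Rows) ?s1 \<le> ecost (Reg 7) + 3 + N ^ n * (5000 * q ^ 3 + 3)"
    by (rule Repeat_spec[of I2, OF I20 e2]) (rule step2)
  let ?t3 = "run (Set_Reg 23 (Num 0)) ?s2"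
  let ?c3 = "Cond (Cell 7 (Reg 23)) (Set_Reg 24 (Num 0)) Skip ;; Incr 23"
  let ?s3 = "run (Repeat (Reg 3) ?c3) ?t3"
  define all where "all \<longleftrightarrow> (\<forall>e<N ^ n. mem e)"
  define D where "D k \<longleftrightarrow> (\<forall>e<N ^ n. dic e k)" for k
  define I3 where "I3 k t \<longleftrightarrow> snd t 0 23 = k \<and> snd t 0 24 = (if all \<and> (\<forall>i<k. \<not> D i) then 1 else 0)"
    for k and t :: state
  have I30: "I3 0 ?t3" using R2 by (simp add: I3_def I2_def all_def)
  have ctx2: "ctx ?s2" using ctx1 by (rule ctx_cong[THEN iffD2, rotated]) (auto simp: run_frame)
  have e3: "eval (Reg 3) (snd ?t3) = n" using ctx2 by (simp add: ctx_def)
  have step3: "I3 (Suc k) (run ?c3 t) \<and> cost ?c3 t \<le> 100"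
    if k: "k < n" and I: "I3 k t" and fr: "\<And>a i. \<not> writes ?c3 a i \<Longrightarrow> snd t a i = snd ?t3 a i" for k t
  proof -
    have "snd t 7 k = (if D k then 1 else 0)"
      using fr[of 7 k] R2 k by (simp add: I2_def D_def)
    then show ?thesis using I by (auto simp: I3_def less_Suc_eq)
  qed
  have R3: "I3 n ?s3 \<and> cost (Repeat (Reg 3) ?c3) ?t3 \<le> ecost (Reg 3) + 3 + n * (100 + 3)"
    by (rule Repeat_spec[of I3, OF I30 e3]) (rule step3)
  have good: "all \<and> (\<forall>i<n. \<not> D i) \<longleftrightarrow> good (digit d c)"
  proof -
    have "good ?a \<longleftrightarrow> good (digit d c)" using good_cong[OF M] tab by blast
    then show ?thesis
      by (simp only: good_def all_def D_def mem_def dic_def not_all not_imp)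
  qed
  have s3: "snd ?s3 0 24 = (if good (digit d c) then 1 else 0)" "snd ?s3 0 25 = snd s 0 25"
    using R3 good by (simp_all add: I3_def run_frame)
  let ?s4 = "run (Cond (Reg 24) (Set_Reg 25 (Num 1)) Skip) ?s3"
  have s4: "snd ?s4 0 25 = (if good (digit d c) then 1 else snd s 0 25)" using s3 by simp
  have s4': "snd ?s4 0 0 = d" "snd ?s4 0 5 = V" "snd ?s4 4 = ?a"
    using ctx2 s s1(1) by (auto simp: ctx_def run_frame)
  have T: "run Test_Table s = run (Odometer 4 0 5) ?s4"
    "cost Test_Table s = 18 + cost (Repeat (Reg 3) ?c1) ?t1 + cost (Repeat (Reg 7) Test_Rows) ?s1 + 9 +
      cost (Repeat (Reg 3) ?c3) ?t3 + cost (Cond (Reg 24) (Set_Reg 25 (Num 1)) Skip) ?s3 +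
      cost (Odometer 4 0 5) ?s4"
    by (simp_all add: Test_Table_def)
  note O = Odometer[where a = 4 and b = 0 and l = 5 and s = ?s4 and c = c, unfolded s4'(1,2)]
  show "\<forall>p<V. snd (run Test_Table s) 4 p = digit d (Suc c) p"
    unfolding T using O(1) d tab s4'(3) by simp
  show "snd (run Test_Table s) 0 25 = (if good (digit d c) then 1 else snd s 0 25)"
    unfolding T using s4 by (simp add: run_frame del: run.simps)
  have O2: "cost (Odometer 4 0 5) ?s4 \<le> 150 + V * 150" using O(2) d tab s4'(3) by simp
  have i4: "cost (Cond (Reg 24) (Set_Reg 25 (Num 1)) Skip) ?s3 \<le> 30" by simp
  define K where "K = q ^ 3"
  have K: "n \<le> K" "1 \<le> K"
    using q(1,5) power_increasing[of 1 3 q] by (simp_all add: K_def)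
  have "N ^ n * (5000 * K + 3) \<le> 5003 * (K * N ^ n)"
    using mult_le_mono1[OF K(2), of "N ^ n"] by (simp add: algebra_simps)
  moreover have "V \<le> K * V" using K by simp
  moreover have "cost (Repeat (Reg 3) ?c1) ?t1 \<le> 11 + n * 103"
    "cost (Repeat (Reg 3) ?c3) ?t3 \<le> 11 + n * 103"
    "cost (Repeat (Reg 7) Test_Rows) ?s1 \<le> 11 + N ^ n * (5000 * K + 3)"
    using R1 R2 R3 by (simp_all add: K_def)
  ultimately have "cost Test_Table s \<le> 8000 * (K * N ^ n) + 8000 * (K * V) + 8000 * K"
    using O2 i4 K unfolding T(2) by linarith
  then show "cost Test_Table s \<le> 8000 * q ^ 3 * (N ^ n + V + 1)"
    by (simp add: K_def algebra_simps)
qed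

text \<open>In round \<open>c\<close> the table consists of the digits of \<open>c\<close>. The
  preparation costs little although \<open>d ^ V\<close> is large, since \<open>Pow\<close> is
  linear in the exponent.\<close>

lemma Search:
  assumes ctx: "ctx s" and M: "1 \<le> M"
  shows "snd (run Search s) 0 25 = (if \<exists>c<d ^ V. good (digit d c) then 1 else snd s 0 25)"
    "cost Search s \<le> 10000 * q ^ 3 * (d ^ V * (N ^ n + V + 1))"
proof -
  let ?s1 = "run (Pow 27 0 3) s"
  have s1: "snd ?s1 0 27 = d ^ n" "snd ?s1 0 0 = d" "snd ?s1 0 2 = N" "snd ?s1 0 3 = n" "snd ?s1 0 4 = M"
    using Pow(1)[of 27 0 3 s] ctx by (simp_all add: ctx_def run_frame)
  let ?s2 = "run (Mul 5 (Reg 4) (Minus (Reg 27) (Reg 0))) ?s1"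
  have s2: "snd ?s2 0 5 = V" using s1 by (simp add: Mul V_def)
  have s2': "snd ?s2 0 0 = d" "snd ?s2 0 2 = N" "snd ?s2 0 3 = n"
    using s1 by (simp_all add: run_frame)
  let ?s3 = "run (Pow 6 0 5) ?s2"
  have s3: "snd ?s3 0 6 = d ^ V" "snd ?s3 0 5 = V" "snd ?s3 0 2 = N" "snd ?s3 0 3 = n"
    using Pow(1)[of 6 0 5 ?s2] s2 s2' by (simp_all add: run_frame)
  let ?s4 = "run (Pow 7 2 3) ?s3"
  have s4: "snd ?s4 0 7 = N ^ n" "snd ?s4 0 6 = d ^ V" "snd ?s4 0 5 = V"
    using Pow(1)[of 7 2 3 ?s3] s3 by (simp_all add: run_frame)
  let ?t5 = "run (Set_Reg 23 (Num 0)) ?s4"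
  let ?c5 = "Assign 4 (Reg 23) (Num 0) ;; Incr 23"
  let ?s5 = "run (Repeat (Reg 5) ?c5) ?t5"
  define I where "I k t \<longleftrightarrow> snd t 0 23 = k \<and> (\<forall>i<k. snd t 4 i = 0)" for k and t :: state
  have e5: "eval (Reg 5) (snd ?t5) = V" using s4 by simp
  have R5: "I V ?s5 \<and> cost (Repeat (Reg 5) ?c5) ?t5 \<le> ecost (Reg 5) + 3 + V * (100 + 3)"
    by (rule Repeat_spec[of I]) (use e5 in \<open>auto simp: I_def less_Suc_eq\<close>)
  have s5: "snd ?s5 0 7 = N ^ n" "snd ?s5 0 6 = d ^ V" "snd ?s5 0 5 = V" "snd ?s5 0 25 = snd s 0 25"
    using s4 by (simp_all add: run_frame)
  have ctx5: "ctx ?s5" using ctx by (rule ctx_cong[THEN iffD2, rotated]) (auto simp: run_frame)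
  let ?s6 = "run (Repeat (Reg 6) Test_Table) ?s5"
  define J where "J c t \<longleftrightarrow> (\<forall>p<V. snd t 4 p = digit d c p) \<and>
    snd t 0 25 = (if \<exists>c'<c. good (digit d c') then 1 else snd s 0 25)" for c and t :: state
  have J0: "J 0 ?s5" using R5 s5 by (simp add: J_def I_def)
  have e6: "eval (Reg 6) (snd ?s5) = d ^ V" using s5 by simp
  have step: "J (Suc c) (run Test_Table t) \<and> cost Test_Table t \<le> 8000 * q ^ 3 * (N ^ n + V + 1)"
    if J: "J c t" and fr: "\<And>a i. \<not> writes Test_Table a i \<Longrightarrow> snd t a i = snd ?s5 a i" for c t
  proof -
    have ctxt: "ctx t" using ctx5 by (rule ctx_cong[THEN iffD2, rotated]) (auto simp: fr)
    have "snd t 0 5 = V" "snd t 0 7 = N ^ n" using fr s5 by simp_all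
    note T = Test_Table[OF ctxt M this, of c]
    show ?thesis using T J by (auto simp: J_def less_Suc_eq)
  qed
  have R6: "J (d ^ V) ?s6 \<and> cost (Repeat (Reg 6) Test_Table) ?s5 \<le>
    ecost (Reg 6) + 3 + d ^ V * (8000 * q ^ 3 * (N ^ n + V + 1) + 3)"
    by (rule Repeat_spec[of J, OF J0 e6]) (rule step)
  have T: "run Search s = ?s6"
    "cost Search s = cost (Pow 27 0 3) s + cost (Mul 5 (Reg 4) (Minus (Reg 27) (Reg 0))) ?s1 +
      cost (Pow 6 0 5) ?s2 + cost (Pow 7 2 3) ?s3 + 9 + cost (Repeat (Reg 5) ?c5) ?t5 +
      cost (Repeat (Reg 6) Test_Table) ?s5"
    by (simp_all add: Search_def)
  show "snd (run Search s) 0 25 = (if \<exists>c<d ^ V. good (digit d c) then 1 else snd s 0 25)"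
    unfolding T using R6 by (simp add: J_def)
  define K where "K = q ^ 3"
  define A where "A = N ^ n + V + 1"
  have K: "q \<le> K" "q * q \<le> K" "1 \<le> K"
    using q(1) power_increasing[of 1 3 q] power_increasing[of 2 3 q]
    by (simp_all add: K_def power2_eq_square)
  have "d + 1 \<le> 2 * q" "N + 1 \<le> 2 * q" "d + 1 \<le> 2 * K" using q K(1) by simp_all
  then have "n * (d + 1) \<le> q * (2 * q)" "n * (N + 1) \<le> q * (2 * q)" "V * (d + 1) \<le> V * (2 * K)"
    using q(5) by (blast intro: mult_le_mono mult_le_mono2)+
  then have b: "n * (d + 1) \<le> 2 * K" "n * (N + 1) \<le> 2 * K" "V * (d + 1) \<le> 2 * (K * V)"
    using K(2) by (simp_all add: mult.left_commute mult.commute)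
  have "cost (Pow 27 0 3) s \<le> 60 + n * (d + 1) * 60"
    using Pow(2)[of 27 0 3 s] ctx by (simp add: ctx_def)
  moreover have "cost (Mul 5 (Reg 4) (Minus (Reg 27) (Reg 0))) ?s1 \<le> 20 + M * 40"
    using s1 by (simp add: Mul)
  moreover have "cost (Pow 6 0 5) ?s2 \<le> 60 + V * (d + 1) * 60"
    using Pow(2)[of 6 0 5 ?s2] s2 s2' by simp
  moreover have "cost (Pow 7 2 3) ?s3 \<le> 60 + n * (N + 1) * 60"
    using Pow(2)[of 7 2 3 ?s3] s3 by simp
  moreover have "cost (Repeat (Reg 5) ?c5) ?t5 \<le> 11 + V * 103" using R5 by simp
  moreover have "M \<le> K" "V \<le> K * V" using K q(6) by simp_all
  ultimately have "cost Search s \<le> 1000 * K + 300 * (K * V) + cost (Repeat (Reg 6) Test_Table) ?s5"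
    unfolding T(2) using b K(3) by linarith
  also have "\<dots> \<le> 1000 * (K * A) + cost (Repeat (Reg 6) Test_Table) ?s5"
    by (simp add: A_def algebra_simps)
  also have "\<dots> \<le> 1000 * (K * A) + 11 + d ^ V * (8000 * K * A + 3)"
    using R6 by (simp add: A_def K_def)
  also have "\<dots> \<le> 10000 * (K * A * d ^ V)"
  proof -
    have "1 \<le> d ^ V" "1 \<le> K * A" using d K(3) by (simp_all add: A_def)
    then have "K * A \<le> K * A * d ^ V" "d ^ V \<le> K * A * d ^ V" "1 \<le> K * A * d ^ V"
      by (simp_all add: Suc_le_eq)
    moreover have "d ^ V * (8000 * K * A + 3) = 8000 * (K * A * d ^ V) + 3 * d ^ V"
      by (simp add: algebra_simps)
    ultimately show ?thesis by linarith
  qed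
  finally show "cost Search s \<le> 10000 * q ^ 3 * (d ^ V * (N ^ n + V + 1))"
    by (simp add: K_def A_def algebra_simps)
qed

end

section \<open>Accepted tables and non-dictatorial aggregators\<close>

lemma diffs_code_cong: "(\<And>i. i \<le> k \<Longrightarrow> us i = vs i) \<Longrightarrow> diffs_code d us k = diffs_code d vs k"
  by (induction k) auto

lemma lookup_cong:
  assumes "\<And>i. i < n \<Longrightarrow> us i = vs i" "1 \<le> n"
  shows "lookup d n M a us j = lookup d n M a vs j"
proof -
  have "diffs_code d us (n - 1) = diffs_code d vs (n - 1)"
    using assms by (intro diffs_code_cong) simp
  then show ?thesis using assms by (simp add: lookup_def entry_def)
qed

lemma entry_inj:
  assumes "entry d n M us j = entry d n M vs j'" "1 \<le> n" "1 \<le> M"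
    and us: "\<And>i. i < n \<Longrightarrow> us i < d" "0 < diffs_code d us (n - 1)"
    and vs: "\<And>i. i < n \<Longrightarrow> vs i < d" "0 < diffs_code d vs (n - 1)"
  shows "min j (M - 1) = min j' (M - 1)" "\<And>i. i < n \<Longrightarrow> us i = vs i"
proof -
  let ?c = "\<lambda>us. diffs_code d us (n - 1)"
  have 1: "d * (?c us - 1) + us 0 = d * (?c vs - 1) + vs 0 \<and> min j (M - 1) = min j' (M - 1)"
    using assms(1,3) by (intro mult_add_inj[of M]) (auto simp: entry_def min_def)
  then show "min j (M - 1) = min j' (M - 1)" ..
  have "?c us - 1 = ?c vs - 1 \<and> us 0 = vs 0"
    using 1 us(1)[of 0] vs(1)[of 0] assms(2) by (intro mult_add_inj[of d]) auto
  with us(2) vs(2) have 2: "?c us = ?c vs" "us 0 = vs 0" by linarith+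
  show "us i = vs i" if "i < n" for i
    by (rule diffs_code_inj[OF _ _ 2(2,1)]) (use that us(1) vs(1) assms(2) in auto)
qed

text \<open>Ties the positions to the actual elements \<open>ds\<close> and rows
  \<open>xs\<close>.\<close>

locale coded_search = search +
  fixes ds :: "'a list" and xs :: "'a list list"
  assumes M: "1 \<le> M"
    and ds: "length ds = d" "distinct ds"
    and xs: "length xs = N" "set xs \<subseteq> tuples (set ds) m"
    and row: "\<And>r j. r < N \<Longrightarrow> j < m \<Longrightarrow> ds ! row r j = xs ! r ! j"
begin

abbreviation (input) X :: "'a list set" where "X \<equiv> set xs"

definition idx :: "'a \<Rightarrow> nat" where
  "idx v = inv_into {..<d} ((!) ds) v"

lemma idx_nth: "i < d \<Longrightarrow> idx (ds ! i) = i"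
  unfolding idx_def using ds by (intro inv_into_f_f) (auto simp: inj_on_nth)

lemma nth_idx: "v \<in> set ds \<Longrightarrow> ds ! idx v = v \<and> idx v < d"
  by (metis idx_nth ds(1) in_set_conv_nth)

lemma coord_ds: "j < m \<Longrightarrow> u \<in> coord X j \<Longrightarrow> u \<in> set ds"
  using xs(2) by (auto simp: coord_def dest!: subsetD intro: tuples_nth)

lemma rowsE:
  assumes "ys \<in> tuples X n"
  obtains e where "e < N ^ n" "\<And>k. k < n \<Longrightarrow> digit N e k < N \<and> xs ! digit N e k = ys ! k"
proof -
  have "\<exists>r. r < N \<and> xs ! r = ys ! k" if "k < n" for k
    using tuples_nth[OF assms that] xs(1) by (auto simp: in_set_conv_nth)
  then obtain y where y: "\<And>k. k < n \<Longrightarrow> y k < N \<and> xs ! y k = ys ! k" by metis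
  then have "\<exists>e<N ^ n. \<forall>k<n. digit N e k = y k" by (intro digits_surj) auto
  with y that show thesis by auto
qed

lemma rows_tuple:
  assumes "e < N ^ n"
  shows "0 < N" "map (\<lambda>k. xs ! digit N e k) [0..<n] \<in> tuples X n"
proof -
  show N: "0 < N" using assms n by (cases N) (auto simp: power_0_left split: if_splits)
  show "map (\<lambda>k. xs ! digit N e k) [0..<n] \<in> tuples X n"
    using digit_less[OF N] xs(1) by (auto intro!: map_upt_in_tuples)
qed

definition cand :: "(nat \<Rightarrow> nat) \<Rightarrow> nat \<Rightarrow> 'a list \<Rightarrow> 'a" where
  "cand a j us = ds ! lookup d n M a (\<lambda>k. idx (us ! k)) j"

lemma cand_eq_image:
  assumes "\<And>k. k < n \<Longrightarrow> y k < N \<and> xs ! y k = ys ! k" "ys \<in> tuples X n" "j < m"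
  shows "cand a j (map (\<lambda>x. x ! j) ys) = ds ! tuple_image a y j"
proof -
  have "idx (map (\<lambda>x. x ! j) ys ! k) = row (y k) j" if "k < n" for k
    using assms that row[of "y k" j] idx_nth[of "row (y k) j"] row_less[of "y k" j]
    by (simp add: tuples_def)
  then show ?thesis
    unfolding cand_def tuple_image_def using n by (intro arg_cong[where f = "(!) ds"] lookup_cong) auto
qed

text \<open>Constant tuples have code 0, where \<open>lookup\<close> returns the vote of voter 0, so
  \<open>cand a\<close> is idempotent for every \<open>a\<close>. The rest translates the two halves
  of \<open>good\<close> from positions to elements.\<close>

lemma search_sound:
  assumes "good a"
  shows "nondictatorial m X n (cand a)"
proof -
  have "map (\<lambda>j. cand a j (map (\<lambda>x. x ! j) ys)) [0..<m] \<in> X" if ys: "ys \<in> tuples X n" for ys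
  proof -
    from rowsE[OF ys] obtain e where e: "e < N ^ n"
      "\<And>k. k < n \<Longrightarrow> digit N e k < N \<and> xs ! digit N e k = ys ! k" by metis
    from assms e(1) obtain r where r: "r < N" "\<forall>j<m. tuple_image a (digit N e) j = row r j"
      unfolding good_def by blast
    have "xs ! r \<in> tuples (set ds) m" using xs r(1) nth_mem by blast
    then have len: "length (xs ! r) = m" by (simp add: tuples_def)
    have "map (\<lambda>j. cand a j (map (\<lambda>x. x ! j) ys)) [0..<m] = xs ! r"
      using cand_eq_image[OF e(2) ys] r row len by (intro nth_equalityI) auto
    then show ?thesis using r(1) xs(1) by simp
  qed
  then have "iia_aggregator m X n (cand a)" by (simp add: iia_aggregator_iff)
  moreover have "cand a j (replicate n u) = u" if "j < m" "u \<in> coord X j" for j u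
  proof -
    have u: "ds ! idx u = u" "idx u < d" using nth_idx coord_ds that by blast+
    have "lookup d n M a (\<lambda>k. idx (replicate n u ! k)) j = lookup d n M a (\<lambda>k. idx u) j"
      using n by (intro lookup_cong) auto
    moreover have "diffs_code d (\<lambda>k. idx u) (n - 1) = 0"
      using diffs_code_0[of "n - 1" "\<lambda>k. idx u" d] u(2) by simp
    ultimately show ?thesis using u by (simp add: cand_def lookup_def)
  qed
  then have "idempotent_agg m X n (cand a)" by (simp add: idempotent_agg_def)
  moreover have "\<not> dictatorship m X n (cand a)"
  proof
    assume "dictatorship m X n (cand a)"
    then obtain k where k: "k < n"
      "\<And>j us. j < m \<Longrightarrow> us \<in> tuples (coord X j) n \<Longrightarrow> cand a j us = us ! k"
      unfolding dictatorship_def by blast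
    from assms k(1) obtain e j where e: "e < N ^ n" "j < m"
      "tuple_image a (digit N e) j \<noteq> row (digit N e k) j" unfolding good_def by blast
    let ?ys = "map (\<lambda>k. xs ! digit N e k) [0..<n]"
    note ys = rows_tuple[OF e(1)]
    from assms e(1,2) obtain r where r: "r < N" "tuple_image a (digit N e) j = row r j"
      unfolding good_def by blast
    have "ds ! tuple_image a (digit N e) j = cand a j (map (\<lambda>x. x ! j) ?ys)"
      by (rule cand_eq_image[symmetric]) (use ys digit_less e(2) in auto)
    also have "\<dots> = map (\<lambda>x. x ! j) ?ys ! k" using k(2)[OF e(2) columns_in_tuples[OF ys(2)]] .
    also have "\<dots> = ds ! row (digit N e k) j" using k(1) row digit_less[OF ys(1)] e(2) by simp
    finally have "tuple_image a (digit N e) j = row (digit N e k) j"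
      using ds r e(2) ys(1) row_less digit_less by (simp add: nth_eq_iff_index_eq)
    with e(3) show False ..
  qed
  ultimately show ?thesis by (simp add: nondictatorial_def)
qed

text \<open>By \<open>entry_inj\<close> an address determines the tuple and the table, and by
  \<open>uni\<close> all coordinates sharing a table have the same function. So the values of
  \<open>f\<close> can be entered without conflict.\<close>

lemma search_complete:
  assumes f: "nondictatorial m X n f" and uni: "\<And>j. j < m \<Longrightarrow> f j = f (min j (M - 1))"
  shows "\<exists>c<d ^ V. good (digit d c)"
proof -
  have agg: "iia_aggregator m X n f" "idempotent_agg m X n f" "\<not> dictatorship m X n f"
    using f by (auto simp: nondictatorial_def)
  let ?us = "\<lambda>us k. idx (us ! k)"
  define P where "P p j us \<longleftrightarrow> j < m \<and> us \<in> tuples (coord X j) n \<and>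
    0 < diffs_code d (?us us) (n - 1) \<and> entry d n M (?us us) j = p" for p j us
  \<comment> \<open>Any tuple with address \<open>p\<close> may be chosen; \<open>a_entry\<close>
    shows that the choice is immaterial. The default 0 keeps \<open>a p < d\<close>, so that
    \<open>digits_surj\<close> applies.\<close>
  define a where "a p = (if \<exists>j us. P p j us
    then idx (case SOME (j, us). P p j us of (j, us) \<Rightarrow> f j us) else 0)" for p
  have usd: "?us us k < d \<and> ds ! ?us us k = us ! k"
    if "j < m" "us \<in> tuples (coord X j) n" "k < n" for j us k
    using nth_idx coord_ds tuples_nth that by blast
  have fd: "f j us \<in> coord X j" if "j < m" "us \<in> tuples (coord X j) n" for j us
    using agg(1) that by (simp add: iia_aggregator_def)
  have ex: "\<exists>j us. P p j us \<and> a p = idx (f j us)" if "P p j us" for p j us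
  proof -
    have "case SOME (j, us). P p j us of (j, us) \<Rightarrow> P p j us"
      by (rule someI[of "\<lambda>(j, us). P p j us" "(j, us)"]) (use that in simp)
    moreover have "a p = idx (case SOME (j, us). P p j us of (j, us) \<Rightarrow> f j us)"
      using that by (auto simp: a_def)
    ultimately show ?thesis by (auto split: prod.splits)
  qed
  have a_entry: "a (entry d n M (?us us) j) = idx (f j us)"
    if j: "j < m" and us: "us \<in> tuples (coord X j) n" and c: "0 < diffs_code d (?us us) (n - 1)" for j us
  proof -
    have "P (entry d n M (?us us) j) j us" using that by (simp add: P_def)
    from ex[OF this] obtain j' us' where P': "P (entry d n M (?us us) j) j' us'"
      and a: "a (entry d n M (?us us) j) = idx (f j' us')" by blast
    from P' have j': "j' < m" "us' \<in> tuples (coord X j') n" "0 < diffs_code d (?us us') (n - 1)"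
      "entry d n M (?us us') j' = entry d n M (?us us) j" by (auto simp: P_def)
    note inj = entry_inj[OF j'(4) n M _ j'(3) _ c]
    have "min j' (M - 1) = min j (M - 1)" "\<And>i. i < n \<Longrightarrow> ?us us' i = ?us us i"
      by (rule inj; use usd j us j' in blast)+
    moreover have "length us' = n" "length us = n" using us j'(2) by (simp_all add: tuples_def)
    moreover from calculation(2) have "us' ! i = us ! i" if "i < n" for i
      using usd[OF j us that] usd[OF j'(1,2) that] that by metis
    ultimately have "min j' (M - 1) = min j (M - 1)" "us' = us"
      by (auto intro: nth_equalityI)
    then show ?thesis using a uni[OF j] uni[OF j'(1)] by simp
  qed
  have "a p < d" for p
  proof (cases "\<exists>j us. P p j us")
    case True
    then obtain j us where "P p j us" "a p = idx (f j us)" using ex by blast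
    then show ?thesis using nth_idx fd coord_ds by (metis P_def)
  qed (use d in \<open>auto simp: a_def\<close>)
  then obtain c where c: "c < d ^ V" "\<forall>p<V. digit d c p = a p"
    using digits_surj[of V a d] by blast
  have img: "tuple_image a (digit N e) j = idx (f j (map (\<lambda>x. x ! j) ys))" and
    rw: "\<And>k. k < n \<Longrightarrow> row (digit N e k) j = idx (ys ! k ! j)"
    if ys: "ys \<in> tuples X n" and e: "\<And>k. k < n \<Longrightarrow> digit N e k < N \<and> xs ! digit N e k = ys ! k"
      and j: "j < m" for e j ys
  proof -
    let ?cs = "map (\<lambda>x. x ! j) ys"
    have cs: "?cs \<in> tuples (coord X j) n" using ys by (rule columns_in_tuples)
    have len: "length ys = n" using ys by (simp add: tuples_def)
    show rw: "row (digit N e k) j = idx (ys ! k ! j)" if "k < n" for k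
      using e[OF that] row[of "digit N e k" j] idx_nth[of "row (digit N e k) j"] row_less j by simp
    have "tuple_image a (digit N e) j = lookup d n M a (?us ?cs) j"
      unfolding tuple_image_def using rw len n by (intro lookup_cong) auto
    also have "\<dots> = idx (f j ?cs)"
    proof (cases "0 < diffs_code d (?us ?cs) (n - 1)")
      case True
      then show ?thesis using a_entry[OF j cs] by (simp add: lookup_def)
    next
      \<comment> \<open>Code 0 means a constant column: \<open>lookup\<close> returns its first
        entry, and idempotency forces \<open>f\<close> to the same value.\<close>
      case False
      then have eq: "\<forall>i\<le>n - 1. ?us ?cs i = ?us ?cs 0"
      proof -
        have "?us ?cs i < d" if "i \<le> n - 1" for i
        proof -
          have "i < n" using that n by linarith
          from usd[OF j cs this] show ?thesis by blast
        qed
        moreover have "0 < d" using d by linarith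
        ultimately have "diffs_code d (?us ?cs) (n - 1) = 0 \<longleftrightarrow> (\<forall>i\<le>n - 1. ?us ?cs i = ?us ?cs 0)"
          by (rule diffs_code_0)
        with False show ?thesis by blast
      qed
      have "?cs ! i = ?cs ! 0" if "i < n" for i
      proof -
        have "i \<le> n - 1" "0 < n" using that by linarith+
        then have "?us ?cs i = ?us ?cs 0" using eq by blast
        moreover have "ds ! ?us ?cs i = ?cs ! i" "ds ! ?us ?cs 0 = ?cs ! 0"
          using usd[OF j cs that] usd[OF j cs \<open>0 < n\<close>] by blast+
        ultimately show ?thesis by metis
      qed
      then have "?cs = map (\<lambda>_. ?cs ! 0) [0..<n]" by (intro tuple_eqI[OF cs])
      also have "\<dots> = replicate n (?cs ! 0)" by (simp add: map_replicate_const del: nth_map)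
      finally have "f j ?cs = f j (replicate n (?cs ! 0))" by (rule arg_cong)
      also have "\<dots> = ?cs ! 0"
        using agg(2) j tuples_nth[OF cs, of 0] n unfolding idempotent_agg_def by fastforce
      finally have "f j ?cs = ?cs ! 0" .
      then show ?thesis using False by (simp add: lookup_def)
    qed
    finally show "tuple_image a (digit N e) j = idx (f j ?cs)" .
  qed
  have "good a"
    unfolding good_def
  proof (intro conjI allI impI)
    fix e assume e: "e < N ^ n"
    let ?ys = "map (\<lambda>k. xs ! digit N e k) [0..<n]"
    note ys = rows_tuple[OF e]
    have "map (\<lambda>j. f j (map (\<lambda>x. x ! j) ?ys)) [0..<m] \<in> X"
      using agg(1) ys(2) by (simp only: iia_aggregator_iff)
    then obtain r where r: "r < N" "xs ! r = map (\<lambda>j. f j (map (\<lambda>x. x ! j) ?ys)) [0..<m]"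
      using xs(1) by (metis in_set_conv_nth)
    have "tuple_image a (digit N e) j = row r j" if j: "j < m" for j
    proof -
      have "tuple_image a (digit N e) j = idx (f j (map (\<lambda>x. x ! j) ?ys))"
        by (rule img[OF ys(2) _ j]) (use digit_less[OF ys(1)] in simp)
      also have "f j (map (\<lambda>x. x ! j) ?ys) = ds ! row r j" using r row[OF r(1) j] j by simp
      finally show ?thesis using idx_nth row_less[OF r(1) j] by simp
    qed
    with r(1) show "\<exists>r<N. \<forall>j<m. tuple_image a (digit N e) j = row r j" by blast
  next
    fix k assume k: "k < n"
    with agg(3) obtain j us where j: "j < m" "us \<in> tuples (coord X j) n" "f j us \<noteq> us ! k"
      unfolding dictatorship_def by blast
    from tuples_coordE[OF j(2)] obtain ys where ys: "ys \<in> tuples X n" "map (\<lambda>x. x ! j) ys = us" .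
    from rowsE[OF ys(1)] obtain e where e: "e < N ^ n"
      "\<And>k. k < n \<Longrightarrow> digit N e k < N \<and> xs ! digit N e k = ys ! k" by metis
    have "tuple_image a (digit N e) j = idx (f j us)" using img[OF ys(1) e(2) j(1)] ys(2) by simp
    moreover have "row (digit N e k) j = idx (us ! k)"
      using rw[OF ys(1) e(2) j(1) k] ys k by (auto simp: tuples_def)
    moreover have "ds ! idx (f j us) = f j us" using nth_idx coord_ds fd j(1,2) by blast
    moreover have "ds ! idx (us ! k) = us ! k" using usd[OF j(1,2) k] by blast
    ultimately show "\<exists>e<N ^ n. \<not> (\<forall>j<m. tuple_image a (digit N e) j = row (digit N e k) j)"
      using e(1) j by metis
  qed
  then have "good (digit d c)" using good_cong[OF M, of a "digit d c"] c(2) by simp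
  with c(1) show ?thesis by blast
qed

theorem search_iff:
  "(\<exists>c<d ^ V. good (digit d c)) \<longleftrightarrow>
    (\<exists>f. nondictatorial m X n f \<and> (\<forall>j<m. f j = f (min j (M - 1))))"
proof
  assume "\<exists>c<d ^ V. good (digit d c)"
  then obtain c where "good (digit d c)" by blast
  moreover have "cand a j = cand a (min j (M - 1))" for a j
    by (simp add: cand_def lookup_def entry_def fun_eq_iff)
  ultimately show "\<exists>f. nondictatorial m X n f \<and> (\<forall>j<m. f j = f (min j (M - 1)))"
    using search_sound by blast
qed (use search_complete in blast)

end

section \<open>Reading the input\<close>

text \<open>Linear search in array 1 for the name in register 28; its position is stored in array 2
  at the index in register 27.\<close>

definition Find :: com where
  "Find = Set_Reg 22 (Num 0) ;;
     Repeat (Reg 0) (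
       Cond (Neq (Reg 28) (Cell 1 (Reg 22))) Skip (Assign 2 (Reg 27) (Reg 22)) ;; Incr 22)"

text \<open>The row offsets arise by repeated addition, which leaves in register 23 the number
  \<open>|X| * m\<close> of entries still to be read.\<close>

definition Read_Input :: com where
  "Read_Input =
     Input 0 (Num 0) ;;
     Set_Reg 23 (Num 0) ;;
     Repeat (Reg 0) (Input 1 (Reg 23) ;; Incr 23) ;;
     Input 0 (Num 1) ;;
     Input 0 (Num 2) ;;
     Set_Reg 22 (Num 0) ;;
     Set_Reg 23 (Num 0) ;;
     Repeat (Reg 2) (
       Assign 3 (Reg 22) (Reg 23) ;; Set_Reg 23 (Plus (Reg 23) (Reg 1)) ;; Incr 22) ;;
     Set_Reg 27 (Num 0) ;;
     Repeat (Reg 23) (Input 0 (Num 28) ;; Find ;; Incr 27)"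

lemma writes_Find [simp]: "writes Find a i \<longleftrightarrow> a = 2 \<or> a = 0 \<and> i = 22"
  by (auto simp: Find_def)

lemma writes_Read_Input [simp]:
  "writes Read_Input a i \<longleftrightarrow> a \<in> {1, 2, 3} \<or> a = 0 \<and> i \<in> {0, 1, 2, 22, 23, 27, 28}"
  by (auto simp: Read_Input_def)

lemma Find:
  assumes ds: "distinct ds" "\<forall>i<length ds. snd s 1 i = ds ! i" "snd s 0 0 = length ds"
    and v: "snd s 0 28 \<in> set ds" and k: "snd s 0 27 = k"
  shows "fst (run Find s) = fst s" "\<And>i. i \<noteq> k \<Longrightarrow> snd (run Find s) 2 i = snd s 2 i"
    "snd (run Find s) 2 k < length ds" "ds ! snd (run Find s) 2 k = snd s 0 28"
    "cost Find s \<le> 20 + length ds * 150"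
proof -
  let ?t = "run (Set_Reg 22 (Num 0)) s"
  let ?c = "Cond (Neq (Reg 28) (Cell 1 (Reg 22))) Skip (Assign 2 (Reg 27) (Reg 22)) ;; Incr 22"
  let ?v = "snd s 0 28"
  define I where "I l t \<longleftrightarrow> fst t = fst s \<and> snd t 0 22 = l \<and> (\<forall>i. i \<noteq> k \<longrightarrow> snd t 2 i = snd s 2 i) \<and>
    (\<forall>i<l. ds ! i = ?v \<longrightarrow> snd t 2 k = i)" for l and t :: state
  have I0: "I 0 ?t" by (simp add: I_def)
  have e: "eval (Reg 0) (snd ?t) = length ds" using ds by simp
  have step: "I (Suc l) (run ?c t) \<and> cost ?c t \<le> 120"
    if l: "l < length ds" and I: "I l t" and fr: "\<And>a i. \<not> writes ?c a i \<Longrightarrow> snd t a i = snd ?t a i" for l t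
  proof -
    have t: "snd t 1 l = ds ! l" "snd t 0 28 = ?v" "snd t 0 27 = k"
      using fr[of 1 l] fr[of 0 28] fr[of 0 27] ds l k by simp_all
    have eq: "?v - ds ! l + (ds ! l - ?v) = 0 \<longleftrightarrow> ds ! l = ?v" by auto
    show ?thesis
    proof (cases "ds ! l = ?v")
      case True
      then have "i < l \<Longrightarrow> ds ! i \<noteq> ?v" for i
        using nth_eq_iff_index_eq[OF ds(1), of i l] l by auto
      then show ?thesis using I t True by (auto simp: I_def less_Suc_eq)
    next
      case False
      then show ?thesis using I t eq by (auto simp: I_def less_Suc_eq)
    qed
  qed
  have R: "I (length ds) (run (Repeat (Reg 0) ?c) ?t) \<and>
    cost (Repeat (Reg 0) ?c) ?t \<le> ecost (Reg 0) + 3 + length ds * (120 + 3)"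
    by (rule Repeat_spec[of I, OF I0 e]) (rule step)
  have run: "run Find s = run (Repeat (Reg 0) ?c) ?t" by (simp add: Find_def)
  show "fst (run Find s) = fst s" "\<And>i. i \<noteq> k \<Longrightarrow> snd (run Find s) 2 i = snd s 2 i"
    using R unfolding run by (auto simp: I_def)
  obtain i where "i < length ds" "ds ! i = ?v" using v by (auto simp: in_set_conv_nth)
  moreover from this have "snd (run Find s) 2 k = i" using R unfolding run by (auto simp: I_def)
  ultimately show "snd (run Find s) 2 k < length ds" "ds ! snd (run Find s) 2 k = ?v" by simp_all
  show "cost Find s \<le> 20 + length ds * 150" using R by (simp add: Find_def)
qed

lemma length_concat_rect: "(\<And>x. x \<in> set xs \<Longrightarrow> length x = m) \<Longrightarrow> length (concat xs) = length xs * m"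
  by (induction xs) auto

lemma nth_concat_rect:
  "(\<And>x. x \<in> set xs \<Longrightarrow> length x = m) \<Longrightarrow> r < length xs \<Longrightarrow> j < m \<Longrightarrow>
   concat xs ! (r * m + j) = xs ! r ! j"
proof (induction xs arbitrary: r)
  case (Cons x xs)
  then show ?case by (cases r) (auto simp: nth_append)
qed simp

lemma Read_Input:
  assumes ds: "distinct ds" and xs: "set xs \<subseteq> tuples (set ds) m"
    and q: "1 \<le> q" "length ds \<le> q" "m \<le> q" "length xs \<le> q"
  defines "s \<equiv> run Read_Input (encode_input ds m xs, \<lambda>_ _. 0)"
  shows "snd s 0 0 = length ds" "snd s 0 1 = m" "snd s 0 2 = length xs" "snd s 0 25 = 0"
    "\<forall>r<length xs. snd s 3 r = r * m"
    "\<forall>i<length xs * m. snd s 2 i < length ds \<and> ds ! snd s 2 i = concat xs ! i"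
    "cost Read_Input (encode_input ds m xs, \<lambda>_ _. 0) \<le> 1000 * q ^ 3"
proof -
  let ?d = "length ds" and ?N = "length xs"
  let ?s0 = "(encode_input ds m xs, \<lambda>_ _. 0) :: state"
  let ?t1 = "run (Input 0 (Num 0) ;; Set_Reg 23 (Num 0)) ?s0"
  let ?c1 = "Input 1 (Reg 23) ;; Incr 23"
  let ?s1 = "run (Repeat (Reg 0) ?c1) ?t1"
  define I1 where "I1 k t \<longleftrightarrow> fst t = drop k ds @ m # ?N # concat xs \<and> snd t 0 23 = k \<and>
    (\<forall>i<k. snd t 1 i = ds ! i)" for k and t :: state
  have I10: "I1 0 ?t1" by (simp add: I1_def encode_input_def)
  have e1: "eval (Reg 0) (snd ?t1) = ?d" by (simp add: encode_input_def)
  have step1: "I1 (Suc k) (run ?c1 t) \<and> cost ?c1 t \<le> 50" if k: "k < ?d" and I: "I1 k t" for k t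
  proof -
    have "fst t = ds ! k # drop (Suc k) ds @ m # ?N # concat xs"
      using I k by (simp add: I1_def Cons_nth_drop_Suc[symmetric])
    then show ?thesis using I by (auto simp: I1_def less_Suc_eq)
  qed
  have R1: "I1 ?d ?s1 \<and> cost (Repeat (Reg 0) ?c1) ?t1 \<le> ecost (Reg 0) + 3 + ?d * (50 + 3)"
    by (rule Repeat_spec[of I1, OF I10 e1]) (rule step1)
  have s1: "fst ?s1 = m # ?N # concat xs" "\<forall>i<?d. snd ?s1 1 i = ds ! i" "snd ?s1 0 0 = ?d"
    using R1 by (simp_all add: I1_def run_frame encode_input_def)
  let ?t2 = "run (Input 0 (Num 1) ;; Input 0 (Num 2) ;; Set_Reg 22 (Num 0) ;; Set_Reg 23 (Num 0)) ?s1"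
  have t2: "fst ?t2 = concat xs" "\<forall>i<?d. snd ?t2 1 i = ds ! i" "snd ?t2 0 0 = ?d"
    "snd ?t2 0 1 = m" "snd ?t2 0 2 = ?N" "snd ?t2 0 22 = 0" "snd ?t2 0 23 = 0"
    using s1 by simp_all
  let ?c2 = "Assign 3 (Reg 22) (Reg 23) ;; Set_Reg 23 (Plus (Reg 23) (Reg 1)) ;; Incr 22"
  let ?s2 = "run (Repeat (Reg 2) ?c2) ?t2"
  define I2 where "I2 r t \<longleftrightarrow> fst t = concat xs \<and> snd t 0 22 = r \<and> snd t 0 23 = r * m \<and>
    (\<forall>i<r. snd t 3 i = i * m)" for r and t :: state
  have I20: "I2 0 ?t2" using t2 by (simp add: I2_def)
  have e2: "eval (Reg 2) (snd ?t2) = ?N" using t2(5) by simp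
  have step2: "I2 (Suc r) (run ?c2 t) \<and> cost ?c2 t \<le> 90"
    if I: "I2 r t" and fr: "\<And>a i. \<not> writes ?c2 a i \<Longrightarrow> snd t a i = snd ?t2 a i" for r t
  proof -
    have "snd t 0 1 = m" using fr[of 0 1] t2(4) by simp
    then show ?thesis using I by (auto simp: I2_def less_Suc_eq)
  qed
  have R2: "I2 ?N ?s2 \<and> cost (Repeat (Reg 2) ?c2) ?t2 \<le> ecost (Reg 2) + 3 + ?N * (90 + 3)"
    by (rule Repeat_spec[of I2, OF I20 e2]) (rule step2)
  have fr2: "snd ?s2 1 i = snd ?t2 1 i" "snd ?s2 0 0 = snd ?t2 0 0" "snd ?s2 0 1 = snd ?t2 0 1"
    "snd ?s2 0 2 = snd ?t2 0 2" for i
    by (rule run_frame; simp)+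
  have s2: "fst ?s2 = concat xs" "\<forall>i<?d. snd ?s2 1 i = ds ! i" "snd ?s2 0 0 = ?d"
    "snd ?s2 0 1 = m" "snd ?s2 0 2 = ?N" "snd ?s2 0 23 = ?N * m" "\<forall>r<?N. snd ?s2 3 r = r * m"
    using R2 t2 unfolding fr2 I2_def by blast+
  define t3 where "t3 = run (Set_Reg 27 (Num 0)) ?s2"
  have t3: "fst t3 = concat xs" "\<forall>i<?d. snd t3 1 i = ds ! i" "snd t3 0 0 = ?d"
    "snd t3 0 1 = m" "snd t3 0 2 = ?N" "snd t3 0 23 = ?N * m" "snd t3 0 27 = 0"
    "\<forall>r<?N. snd t3 3 r = r * m"
    unfolding t3_def using s2 by (simp_all del: run.simps(4))
  let ?c3 = "Input 0 (Num 28) ;; Find ;; Incr 27"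
  let ?s3 = "run (Repeat (Reg 23) ?c3) t3"
  have len: "length (concat xs) = ?N * m"
    by (rule length_concat_rect) (use xs in \<open>auto simp: tuples_def\<close>)
  have inD: "concat xs ! i \<in> set ds" if "i < ?N * m" for i
  proof -
    have "concat xs ! i \<in> set (concat xs)" using that len by (intro nth_mem) simp
    then show ?thesis using xs by (auto simp: tuples_def)
  qed
  define I3 where "I3 k t \<longleftrightarrow> fst t = drop k (concat xs) \<and> snd t 0 27 = k \<and>
    (\<forall>i<k. snd t 2 i < ?d \<and> ds ! snd t 2 i = concat xs ! i)" for k and t :: state
  have I30: "I3 0 t3" using t3(1,7) by (simp add: I3_def)
  have e3: "eval (Reg 23) (snd t3) = ?N * m" using t3(6) by simp
  have step3: "I3 (Suc k) (run ?c3 t) \<and> cost ?c3 t \<le> 100 + ?d * 150"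
    if k: "k < ?N * m" and I: "I3 k t"
      and fr: "\<And>a i. \<not> writes ?c3 a i \<Longrightarrow> snd t a i = snd t3 a i" for k t
  proof -
    let ?u = "run (Input 0 (Num 28)) t"
    have f: "fst t = concat xs ! k # drop (Suc k) (concat xs)"
      using I k len by (simp add: I3_def Cons_nth_drop_Suc)
    have "snd t 0 27 = k" using I by (simp add: I3_def)
    with f fr t3(2,3) have u: "\<forall>i<?d. snd ?u 1 i = ds ! i" "snd ?u 0 0 = ?d"
      "snd ?u 0 28 = concat xs ! k" "snd ?u 0 27 = k" "fst ?u = drop (Suc k) (concat xs)"
      "\<And>i. snd ?u 2 i = snd t 2 i"
      by simp_all
    have "snd ?u 0 28 \<in> set ds" using u(3) inD[OF k] by simp
    note F = Find[OF ds u(1,2) this u(4)]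
    let ?w = "run Find ?u"
    have "snd ?w 0 27 = k" using u(4) run_frame[of Find 0 27 ?u] by simp
    moreover have "\<forall>i<Suc k. snd ?w 2 i < ?d \<and> ds ! snd ?w 2 i = concat xs ! i"
      using F(2-4) u(3,6) I by (auto simp: I3_def less_Suc_eq)
    moreover have "run ?c3 t = run (Incr 27) ?w" "cost ?c3 t = 9 + cost Find ?u + 18" by simp_all
    ultimately show ?thesis using F(1,5) u(5) by (simp add: I3_def)
  qed
  have R3: "I3 (?N * m) ?s3 \<and>
    cost (Repeat (Reg 23) ?c3) t3 \<le> ecost (Reg 23) + 3 + ?N * m * ((100 + ?d * 150) + 3)"
    by (rule Repeat_spec[of I3, OF I30 e3]) (rule step3)
  have s: "s = ?s3" by (simp add: s_def Read_Input_def t3_def)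
  have fr3: "snd ?s3 0 0 = snd t3 0 0" "snd ?s3 0 1 = snd t3 0 1"
    "snd ?s3 0 2 = snd t3 0 2" "snd ?s3 3 i = snd t3 3 i" for i
    by (rule run_frame; simp)+
  show "snd s 0 0 = ?d" "snd s 0 1 = m" "snd s 0 2 = ?N" "\<forall>r<?N. snd s 3 r = r * m"
    unfolding s fr3 using t3 by simp_all
  show "snd s 0 25 = 0" unfolding s_def by (subst run_frame) simp_all
  show "\<forall>i<?N * m. snd s 2 i < ?d \<and> ds ! snd s 2 i = concat xs ! i"
    using R3 unfolding s by (simp add: I3_def)
  have "cost Read_Input ?s0 = 18 + cost (Repeat (Reg 0) ?c1) ?t1 + 36 + cost (Repeat (Reg 2) ?c2) ?t2 +
    9 + cost (Repeat (Reg 23) ?c3) t3"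
    by (simp add: Read_Input_def t3_def)
  moreover have "cost (Repeat (Reg 0) ?c1) ?t1 \<le> 11 + ?d * 53" using R1 by simp
  moreover have "cost (Repeat (Reg 2) ?c2) ?t2 \<le> 11 + ?N * 93" using R2 by simp
  moreover have "cost (Repeat (Reg 23) ?c3) t3 \<le> 11 + ?N * m * (103 + ?d * 150)" using R3 by simp
  moreover have "?N * m * (103 + ?d * 150) \<le> q * q * (253 * q)"
    using q by (intro mult_le_mono) auto
  moreover have "q * q * (253 * q) = 253 * q ^ 3" by (simp add: power3_eq_cube)
  moreover have "q \<le> q ^ 3" "1 \<le> q ^ 3" using q(1) power_increasing[of 1 3 q] by simp_all
  ultimately show "cost Read_Input ?s0 \<le> 1000 * q ^ 3" using q by linarith
qed

section \<open>The time bound\<close>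

text \<open>The binomial theorem expands each of the three factors, so the coefficients are products
  of three binomial coefficients.\<close>

lemma polynomial3_power: "polynomial3 (\<lambda>x y z. ((1 + x) * (1 + y) * (1 + z)) ^ k)"
proof -
  let ?b = "\<lambda>i. real (k choose i)"
  have b: "(1 + x) ^ k = (\<Sum>i\<le>k. ?b i * x ^ i)" for x :: real
    using binomial_ring[of x 1 k] by (simp add: add.commute)
  have "((1 + x) * (1 + y) * (1 + z)) ^ k =
    (\<Sum>(i, j, l)\<in>{..k} \<times> {..k} \<times> {..k}. ?b i * ?b j * ?b l * x ^ i * y ^ j * z ^ l)" for x y z :: real
  proof -
    have "(\<Sum>(i, j, l)\<in>{..k} \<times> {..k} \<times> {..k}. ?b i * ?b j * ?b l * x ^ i * y ^ j * z ^ l) =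
      (\<Sum>i\<le>k. \<Sum>j\<le>k. \<Sum>l\<le>k. (?b i * x ^ i) * (?b j * y ^ j) * (?b l * z ^ l))"
      by (simp add: sum.cartesian_product[symmetric] mult_ac)
    also have "\<dots> = (1 + x) ^ k * (1 + y) ^ k * (1 + z) ^ k"
      unfolding b by (simp only: sum_distrib_left[symmetric] sum_distrib_right[symmetric])
    finally show ?thesis by (simp add: power_mult_distrib)
  qed
  then show ?thesis unfolding polynomial3_def
    by (intro exI[of _ "{..k} \<times> {..k} \<times> {..k}"] exI[of _ "\<lambda>i j l. ?b i * ?b j * ?b l"]) auto
qed

text \<open>The \<open>N ^ d \<le> d ^ (m * d)\<close> tests per table match exactly the
  \<open>d\<close> omitted entries per coordinate, as
  \<open>m * (d ^ d - d) + m * d = m * d ^ d\<close>.\<close>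

lemma diagonal_free_search_bound:
  assumes "1 \<le> d" "1 \<le> m" "N \<le> d ^ m"
  shows "d ^ (m * (d ^ d - d)) * (N ^ d + m * (d ^ d - d) + 1) \<le> (m + 2) * d ^ (m * d ^ d)"
    (is "_ * ?s \<le> _")
proof -
  have dd: "d \<le> d ^ d" using assms(1) by (simp add: self_le_power)
  have "N ^ d \<le> d ^ (m * d)" using power_mono[OF assms(3), of d] by (simp add: power_mult)
  moreover have "d ^ d - d \<le> d ^ (m * d)"
  proof -
    have "d ^ d \<le> d ^ (m * d)" using assms(1,2) by (intro power_increasing) auto
    then show ?thesis by simp
  qed
  then have "m * (d ^ d - d) \<le> m * d ^ (m * d)" by simp
  moreover have "1 \<le> d ^ (m * d)" using assms(1) by simp
  ultimately have "?s \<le> d ^ (m * d) + m * d ^ (m * d) + d ^ (m * d)" by linarith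
  also have "\<dots> = (m + 2) * d ^ (m * d)" by simp
  finally have "?s \<le> (m + 2) * d ^ (m * d)" .
  then have "d ^ (m * (d ^ d - d)) * ?s \<le> d ^ (m * (d ^ d - d)) * ((m + 2) * d ^ (m * d))"
    by (rule mult_le_mono2)
  also have "\<dots> = (m + 2) * d ^ (m * (d ^ d - d) + m * d)"
    by (simp only: power_add mult.left_commute)
  also have "m * (d ^ d - d) + m * d = m * d ^ d" using dd by (simp add: diff_mult_distrib2)
  finally show ?thesis .
qed

text \<open>For \<open>d \<ge> 3\<close> already \<open>d ^ 3 \<le> d ^ d\<close>. The constant 64
  is the number \<open>2 ^ (2 ^ 3 - 2)\<close> of tables for \<open>d = 2\<close>.\<close>

lemma ternary_search_bound:
  assumes "1 \<le> d" "1 \<le> m"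
  shows "d ^ (d ^ 3 - d) \<le> 64 * d ^ (m * d ^ d)"
proof -
  have 1: "1 \<le> d ^ (m * d ^ d)" using assms by simp
  consider "d = 1" | "d = 2" | "3 \<le> d" using assms by linarith
  then show ?thesis
  proof cases
    case 3
    have "d ^ 3 \<le> d ^ d" using 3 by (intro power_increasing) auto
    also have "\<dots> \<le> m * d ^ d" using assms by simp
    finally have "d ^ (d ^ 3 - d) \<le> d ^ (m * d ^ d)" using assms by (intro power_increasing) auto
    then show ?thesis by simp
  qed (use 1 in auto)
qed

section \<open>The decision procedure\<close>

text \<open>For \<open>m = 0\<close> the second search would exceed the time bound, which is then polynomial.\<close>

definition Main_Com :: com where
  "Main_Com = Read_Input ;;
     Cond (Reg 1) (
       Set_Reg 3 (Reg 0) ;; Set_Reg 4 (Reg 1) ;; Search ;;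
       Set_Reg 3 (Num 3) ;; Set_Reg 4 (Num 1) ;; Search)
       Skip"

definition Result :: expr where
  "Result = Minus (Num 1) (Reg 25)"

lemma wf_Main: "wf_com Main_Com" "ewf Result"
  by (simp_all add: Main_Com_def Result_def Read_Input_def Find_def Search_def Test_Table_def
      Test_Rows_def Odometer_def Dictators_def Member_def Eq_Row_def Image_Tuple_def Look_Up_def
      Code_Tuple_def Code_Step_def Mul_def Pow_def)

lemma card_tuples: "finite D \<Longrightarrow> card (tuples D m) = card D ^ m"
  using card_lists_length_eq[of D m] by (simp add: tuples_def conj_commute)

text \<open>Without coordinates every voter is vacuously a dictator.\<close>

lemma impossibility_domain_0: "impossibility_domain 0 X"
  by (auto simp: impossibility_domain_def dictatorship_def intro!: exI[of _ 0])

text \<open>The factor 3 in \<open>q\<close> covers the arity of the ternary search. This search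
  also explains the exponent and most of the constant: \<open>q ^ 3\<close> per test, at most
  \<open>3 * q ^ 3\<close> in place of \<open>N ^ 3 + V + 1\<close>, and
  \<open>10000 * 64 * 3 = 1920000\<close>.\<close>

lemma Main_Com:
  assumes D: "D \<noteq> {}" and X: "X \<subseteq> tuples D m"
    and ds: "distinct ds" "set ds = D" and xs: "distinct xs" "set xs = X"
  defines "s0 \<equiv> (encode_input ds m xs, \<lambda>_ _. 0)"
    and "d \<equiv> card D" and "N \<equiv> card X"
  defines "q \<equiv> 3 * ((1 + N) * (1 + m) * (1 + d))"
  shows "eval Result (snd (run Main_Com s0)) = (if impossibility_domain m X then 1 else 0)"
    "cost Main_Com s0 \<le> 3000000 * q ^ 6 * d ^ (m * d ^ d)"
proof -
  have len: "length ds = d" "length xs = N"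
    using ds xs by (simp_all add: d_def N_def distinct_card[symmetric])
  have finD: "finite D" using ds by auto
  have d1: "1 \<le> d" using D finD by (simp add: d_def Suc_le_eq card_gt_0_iff)
  have q: "3 \<le> q" "d \<le> q" "m \<le> q" "N \<le> q" "m + 2 \<le> q" by (simp_all add: q_def algebra_simps)
  have q1: "1 \<le> q" using q by simp
  have xsD: "set xs \<subseteq> tuples (set ds) m" using X ds xs by simp
  define s1 where "s1 = run Read_Input s0"
  have s1: "snd s1 0 0 = d" "snd s1 0 1 = m" "snd s1 0 2 = N" "snd s1 0 25 = 0"
    "\<forall>r<N. snd s1 3 r = r * m"
    "\<forall>i<N * m. snd s1 2 i < d \<and> ds ! snd s1 2 i = concat xs ! i"
    and cost1: "cost Read_Input s0 \<le> 1000 * q ^ 3"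
    using Read_Input[OF ds(1) xsD, of q] q q1 unfolding len s1_def s0_def by simp_all
  define E where "E = d ^ (m * d ^ d)"
  have E: "1 \<le> E" using d1 by (simp add: E_def)
  have qp: "q ^ 3 \<le> q ^ 6" "q ^ 4 \<le> q ^ 6" "1 \<le> q ^ 6"
    using q1 power_increasing[of 3 6 q] power_increasing[of 4 6 q] by simp_all
  have qE: "q ^ 6 \<le> q ^ 6 * E" using E by simp
  show "eval Result (snd (run Main_Com s0)) = (if impossibility_domain m X then 1 else 0)"
    "cost Main_Com s0 \<le> 3000000 * q ^ 6 * d ^ (m * d ^ d)"
  proof (atomize (full), cases "m = 0")
    case True
    have "cost Main_Com s0 \<le> 1000 * q ^ 3 + 20"
      using cost1 s1(2) True by (simp add: Main_Com_def s1_def)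
    also have "\<dots> \<le> 3000000 * q ^ 6 * E" using qp qE by linarith
    finally show "eval Result (snd (run Main_Com s0)) = (if impossibility_domain m X then 1 else 0) \<and>
      cost Main_Com s0 \<le> 3000000 * q ^ 6 * d ^ (m * d ^ d)"
      using s1 True by (simp add: impossibility_domain_0 Main_Com_def Result_def s1_def E_def)
  next
    case False
    then have m1: "1 \<le> m" by simp
    have lenx: "length x = m" if "x \<in> set xs" for x using that xsD by (auto simp: tuples_def)
    have loc: "coded_search d m N n M q (snd s1 2) ds xs"
      if "1 \<le> n" "n \<le> q" "1 \<le> M" "M \<le> q" for n M
    proof -
      interpret search d m N n M q "snd s1 2"
        by unfold_locales (use that d1 q q1 s1(6) in auto)
      show ?thesis
      proof
        show "ds ! row r j = xs ! r ! j" if "r < N" "j < m" for r j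
          unfolding row_def using s1(6) x_row[OF that] nth_concat_rect[OF lenx, of xs r j] that len by simp
      qed (use that ds len xsD in auto)
    qed
    interpret A: coded_search d m N d m q "snd s1 2" ds xs
      by (rule loc) (use d1 m1 q in auto)
    interpret B: coded_search d m N 3 1 q "snd s1 2" ds xs
      by (rule loc) (use q q1 in auto)
    define s2 where "s2 = run (Set_Reg 3 (Reg 0) ;; Set_Reg 4 (Reg 1)) s1"
    have ctxA: "A.ctx s2" using s1 by (simp add: A.ctx_def s2_def)
    define s3 where "s3 = run Search s2"
    have s3: "snd s3 0 25 = (if \<exists>c<d ^ A.V. A.good (digit d c) then 1 else 0)"
      using A.Search(1)[OF ctxA m1] s1(4) by (simp add: s2_def s3_def)
    have fr3: "snd s3 0 0 = d" "snd s3 0 1 = m" "snd s3 0 2 = N" "snd s3 3 = snd s1 3" "snd s3 2 = snd s1 2"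
      using s1 by (auto simp: s3_def s2_def run_frame)
    define s4 where "s4 = run (Set_Reg 3 (Num 3) ;; Set_Reg 4 (Num 1)) s3"
    have ctxB: "B.ctx s4" using fr3 s1(5) unfolding B.ctx_def s4_def by simp
    have s5: "snd (run Search s4) 0 25 = (if \<exists>c<d ^ B.V. B.good (digit d c) then 1 else snd s3 0 25)"
    proof -
      have "snd s4 0 25 = snd s3 0 25" by (simp add: s4_def)
      then show ?thesis using B.Search(1)[OF ctxB order_refl] by (simp only:)
    qed
    have T: "run Main_Com s0 = run Search s4"
      "cost Main_Com s0 = cost Read_Input s0 + 9 + 32 + cost Search s2 + 18 + cost Search s4"
      using s1(2) m1 by (simp_all add: Main_Com_def s1_def[symmetric] s2_def s3_def s4_def)
    have A: "(\<exists>c<d ^ A.V. A.good (digit d c)) \<longleftrightarrow> (\<exists>f. nondictatorial m X d f)"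
    proof -
      \<comment> \<open>With \<open>M = m\<close> the sharing condition in \<open>search_iff\<close>
        is vacuous.\<close>
      have "f j = f (min j (m - 1))" if "j < m" for f :: "nat \<Rightarrow> nat list \<Rightarrow> nat" and j
        using that by (simp add: min_absorb1)
      then show ?thesis unfolding A.search_iff xs(2) by blast
    qed
    have B: "(\<exists>c<d ^ B.V. B.good (digit d c)) \<longleftrightarrow> (\<exists>g. nondictatorial m X 3 (\<lambda>_. g))"
      unfolding B.search_iff xs(2)
    proof
      assume "\<exists>f. nondictatorial m X 3 f \<and> (\<forall>j<m. f j = f (min j (1 - 1)))"
      then obtain f where f: "nondictatorial m X 3 f" "\<forall>j<m. f j = f 0" by auto
      have "nondictatorial m X 3 (\<lambda>_. f 0)" by (rule nondictatorial_cong[OF f(1)]) (use f(2) in metis)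
      then show "\<exists>g. nondictatorial m X 3 (\<lambda>_. g)" by blast
    qed blast
    have "impossibility_domain m X \<longleftrightarrow>
        \<not> (\<exists>c<d ^ A.V. A.good (digit d c)) \<and> \<not> (\<exists>c<d ^ B.V. B.good (digit d c))"
      using impossibility_domain_search[OF finD D X, folded d_def] unfolding A B .
    then have res: "eval Result (snd (run Main_Com s0)) = (if impossibility_domain m X then 1 else 0)"
      unfolding T by (simp add: Result_def s5 s3)
    have "N \<le> d ^ m"
      using card_mono[OF _ X] card_tuples[OF finD, of m] finite_lists_length_eq[OF finD, of m]
      by (simp add: N_def d_def tuples_def conj_commute)
    from diagonal_free_search_bound[OF d1 m1 this]
    have "d ^ A.V * (N ^ d + A.V + 1) \<le> (m + 2) * E" by (simp add: A.V_def E_def)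
    also have "\<dots> \<le> q * E" using q(5) by (rule mult_le_mono1)
    finally have "10000 * q ^ 3 * (d ^ A.V * (N ^ d + A.V + 1)) \<le> 10000 * q ^ 3 * (q * E)"
      by (rule mult_le_mono2)
    also have "\<dots> = 10000 * (q ^ 4 * E)" using power_add[of q 3 1] by simp
    also have "\<dots> \<le> 10000 * (q ^ 6 * E)" using qp by simp
    finally have cA: "cost Search s2 \<le> 10000 * (q ^ 6 * E)"
      using A.Search(2)[OF ctxA m1] by linarith
    have "N ^ 3 \<le> q ^ 3" "d ^ 3 \<le> q ^ 3" "1 \<le> q ^ 3" using q q1 by (simp_all add: power_mono)
    moreover have V: "B.V = d ^ 3 - d" unfolding B.V_def by simp
    ultimately have "N ^ 3 + B.V + 1 \<le> 3 * q ^ 3" by linarith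
    moreover have "d ^ B.V \<le> 64 * E" using ternary_search_bound[OF d1 m1] unfolding V E_def .
    ultimately have "d ^ B.V * (N ^ 3 + B.V + 1) \<le> 64 * E * (3 * q ^ 3)" by (intro mult_le_mono)
    then have "10000 * q ^ 3 * (d ^ B.V * (N ^ 3 + B.V + 1)) \<le> 10000 * q ^ 3 * (64 * E * (3 * q ^ 3))"
      by (rule mult_le_mono2)
    also have "\<dots> = 1920000 * (q ^ 6 * E)" using power_add[of q 3 3] by simp
    finally have cB: "cost Search s4 \<le> 1920000 * (q ^ 6 * E)"
      using B.Search(2)[OF ctxB order_refl] by linarith
    have "cost Main_Com s0 \<le> 1000 * q ^ 6 + 59 + 10000 * (q ^ 6 * E) + 1920000 * (q ^ 6 * E)"
      unfolding T(2) using cost1 qp cA cB by linarith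
    also have "\<dots> \<le> 3000000 * (q ^ 6 * E)" using qp qE by linarith
    finally show "eval Result (snd (run Main_Com s0)) = (if impossibility_domain m X then 1 else 0) \<and>
      cost Main_Com s0 \<le> 3000000 * q ^ 6 * d ^ (m * d ^ d)"
      using res by (simp add: E_def)
  qed
qed

theorem theorem17:
  "\<exists>(P :: instr list) (C :: real) p. polynomial3 p \<and>
     (\<forall>(D :: nat set) (m :: nat) (X :: nat list set) ds xs.
        finite D \<and> D \<noteq> {} \<and> X \<subseteq> tuples D m \<and> enumerates ds D \<and> enumerates xs X \<longrightarrow>
        (\<exists>t. halts_within P (encode_input ds m xs) t (if impossibility_domain m X then 1 else 0) \<and>
             real t \<le> C * (p (real (card X)) (real m) (real (card D))
                            * real (card D) ^ (m * card D ^ card D))))"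
proof (intro exI conjI allI impI)
  let ?P = "ccode 0 0 Main_Com @ ecode 0 Result"
  let ?p = "\<lambda>x y z. ((1 + x) * (1 + y) * (1 + z)) ^ 6 :: real"
  \<comment> \<open>\<open>3 ^ 6\<close> comes from the factor 3 in \<open>q\<close>; the increase
    from 3000000 absorbs the evaluation of \<open>Result\<close>.\<close>
  let ?C = "4000000 * 3 ^ 6 :: real"
  show "polynomial3 ?p" by (rule polynomial3_power)
  fix D :: "nat set" and m :: nat and X :: "nat list set" and ds xs
  assume "finite D \<and> D \<noteq> {} \<and> X \<subseteq> tuples D m \<and> enumerates ds D \<and> enumerates xs X"
  then have *: "D \<noteq> {}" "X \<subseteq> tuples D m" "distinct ds" "set ds = D" "distinct xs" "set xs = X"
    by (auto simp: enumerates_def)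
  let ?s = "(encode_input ds m xs, \<lambda>_ _. 0) :: state"
  let ?q = "3 * ((1 + card X) * (1 + m) * (1 + card D))"
  let ?E = "card D ^ (m * card D ^ card D)"
  let ?t = "cost Main_Com ?s + ecost Result"
  note M = Main_Com[OF *]
  show "halts_within ?P (encode_input ds m xs) ?t (if impossibility_domain m X then 1 else 0)"
    using compiled_halts[OF wf_Main, of "encode_input ds m xs"] unfolding M(1) .
  have "finite D" using *(4) by auto
  then have "1 \<le> ?E" using *(1) by (simp add: Suc_le_eq card_gt_0_iff)
  then have "1 * 1 \<le> ?q ^ 6 * ?E" by (intro mult_le_mono) auto
  moreover have "ecost Result = 10" by (simp add: Result_def)
  ultimately have "?t \<le> 4000000 * ?q ^ 6 * ?E" using M(2) unfolding mult.assoc by linarith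
  then have "real ?t \<le> real (4000000 * ?q ^ 6 * ?E)" by (rule of_nat_mono)
  also have "\<dots> = ?C * (?p (real (card X)) (real m) (real (card D)) *
      real (card D) ^ (m * card D ^ card D))"
    by (simp only: of_nat_mult of_nat_power of_nat_add of_nat_1 of_nat_numeral power_mult_distrib mult.assoc)
  finally show "real ?t \<le> ?C * (?p (real (card X)) (real m) (real (card D)) *
      real (card D) ^ (m * card D ^ card D))" .
qed

end
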